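(* Let $f$ be of either ignition type or general KPP type. There are constants $C_1,C_2>0$ depending only on the reaction $f$ (more particularly, only on the constants $f_0$, $\zeta$ and $\theta_4-\theta_1$ described in the context) such that the following holds. Let $U,H,\kappa,v_0>0$ satisfy $$\frac{UH}\kappa\ge1,\qquad\frac lH\le1,\quad l=\frac\kappa{v_0}.$$ Let $\Omega=\mathbb R\times[0,\pi H]$ and $$u(x,y)=U\left(\sin\frac xH\cos\frac yH,\ -\cos\frac xH\sin\frac yH\right).$$ Let $T(x,y,t)$ solve $$T_t+u\cdot\nabla T=\kappa\Delta T+\frac{v_0^2}\kappa f(T)\ \text{ in }\Omega,\qquad T(x,y,0)=T_0(x,y),$$ with $T\to1$ as $x\to-\infty$, $T\to0$ as $x\to+\infty$, and either Neumann or periodic boundary conditions in $y$, where $T_0$ satisfies $\kappa\Delta T_0-u\cdot\nabla T_0+\frac{v_0^2}\kappa f(T_0)\ge0$ and, for some $\lambda>0$, $T_0=1-O(e^{\lambda x})$ for $x<0$, $T_0=O(e^{-\lambda x})$ for $x>0$, $|\nabla T_0|=O(e^{-\lambda|x|})$. Set $\tau_c=\kappa/v_0^2$ and $\tau_u=H/U$. Then for any time $t>0$ $$V(t)\ge\begin{cases}\left(C_1\sqrt{\dfrac{\tau_c}{\tau_u}}+C_2\right)v_0,&\tau_c\le\tau_u,\\[2mm]\left(C_1\left(\dfrac{\tau_c}{\tau_u}\right)^{1/5}+C_2\right)v_0,&\tau_c\ge\tau_u.\end{cases}$$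
   Context: The nonlinearity $f\in C^1[0,1]$ satisfies $f(0)=f(1)=0$, $f\ge0$ on $(0,1)$, $f\not\equiv0$. General KPP type: $f>0$ on $(0,1)$. Ignition type: for some $\theta_0\in(0,1)$, $f=0$ on $[0,\theta_0]$ and at $1$, $f>0$ on $(\theta_0,1)$. Fixed constants $\theta_4>\theta_1$, $f_0>0$, $\zeta>0$ are chosen with $f(\theta)>f_0$ for $\theta\in(\theta_1-\zeta,\theta_4+\zeta)\subset[0,1]$. Neumann conditions: $T_y=0$ at $y=0,\pi H$. Periodic conditions: $T$ is periodic in $y$ with period the strip width $\pi H$ (so $T$ and $T_y$ agree at $y=0$ and $y=\pi H$). Solutions satisfy $0\le T\le1$, and the exponential bounds on the initial data persist for each $t>0$ (with a constant depending on $t$). The differential inequality on $T_0$ guarantees $T_t\ge0$ for all $t$. Bulk burning rate: $V(t)=\int_\Omega T_t(x,y,t)\frac{dx\,dy}H$. *)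

theory Defs
  imports "HOL-Analysis.Analysis"
begin

definition reaction :: "(real \<Rightarrow> real) \<Rightarrow> bool" where
  "reaction f \<longleftrightarrow>
     (\<exists>f'. continuous_on {0..1} f' \<and>
           (\<forall>s\<in>{0..1}. (f has_real_derivative f' s) (at s within {0..1}))) \<and>
     f 0 = 0 \<and> f 1 = 0 \<and>
     (\<forall>s\<in>{0<..<1}. f s \<ge> 0) \<and>
     (\<exists>s\<in>{0..1}. f s \<noteq> 0)"

definition general_KPP_type :: "(real \<Rightarrow> real) \<Rightarrow> bool" where
  "general_KPP_type f \<longleftrightarrow> reaction f \<and> (\<forall>s\<in>{0<..<1}. f s > 0)"

definition ignition_type :: "(real \<Rightarrow> real) \<Rightarrow> bool" where
  "ignition_type f \<longleftrightarrow> reaction f \<and>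
     (\<exists>\<theta>\<^sub>0\<in>{0<..<1}. (\<forall>s\<in>{0..\<theta>\<^sub>0}. f s = 0) \<and> (\<forall>s\<in>{\<theta>\<^sub>0<..<1}. f s > 0))"

definition strip :: "real \<Rightarrow> (real \<times> real) set" where
  "strip H = UNIV \<times> {0..pi * H}"

(* Functions on the strip are curried functions g x y whose values for y outside {0..pi * H}
   are irrelevant; the y-derivative is therefore taken within {0..pi * H}, i.e. it is
   one-sided on the two boundary lines. *)
definition dx :: "(real \<Rightarrow> real \<Rightarrow> real) \<Rightarrow> real \<Rightarrow> real \<Rightarrow> real" where
  "dx g x y = deriv (\<lambda>s. g s y) x"

definition dy :: "real \<Rightarrow> (real \<Rightarrow> real \<Rightarrow> real) \<Rightarrow> real \<Rightarrow> real \<Rightarrow> real" where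
  "dy H g x y = vector_derivative (\<lambda>s. g x s) (at y within {0..pi * H})"

definition dt :: "(real \<Rightarrow> real \<Rightarrow> real \<Rightarrow> real) \<Rightarrow> real \<Rightarrow> real \<Rightarrow> real \<Rightarrow> real" where
  "dt T x y t = deriv (\<lambda>s. T x y s) t"

definition grad :: "real \<Rightarrow> (real \<Rightarrow> real \<Rightarrow> real) \<Rightarrow> real \<Rightarrow> real \<Rightarrow> real \<times> real" where
  "grad H g x y = (dx g x y, dy H g x y)"

definition laplacian :: "real \<Rightarrow> (real \<Rightarrow> real \<Rightarrow> real) \<Rightarrow> real \<Rightarrow> real \<Rightarrow> real" where
  "laplacian H g x y = dx (dx g) x y + dy H (dy H g) x y"

definition twice_differentiable_strip :: "real \<Rightarrow> (real \<Rightarrow> real \<Rightarrow> real) \<Rightarrow> bool" where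
  "twice_differentiable_strip H g \<longleftrightarrow>
     (\<forall>(x, y)\<in>strip H.
        (\<lambda>s. g s y) differentiable (at x) \<and>
        (\<lambda>s. dx g s y) differentiable (at x) \<and>
        (\<lambda>s. g x s) differentiable (at y within {0..pi * H}) \<and>
        (\<lambda>s. dy H g x s) differentiable (at y within {0..pi * H}))"

(* Only the derivatives that occur in the equation are required to exist and be continuous;
   no condition on the mixed derivative. *)
definition C2_strip :: "real \<Rightarrow> (real \<Rightarrow> real \<Rightarrow> real) \<Rightarrow> bool" where
  "C2_strip H g \<longleftrightarrow> twice_differentiable_strip H g \<and>
     (\<forall>h\<in>{g, dx g, dy H g, dx (dx g), dy H (dy H g)}.
        continuous_on (strip H) (\<lambda>(x, y). h x y))"

(* The classical parabolic class C^{2,1} for t > 0, continuous up to t = 0. *)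
definition C21_strip :: "real \<Rightarrow> (real \<Rightarrow> real \<Rightarrow> real \<Rightarrow> real) \<Rightarrow> bool" where
  "C21_strip H T \<longleftrightarrow>
     continuous_on (strip H \<times> {0..}) (\<lambda>((x, y), t). T x y t) \<and>
     (\<forall>t>0. twice_differentiable_strip H (\<lambda>x y. T x y t)) \<and>
     (\<forall>(x, y)\<in>strip H. \<forall>t>0. (\<lambda>s. T x y s) differentiable (at t)) \<and>
     (\<forall>h\<in>{dt T,
           \<lambda>x y t. dx (\<lambda>x y. T x y t) x y,
           \<lambda>x y t. dy H (\<lambda>x y. T x y t) x y,
           \<lambda>x y t. dx (dx (\<lambda>x y. T x y t)) x y,
           \<lambda>x y t. dy H (dy H (\<lambda>x y. T x y t)) x y}.
        continuous_on (strip H \<times> {0<..}) (\<lambda>((x, y), t). h x y t))"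

definition cell_flow :: "real \<Rightarrow> real \<Rightarrow> real \<Rightarrow> real \<Rightarrow> real \<times> real" where
  "cell_flow U H x y = U *\<^sub>R (sin (x / H) * cos (y / H), - (cos (x / H) * sin (y / H)))"

definition neumann_bc :: "real \<Rightarrow> (real \<Rightarrow> real \<Rightarrow> real) \<Rightarrow> bool" where
  "neumann_bc H g \<longleftrightarrow> (\<forall>x. dy H g x 0 = 0 \<and> dy H g x (pi * H) = 0)"

(* Period pi * H is the width of the strip. The cell flow itself is not pi * H-periodic in y,
   so second derivatives need not match across the identified boundary lines. *)
definition periodic_bc :: "real \<Rightarrow> (real \<Rightarrow> real \<Rightarrow> real) \<Rightarrow> bool" where
  "periodic_bc H g \<longleftrightarrow>
     (\<forall>x. g x 0 = g x (pi * H) \<and> dy H g x 0 = dy H g x (pi * H))"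

definition admissible_initial_data ::
    "(real \<Rightarrow> real) \<Rightarrow> real \<Rightarrow> real \<Rightarrow> real \<Rightarrow> real \<Rightarrow>
     ((real \<Rightarrow> real \<Rightarrow> real) \<Rightarrow> bool) \<Rightarrow> (real \<Rightarrow> real \<Rightarrow> real) \<Rightarrow> bool" where
  "admissible_initial_data f U H \<kappa> v\<^sub>0 bc T\<^sub>0 \<longleftrightarrow>
     C2_strip H T\<^sub>0 \<and> bc T\<^sub>0 \<and>
     (\<forall>(x, y)\<in>strip H.
        \<kappa> * laplacian H T\<^sub>0 x y - cell_flow U H x y \<bullet> grad H T\<^sub>0 x y
          + v\<^sub>0\<^sup>2 / \<kappa> * f (T\<^sub>0 x y) \<ge> 0) \<and>
     (\<exists>\<mu>>0. \<exists>C. \<forall>(x, y)\<in>strip H.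
        (x < 0 \<longrightarrow> \<bar>1 - T\<^sub>0 x y\<bar> \<le> C * exp (\<mu> * x)) \<and>
        (x > 0 \<longrightarrow> \<bar>T\<^sub>0 x y\<bar> \<le> C * exp (- \<mu> * x)) \<and>
        norm (grad H T\<^sub>0 x y) \<le> C * exp (- \<mu> * \<bar>x\<bar>))"

(* The bound 0 \<le> T \<le> 1 belongs to the notion of solution, as f is only given on {0..1}. *)
definition solves_reaction_advection_diffusion ::
    "(real \<Rightarrow> real) \<Rightarrow> real \<Rightarrow> real \<Rightarrow> real \<Rightarrow> real \<Rightarrow>
     ((real \<Rightarrow> real \<Rightarrow> real) \<Rightarrow> bool) \<Rightarrow> (real \<Rightarrow> real \<Rightarrow> real) \<Rightarrow>
     (real \<Rightarrow> real \<Rightarrow> real \<Rightarrow> real) \<Rightarrow> bool" where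
  "solves_reaction_advection_diffusion f U H \<kappa> v\<^sub>0 bc T\<^sub>0 T \<longleftrightarrow>
     C21_strip H T \<and>
     (\<forall>(x, y)\<in>strip H. \<forall>t\<ge>0. 0 \<le> T x y t \<and> T x y t \<le> 1) \<and>
     (\<forall>(x, y)\<in>strip H. \<forall>t>0.
        dt T x y t + cell_flow U H x y \<bullet> grad H (\<lambda>x y. T x y t) x y =
          \<kappa> * laplacian H (\<lambda>x y. T x y t) x y + v\<^sub>0\<^sup>2 / \<kappa> * f (T x y t)) \<and>
     (\<forall>(x, y)\<in>strip H. T x y 0 = T\<^sub>0 x y) \<and>
     (\<forall>t>0. bc (\<lambda>x y. T x y t)) \<and>
     (\<forall>t>0. \<forall>y\<in>{0..pi * H}.
        ((\<lambda>x. T x y t) \<longlongrightarrow> 1) at_bot \<and> ((\<lambda>x. T x y t) \<longlongrightarrow> 0) at_top)"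

(* The Bochner integral of a non-integrable function is 0, so a positive lower bound on this
   quantity entails that the time derivative is integrable over the strip. *)
definition bulk_burning_rate ::
    "real \<Rightarrow> (real \<Rightarrow> real \<Rightarrow> real \<Rightarrow> real) \<Rightarrow> real \<Rightarrow> real" where
  "bulk_burning_rate H T t = (LINT p:strip H|lborel. dt T (fst p) (snd p) t / H)"

end

theory Submission
  imports Defs
begin

text \<open>
  Rescaling lengths by $H$ turns the equation into $T_t + a u \cdot\nabla T = b \Delta T + c f(T)$ on a
  strip of width $\pi$, with $a = U/H$, $b = \kappa/H^2$, $c = v_0^2/\kappa$. By comparison $T_t \ge 0$ and
  the exponential tails persist. Integrating the equation, and the equation multiplied by $1 - T$, at a
  fixed time shows that $V = \int T_t$ bounds both $\int c f(T)$ and $\int b |\nabla T|^2$.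

  On every horizontal line $T$ crosses $[\theta_1,\theta_4]$, so AM-GM on $b T_x^2 + c f(T)$ gives
  $V \ge \pi \sqrt{b c f_0} (\theta_4 - \theta_1)$, which settles $\tau_c \le \tau_u$.

  If $b \le c \le a$, put $e = |\nabla T|^2 + (c f(T) + T_t)/b$ and let $\psi = \sin x \sin y$ be the stream
  function. Testing the equation with a bump in $\psi/\eta$, $\eta \sim \sqrt{b/a}$, which is annihilated by
  $u \cdot \nabla$, shows that the mean of $T$ over the tube of streamlines of width $\eta$ at the bottom of
  the strip is almost constant along each cell, and that the square of its jump from one cell to the next
  is at most a multiple of $\eta\int e$: on the vertical separatrix between two cells the tubes touch, and
  there the bump times $u_2$ is an $x$-derivative of size $\eta$. A cell whose mean lies in
  $[\theta_1,\theta_4]$ carries energy $\int e$ at least a multiple of $\sqrt{c/b}$, because otherwise $T$ stays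
  near this mean on some column of height $\sqrt{b/c}$, which then burns. If the front passes $n$ such cells,
  the total energy is at least a multiple of $n \sqrt{c/b}$ and of $\sqrt{a/b}/(n + 1)$, hence of
  $(a/b)^{1/4} (c/b)^{1/4}$. As $a/c = \tau_c/\tau_u$, this yields the exponent $1/4 \ge 1/5$.
\<close>

section \<open>Comparison principle on a strip\<close>

text \<open>The bump is odd: \<psi> and the horizontal velocity change sign together at a
  separatrix, so their product keeps its sign, and the fluxes through the middles of two
  neighbouring cells are, up to diffusion, the same multiple \<eta>\<alpha>/6 of weighted means of T
  with positive weights. All testing takes place in the lower half of the strip: the bump vanishes
  on the bottom line, so both boundary conditions can be treated alike. The price is a cut through
  the vertical part of the tube, whose advective flux is of size \<alpha>\<eta> and not small by
  itself; oddness turns it into a difference of T across the separatrix. Relative to \<alpha>\<eta>,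
  diffusion errs by b sqrt(E/\<eta>)/(\<alpha>\<eta>) and the cut by sqrt(\<eta>E); they balance
  when \<eta>^2 \<alpha> is comparable with b. A cell of large energy has no useful relation between
  its mean and the values of T, but it already pays; means and values are compared only in quiet
  cells. The Lipschitz constant of f and the constants of the tails give finite integrals and limits
  but do not enter the final bounds, so these depend on f only through f_0, \<zeta> and \<theta>4 -
  \<theta>1.\<close>

lemma second_derivative_nonneg_at_min_right:
  fixes g g' :: "real \<Rightarrow> real"
  assumes "p < q" "q \<le> l"
    and g: "\<And>s. s \<in> {p..l} \<Longrightarrow> (g has_real_derivative g' s) (at s within {p..l})"
    and g': "(g' has_real_derivative D) (at p within {p..l})"
    and "g' p = 0" and min: "\<And>s. s \<in> {p..q} \<Longrightarrow> g p \<le> g s"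
  shows "D \<ge> 0"
proof (rule ccontr)
  assume "\<not> D \<ge> 0"
  then obtain d where d: "d > 0" "\<And>h. h > 0 \<Longrightarrow> p + h \<in> {p..l} \<Longrightarrow> h < d \<Longrightarrow> g' (p + h) < g' p"
    using has_real_derivative_neg_dec_right[OF g'] by auto
  define r where "r = min q (p + d / 2)"
  have r: "p < r" "r \<le> q" "r < p + d" using assms(1) d(1) by (auto simp: r_def)
  have "\<exists>x\<in>{p<..<r}. g r - g p = g' x * (r - p)"
  proof (rule mvt_simple)
    fix x assume "p \<le> x" "x \<le> r"
    then have "(g has_real_derivative g' x) (at x within {p..r})"
      using r assms(2) by (intro DERIV_subset[OF g]) auto
    then show "(g has_derivative (*) (g' x)) (at x within {p..r})"
      by (simp add: has_field_derivative_def)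
  qed (use r in auto)
  then obtain x where x: "p < x" "x < r" "g r - g p = g' x * (r - p)" by auto
  have "g' x < 0" using d(2)[of "x - p"] x r assms by auto
  then have "g r < g p" using x r by (smt (verit) mult_neg_pos)
  then show False using min[of r] r by auto
qed

text \<open>Reflection s -> -s: the first derivative changes sign and the second changes it back.
  One-sided forms are needed since a minimum may sit on a boundary line, where only one-sided
  derivatives exist.\<close>

lemma second_derivative_nonneg_at_min_left:
  fixes g g' :: "real \<Rightarrow> real"
  assumes "q < p" "l \<le> q"
    and g: "\<And>s. s \<in> {l..p} \<Longrightarrow> (g has_real_derivative g' s) (at s within {l..p})"
    and g': "(g' has_real_derivative D) (at p within {l..p})"
    and "g' p = 0" and min: "\<And>s. s \<in> {q..p} \<Longrightarrow> g p \<le> g s"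
  shows "D \<ge> 0"
proof (rule second_derivative_nonneg_at_min_right)
  have im: "uminus ` {-p..-l} = {l..p}" by auto
  show "((\<lambda>s. g (- s)) has_real_derivative - g' (- s)) (at s within {-p..-l})"
    if "s \<in> {-p..-l}" for s
  proof -
    have "((g \<circ> uminus) has_real_derivative g' (- s) * (-1)) (at s within {-p..-l})"
      by (rule DERIV_image_chain) (use that in \<open>auto simp: im intro!: g derivative_eq_intros\<close>)
    then show ?thesis by (simp add: o_def)
  qed
  have "((g' \<circ> uminus) has_real_derivative D * (-1)) (at (-p) within {-p..-l})"
    by (rule DERIV_image_chain) (auto simp: im intro!: g' derivative_eq_intros)
  from DERIV_minus[OF this]
  show "((\<lambda>s. - g' (- s)) has_real_derivative D) (at (-p) within {-p..-l})"
    by (simp add: o_def)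
  show "- p < - q" "- q \<le> - l" "- g' (- (- p)) = 0" using assms by auto
  show "g (- (- p)) \<le> g (- s)" if "s \<in> {-p..-q}" for s
    using min[of "- s"] that by auto
qed

lemma derivative_nonpos_at_min_left:
  fixes g :: "real \<Rightarrow> real"
  assumes g: "(g has_real_derivative D) (at p within S)" and "{q..p} \<subseteq> S" "q < p"
    and min: "\<And>s. s \<in> {q..p} \<Longrightarrow> g p \<le> g s"
  shows "D \<le> 0"
proof (rule ccontr)
  assume "\<not> D \<le> 0"
  then obtain d where d: "d > 0" "\<And>h. h > 0 \<Longrightarrow> p - h \<in> S \<Longrightarrow> h < d \<Longrightarrow> g (p - h) < g p"
    using has_real_derivative_pos_inc_left[OF g] by auto
  define h where "h = min (p - q) (d / 2)"
  have h: "h > 0" "p - h \<in> {q..p}" "h < d" using d(1) assms(3) by (auto simp: h_def)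
  moreover have "p - h \<in> S" using h(2) assms(2) by blast
  ultimately show False using d(2)[of h] min[of "p - h"] by auto
qed

lemma derivative_nonneg_at_min_right:
  fixes g :: "real \<Rightarrow> real"
  assumes g: "(g has_real_derivative D) (at p within S)" and "{p..q} \<subseteq> S" "p < q"
    and min: "\<And>s. s \<in> {p..q} \<Longrightarrow> g p \<le> g s"
  shows "D \<ge> 0"
proof (rule ccontr)
  assume "\<not> D \<ge> 0"
  then obtain d where d: "d > 0" "\<And>h. h > 0 \<Longrightarrow> p + h \<in> S \<Longrightarrow> h < d \<Longrightarrow> g (p + h) < g p"
    using has_real_derivative_neg_dec_right[OF g] by auto
  define h where "h = min (q - p) (d / 2)"
  have h: "h > 0" "p + h \<in> {p..q}" "h < d" using d(1) assms(3) by (auto simp: h_def)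
  moreover have "p + h \<in> S" using h(2) assms(2) by blast
  ultimately show False using d(2)[of h] min[of "p + h"] by auto
qed

text \<open>Since the equation holds up to the boundary lines, a minimum there has vanishing normal
  derivative by the boundary condition, and no Hopf lemma is needed.\<close>

lemma comparison_strip:
  fixes W Wx Wy Wxx Wyy Wt :: "real \<Rightarrow> real \<times> real \<Rightarrow> real"
  assumes pos: "\<tau> > 0" "l > 0" "b \<ge> 0" "a \<ge> 0" "L \<ge> 0"
    and cont: "continuous_on ({0..\<tau>} \<times> (UNIV \<times> {0..l})) (\<lambda>(t, p). W t p)"
    and bdd: "\<And>t x y. t \<in> {0..\<tau>} \<Longrightarrow> y \<in> {0..l} \<Longrightarrow> W t (x, y) \<ge> - B"
    and init: "\<And>x y. y \<in> {0..l} \<Longrightarrow> W 0 (x, y) \<ge> 0"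
    and Wt: "\<And>t x y. t \<in> {0<..\<tau>} \<Longrightarrow> y \<in> {0..l} \<Longrightarrow>
      ((\<lambda>s. W s (x, y)) has_real_derivative Wt t (x, y)) (at t)"
    and Wx: "\<And>t x y. t \<in> {0<..\<tau>} \<Longrightarrow> y \<in> {0..l} \<Longrightarrow>
      ((\<lambda>s. W t (s, y)) has_real_derivative Wx t (x, y)) (at x)"
    and Wxx: "\<And>t x y. t \<in> {0<..\<tau>} \<Longrightarrow> y \<in> {0..l} \<Longrightarrow>
      ((\<lambda>s. Wx t (s, y)) has_real_derivative Wxx t (x, y)) (at x)"
    and Wy: "\<And>t x y. t \<in> {0<..\<tau>} \<Longrightarrow> y \<in> {0..l} \<Longrightarrow>
      ((\<lambda>s. W t (x, s)) has_real_derivative Wy t (x, y)) (at y within {0..l})"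
    and Wyy: "\<And>t x y. t \<in> {0<..\<tau>} \<Longrightarrow> y \<in> {0..l} \<Longrightarrow>
      ((\<lambda>s. Wy t (x, s)) has_real_derivative Wyy t (x, y)) (at y within {0..l})"
    and bc: "\<And>t x. t \<in> {0<..\<tau>} \<Longrightarrow>
      (Wy t (x, 0) = 0 \<and> Wy t (x, l) = 0) \<or> (W t (x, 0) = W t (x, l) \<and> Wy t (x, 0) = Wy t (x, l))"
    and vx: "\<And>p. \<bar>vx p\<bar> \<le> a"
    and super: "\<And>t x y. t \<in> {0<..\<tau>} \<Longrightarrow> y \<in> {0..l} \<Longrightarrow> W t (x, y) < 0 \<Longrightarrow>
      Wt t (x, y) + (vx (x, y) * Wx t (x, y) + vy (x, y) * Wy t (x, y))
        - b * (Wxx t (x, y) + Wyy t (x, y)) \<ge> L * W t (x, y)"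
    and t: "t \<in> {0..\<tau>}" and y: "y \<in> {0..l}"
  shows "W t (x, y) \<ge> 0"
proof (rule ccontr)
  assume neg: "\<not> W t (x, y) \<ge> 0"
  \<comment> \<open>The barrier exp(\<Lambda> t)(1 + x^2) has to outgrow all that works against it:
    transport costs at most a because 2|x| \<le> 1 + x^2, diffusion 2 b, the zero-order term L; the
    last 1 makes the inequality strict.\<close>
  define \<Lambda> where "\<Lambda> = a + 2 * b + L + 1"
  define \<rho> where "\<rho> = (\<lambda>(s::real, p::real \<times> real). exp (\<Lambda> * s) * (1 + (fst p)\<^sup>2))"
  have one: "1 + z\<^sup>2 > 0" for z :: real by (smt (verit) zero_le_power2)
  have two: "2 * \<bar>z\<bar> \<le> 1 + z\<^sup>2" for z :: real
    using zero_le_power2[of "\<bar>z\<bar> - 1"] by (simp add: power2_diff)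
  have \<rho>pos: "\<rho> q > 0" for q by (auto simp: \<rho>_def one split: prod.split)
  \<comment> \<open>W is bounded below and the barrier grows, so Y cannot be very negative for large
    |x|; hence a negative infimum is attained although the strip is unbounded.\<close>
  define Y where "Y = (\<lambda>(s, p). W s p / \<rho> (s, p))"
  have \<Lambda>: "\<Lambda> > 0" using pos by (auto simp: \<Lambda>_def)
  have Y0: "Y (t, (x, y)) < 0" using neg \<rho>pos[of "(t, (x, y))"] by (auto simp: Y_def divide_neg_pos)
  define X where "X = \<bar>x\<bar> + \<bar>B\<bar> / (- Y (t, (x, y))) + 1"
  have BY: "\<bar>B\<bar> / (- Y (t, (x, y))) \<ge> 0" using Y0 by (intro divide_nonneg_pos) auto
  have far: "Y (s, (z, w)) > Y (t, (x, y))" if "s \<in> {0..\<tau>}" "w \<in> {0..l}" "\<bar>z\<bar> \<ge> X" for s z w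
  proof -
    let ?Y = "Y (t, (x, y))"
    have "- B \<le> W s (z, w)" using bdd that by auto
    then have "- \<bar>B\<bar> \<le> W s (z, w)" by auto
    have X1: "X \<ge> 1" "X > \<bar>B\<bar> / (- ?Y)" using BY by (simp_all add: X_def)
    have "\<bar>B\<bar> < X * (- ?Y)" using X1(2) Y0 by (subst (asm) divide_less_eq) auto
    also have "X \<le> 1 + z\<^sup>2"
      using that(3) two[of z] X1 by auto
    then have "X * (- ?Y) \<le> (1 + z\<^sup>2) * (- ?Y)" using Y0 by (intro mult_right_mono) auto
    also have "\<dots> \<le> \<rho> (s, (z, w)) * (- ?Y)"
      using Y0 that \<Lambda> by (intro mult_right_mono) (auto simp: \<rho>_def one)
    finally have "W s (z, w) > \<rho> (s, (z, w)) * ?Y" using \<open>- \<bar>B\<bar> \<le> W s (z, w)\<close> by auto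
    then show ?thesis using \<rho>pos[of "(s, (z, w))"] by (auto simp: Y_def pos_less_divide_eq mult.commute)
  qed
  let ?C = "{0..\<tau>} \<times> ({-X..X} \<times> {0..l})"
  have X0: "X \<ge> \<bar>x\<bar>" using BY by (simp add: X_def)
  have contY: "continuous_on ?C Y"
    unfolding Y_def case_prod_beta'
  proof (intro continuous_on_divide)
    show "continuous_on ?C (\<lambda>q. W (fst q) (snd q))"
      using continuous_on_subset[OF cont, of ?C] by (auto simp: case_prod_beta')
    show "continuous_on ?C (\<lambda>q. \<rho> (fst q, snd q))"
      unfolding \<rho>_def by (auto intro!: continuous_intros simp: case_prod_beta')
    show "\<forall>q\<in>?C. \<rho> (fst q, snd q) \<noteq> 0"
    proof
      fix q show "\<rho> (fst q, snd q) \<noteq> 0" using \<rho>pos[of "(fst q, snd q)"] by linarith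
    qed
  qed
  have "(t, (x, y)) \<in> ?C" using t y X0 by auto
  then have "?C \<noteq> {}" by blast
  moreover have "compact ?C" by (intro compact_Times) auto
  ultimately have "\<exists>q\<in>?C. \<forall>r\<in>?C. Y q \<le> Y r"
    using contY by (intro continuous_attains_inf)
  then obtain q where q: "q \<in> ?C" "\<And>r. r \<in> ?C \<Longrightarrow> Y q \<le> Y r" by metis
  obtain t1 x1 y1 where q1: "q = (t1, (x1, y1))" by (metis prod.exhaust)
  \<comment> \<open>For this \<epsilon> the function W + \<epsilon> \<rho> is nonnegative and
    vanishes at q, so the first and second order conditions for a minimum apply to it there.\<close>
  define \<epsilon> where "\<epsilon> = - Y q"
  have tC: "(t, (x, y)) \<in> ?C" using t y X0 by auto
  have \<epsilon>: "\<epsilon> > 0" using q(2)[OF tC] Y0 by (auto simp: \<epsilon>_def)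
  have Ymin: "Y q \<le> Y (s, (z, w))" if "s \<in> {0..\<tau>}" "w \<in> {0..l}" for s z w
  proof (cases "\<bar>z\<bar> \<le> X")
    case True
    then have "(s, (z, w)) \<in> ?C" using that by auto
    then show ?thesis by (rule q(2))
  next
    case False then show ?thesis using far[of s w z] q(2)[OF tC] that by auto
  qed
  have Z: "W s (z, w) + \<epsilon> * \<rho> (s, (z, w)) \<ge> 0" if "s \<in> {0..\<tau>}" "w \<in> {0..l}" for s z w
    using Ymin[OF that, of z] \<rho>pos[of "(s, (z, w))"]
    by (auto simp: Y_def \<epsilon>_def pos_le_divide_eq)
  have Z0: "W t1 (x1, y1) + \<epsilon> * \<rho> (t1, (x1, y1)) = 0"
    using \<rho>pos[of q] by (auto simp: Y_def \<epsilon>_def q1)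
  have Wneg: "W t1 (x1, y1) < 0" using Z0 \<epsilon> \<rho>pos by (smt (verit) mult_pos_pos)
  have y1: "y1 \<in> {0..l}" and t1': "t1 \<in> {0..\<tau>}" using q(1) by (auto simp: q1)
  have t1: "t1 \<in> {0<..\<tau>}" using t1' init[OF y1, of x1] Wneg by (cases "t1 = 0") auto
  define R where "R = \<rho> (t1, (x1, y1))"
  have R: "R > 0" by (simp add: R_def \<rho>pos)
  \<comment> \<open>Only times before t1 are compared, as t1 may equal \<tau>; hence an inequality
    and not an equation.\<close>
  have dt: "Wt t1 (x1, y1) + \<epsilon> * \<Lambda> * R \<le> 0"
  proof (rule derivative_nonpos_at_min_left)
    show "((\<lambda>s. W s (x1, y1) + \<epsilon> * \<rho> (s, (x1, y1))) has_real_derivative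
      Wt t1 (x1, y1) + \<epsilon> * \<Lambda> * R) (at t1 within UNIV)"
      unfolding \<rho>_def R_def by (auto intro!: derivative_eq_intros Wt t1 y1)
    show "0 < t1" using t1 by auto
    show "W t1 (x1, y1) + \<epsilon> * \<rho> (t1, (x1, y1)) \<le> W s (x1, y1) + \<epsilon> * \<rho> (s, (x1, y1))"
      if "s \<in> {0..t1}" for s
      using Z[of s y1 x1] that t1 y1 Z0 by auto
  qed auto
  let ?e = "exp (\<Lambda> * t1)"
  have X1: "((\<lambda>s. W t1 (s, y1) + \<epsilon> * \<rho> (t1, (s, y1))) has_real_derivative
      Wx t1 (s, y1) + \<epsilon> * ?e * 2 * s) (at s)" for s
    unfolding \<rho>_def by (auto intro!: derivative_eq_intros Wx t1 y1)
  have X2: "((\<lambda>s. Wx t1 (s, y1) + \<epsilon> * ?e * 2 * s) has_real_derivative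
      Wxx t1 (s, y1) + \<epsilon> * ?e * 2) (at s)" for s
    by (auto intro!: derivative_eq_intros Wxx t1 y1)
  have x0: "Wx t1 (x1, y1) + \<epsilon> * ?e * 2 * x1 = 0"
    by (rule DERIV_local_min[OF X1 zero_less_one]) (use Z Z0 t1 y1 in auto)
  have xx: "Wxx t1 (x1, y1) + \<epsilon> * ?e * 2 \<ge> 0"
    by (rule second_derivative_nonneg_at_min_right
        [OF _ _ has_field_derivative_at_within[OF X1] has_field_derivative_at_within[OF X2] x0,
         of "x1 + 1" "x1 + 1"]) (use Z Z0 t1 y1 in auto)
  define g where "g = (\<lambda>s. W t1 (x1, s) + \<epsilon> * \<rho> (t1, (x1, s)))"
  have \<rho>y: "\<rho> (t1, (x1, s)) = R" for s by (auto simp: \<rho>_def R_def)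
  have g: "(g has_real_derivative Wy t1 (x1, s)) (at s within {0..l})" if "s \<in> {0..l}" for s
    unfolding g_def \<rho>y by (auto intro!: derivative_eq_intros Wy t1 that)
  have gmin: "g s \<ge> 0" if "s \<in> {0..l}" for s unfolding g_def using Z that t1 by auto
  have g0: "g y1 = 0" unfolding g_def using Z0 by auto
  have right: "Wy t1 (x1, s) \<ge> 0" if "g s = 0" "0 \<le> s" "s < l" for s
    by (rule derivative_nonneg_at_min_right[OF g, of s l]) (use that gmin in auto)
  have left: "Wy t1 (x1, s) \<le> 0" if "g s = 0" "0 < s" "s \<le> l" for s
    by (rule derivative_nonpos_at_min_left[OF g, of s 0]) (use that gmin in auto)
  \<comment> \<open>Under the periodic condition a minimum on one boundary line is also one on the
    other; the derivative is nonnegative at 0, nonpositive at l, and the two agree, so both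
    vanish.\<close>
  have y0: "Wy t1 (x1, y1) = 0"
  proof (cases "0 < y1 \<and> y1 < l")
    case True
    then show ?thesis using left[OF g0] right[OF g0] by auto
  next
    case False
    then have ends: "y1 = 0 \<or> y1 = l" using y1 by auto
    from bc[OF t1, of x1] show ?thesis
    proof
      assume "W t1 (x1, 0) = W t1 (x1, l) \<and> Wy t1 (x1, 0) = Wy t1 (x1, l)"
      moreover from this have "g 0 = 0" "g l = 0" using ends g0 by (auto simp: g_def \<rho>y)
      ultimately show ?thesis using left[of l] right[of 0] pos(2) ends by auto
    qed (use ends in auto)
  qed
  have yy: "Wyy t1 (x1, y1) \<ge> 0"
  proof (cases "y1 < l")
    case True
    show ?thesis
    proof (rule second_derivative_nonneg_at_min_right)
      show "(g has_real_derivative Wy t1 (x1, s)) (at s within {y1..l})" if "s \<in> {y1..l}" for s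
        using y1 that by (intro DERIV_subset[OF g]) auto
      show "((\<lambda>s. Wy t1 (x1, s)) has_real_derivative Wyy t1 (x1, y1)) (at y1 within {y1..l})"
        using y1 by (intro DERIV_subset[OF Wyy[OF t1 y1]]) auto
    qed (use True y0 gmin g0 y1 in auto)
  next
    case False
    show ?thesis
    proof (rule second_derivative_nonneg_at_min_left)
      show "(g has_real_derivative Wy t1 (x1, s)) (at s within {0..y1})" if "s \<in> {0..y1}" for s
        using y1 that by (intro DERIV_subset[OF g]) auto
      show "((\<lambda>s. Wy t1 (x1, s)) has_real_derivative Wyy t1 (x1, y1)) (at y1 within {0..y1})"
        using y1 by (intro DERIV_subset[OF Wyy[OF t1 y1]]) auto
    qed (use False pos(2) y0 gmin g0 y1 in auto)
  qed
  have RE: "R = ?e * (1 + x1\<^sup>2)" by (simp add: R_def \<rho>_def)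
  have eR: "?e \<le> R" unfolding RE by simp
  have "\<bar>2 * x1\<bar> \<le> 1 + x1\<^sup>2" using two[of x1] by (simp add: abs_mult)
  then have xR: "?e * \<bar>2 * x1\<bar> \<le> R" unfolding RE by (intro mult_left_mono) auto
  have "Wx t1 (x1, y1) = - (\<epsilon> * (?e * (2 * x1)))" using x0 by (simp add: mult.assoc)
  then have "vx (x1, y1) * Wx t1 (x1, y1) = - (\<epsilon> * (vx (x1, y1) * (?e * (2 * x1))))"
    by simp
  also have "\<dots> \<le> \<epsilon> * (a * R)"
  proof -
    have "\<bar>vx (x1, y1) * (?e * (2 * x1))\<bar> \<le> a * R"
      unfolding abs_mult[of "vx (x1, y1)"] using vx xR pos
      by (intro mult_mono) (auto simp: abs_mult)
    then have "\<epsilon> * (- (vx (x1, y1) * (?e * (2 * x1)))) \<le> \<epsilon> * (a * R)"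
      using \<epsilon> by (intro mult_left_mono) auto
    then show ?thesis by simp
  qed
  finally have A: "vx (x1, y1) * Wx t1 (x1, y1) \<le> \<epsilon> * (a * R)" .
  have "Wxx t1 (x1, y1) + Wyy t1 (x1, y1) \<ge> - (2 * \<epsilon> * R)"
  proof -
    have "\<epsilon> * ?e * 2 \<le> 2 * \<epsilon> * R" using mult_left_mono[OF eR, of "2 * \<epsilon>"] \<epsilon> by (simp add: mult_ac)
    then show ?thesis using xx yy by linarith
  qed
  from mult_left_mono[OF this, of b] pos
  have Bb: "- b * (Wxx t1 (x1, y1) + Wyy t1 (x1, y1)) \<le> 2 * b * \<epsilon> * R"
    by (auto simp: algebra_simps)
  have "W t1 (x1, y1) = - (\<epsilon> * R)" using Z0 by (simp add: R_def)
  then have "L * W t1 (x1, y1) = - L * \<epsilon> * R" by simp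
  with super[OF t1 y1 Wneg] A Bb y0 dt
  have "- L * \<epsilon> * R \<le> - (\<epsilon> * \<Lambda> * R) + \<epsilon> * (a * R) + 2 * b * \<epsilon> * R"
    by simp
  then have "\<epsilon> * R * \<Lambda> \<le> \<epsilon> * R * (a + 2 * b + L)" by (simp add: algebra_simps)
  then have "\<Lambda> \<le> a + 2 * b + L" using \<epsilon> R by simp
  then show False by (simp add: \<Lambda>_def)
qed

section \<open>Integrals over rectangles\<close>

lemma rect_cbox: "{a..b} \<times> {c..d} = cbox (a, c) (b, d)" for a b c d :: real
  by (simp add: cbox_Pair_eq)

lemma rect_integrable:
  fixes f :: "real \<times> real \<Rightarrow> real"
  shows "continuous_on ({a..b} \<times> {c..d}) f \<Longrightarrow> f integrable_on {a..b} \<times> {c..d}"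
  unfolding rect_cbox by (rule integrable_continuous)

lemma rect_Fubini:
  fixes f :: "real \<times> real \<Rightarrow> real"
  assumes "continuous_on ({a..b} \<times> {c..d}) f"
  shows "integral ({a..b} \<times> {c..d}) f = integral {a..b} (\<lambda>x. integral {c..d} (\<lambda>y. f (x, y)))"
  using integral_prod_continuous[of a c b d f] assms by (simp add: rect_cbox)

lemma rect_Fubini_swap:
  fixes f :: "real \<times> real \<Rightarrow> real"
  assumes "continuous_on ({a..b} \<times> {c..d}) f"
  shows "integral ({a..b} \<times> {c..d}) f = integral {c..d} (\<lambda>y. integral {a..b} (\<lambda>x. f (x, y)))"
  using integral_swap_continuous[of a c b d "\<lambda>x y. f (x, y)"] rect_Fubini[OF assms] assms
  by (simp add: rect_cbox)

lemma continuous_on_slice_integral: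
  fixes f :: "real \<times> real \<Rightarrow> real"
  assumes "continuous_on (A \<times> {c..d}) f"
  shows "continuous_on A (\<lambda>x. integral {c..d} (\<lambda>y. f (x, y)))"
  using integral_continuous_on_param[of A c d "\<lambda>x y. f (x, y)"] assms by simp

lemma continuous_on_slice_integral_swap:
  fixes f :: "real \<times> real \<Rightarrow> real"
  assumes "continuous_on ({a..b} \<times> A) f"
  shows "continuous_on A (\<lambda>y. integral {a..b} (\<lambda>x. f (x, y)))"
proof -
  have "continuous_on (A \<times> {a..b}) (\<lambda>p. f (snd p, fst p))"
    by (rule continuous_on_compose2[OF assms]) (auto intro!: continuous_intros)
  from continuous_on_slice_integral[OF this] show ?thesis by simp
qed

lemma continuous_on_slice:
  fixes f :: "real \<times> real \<Rightarrow> real"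
  assumes "continuous_on (A \<times> B) f"
  shows "x \<in> A \<Longrightarrow> continuous_on B (\<lambda>y. f (x, y))" "y \<in> B \<Longrightarrow> continuous_on A (\<lambda>x. f (x, y))"
  by (rule continuous_on_compose2[OF assms], auto intro!: continuous_intros)+

lemma rect_mono:
  fixes f g :: "real \<times> real \<Rightarrow> real"
  assumes "continuous_on ({a..b} \<times> {c..d}) f" "continuous_on ({a..b} \<times> {c..d}) g"
    and "\<And>x y. x \<in> {a..b} \<Longrightarrow> y \<in> {c..d} \<Longrightarrow> f (x, y) \<le> g (x, y)"
  shows "integral ({a..b} \<times> {c..d}) f \<le> integral ({a..b} \<times> {c..d}) g"
  using assms by (intro integral_le rect_integrable) auto

lemma rect_subset_le:
  fixes f :: "real \<times> real \<Rightarrow> real"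
  assumes "continuous_on ({a..b} \<times> {c..d}) f" "{a'..b'} \<times> {c'..d'} \<subseteq> {a..b} \<times> {c..d}"
    and "\<And>x y. x \<in> {a..b} \<Longrightarrow> y \<in> {c..d} \<Longrightarrow> f (x, y) \<ge> 0"
  shows "integral ({a'..b'} \<times> {c'..d'}) f \<le> integral ({a..b} \<times> {c..d}) f"
  using assms(1,3) continuous_on_subset[OF assms(1,2)]
  by (intro integral_subset_le[OF assms(2)] rect_integrable) auto

lemma rect_combine:
  fixes f :: "real \<times> real \<Rightarrow> real"
  assumes "continuous_on ({a..b} \<times> {c..d}) f" "a \<le> m" "m \<le> b"
  shows "integral ({a..b} \<times> {c..d}) f =
    integral ({a..m} \<times> {c..d}) f + integral ({m..b} \<times> {c..d}) f"
proof -
  have c: "continuous_on ({a..m} \<times> {c..d}) f" "continuous_on ({m..b} \<times> {c..d}) f"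
    by (rule continuous_on_subset[OF assms(1)]; use assms in auto)+
  show ?thesis
    unfolding rect_Fubini[OF assms(1)] rect_Fubini[OF c(1)] rect_Fubini[OF c(2)]
    using assms
    by (intro Henstock_Kurzweil_Integration.integral_combine[symmetric]
        integrable_continuous_real continuous_on_slice_integral) auto
qed

lemma rect_divergence:
  fixes P Q Px Qy :: "real \<times> real \<Rightarrow> real"
  assumes "a \<le> b" "c \<le> d"
    and P: "\<And>x y. x \<in> {a..b} \<Longrightarrow> y \<in> {c..d} \<Longrightarrow>
      ((\<lambda>s. P (s, y)) has_real_derivative Px (x, y)) (at x within {a..b})"
    and Q: "\<And>x y. x \<in> {a..b} \<Longrightarrow> y \<in> {c..d} \<Longrightarrow>
      ((\<lambda>s. Q (x, s)) has_real_derivative Qy (x, y)) (at y within {c..d})"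
    and cont: "continuous_on ({a..b} \<times> {c..d}) Px" "continuous_on ({a..b} \<times> {c..d}) Qy"
  shows "integral ({a..b} \<times> {c..d}) (\<lambda>p. Px p + Qy p) =
    integral {c..d} (\<lambda>y. P (b, y) - P (a, y)) + integral {a..b} (\<lambda>x. Q (x, d) - Q (x, c))"
proof -
  have "integral ({a..b} \<times> {c..d}) Px = integral {c..d} (\<lambda>y. P (b, y) - P (a, y))"
    unfolding rect_Fubini_swap[OF cont(1)]
    by (intro integral_cong integral_unique fundamental_theorem_of_calculus)
      (use assms in \<open>auto simp: has_real_derivative_iff_has_vector_derivative[symmetric]\<close>)
  moreover have "integral ({a..b} \<times> {c..d}) Qy = integral {a..b} (\<lambda>x. Q (x, d) - Q (x, c))"
    unfolding rect_Fubini[OF cont(2)]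
    by (intro integral_cong integral_unique fundamental_theorem_of_calculus)
      (use assms in \<open>auto simp: has_real_derivative_iff_has_vector_derivative[symmetric]\<close>)
  ultimately show ?thesis
    using cont by (subst integral_add) (auto intro!: rect_integrable)
qed

lemma integral_Cauchy_Schwarz:
  fixes f g :: "'a::euclidean_space \<Rightarrow> real"
  assumes "f integrable_on S" "g integrable_on S" "(\<lambda>x. (f x)\<^sup>2) integrable_on S"
    "(\<lambda>x. (g x)\<^sup>2) integrable_on S" "(\<lambda>x. f x * g x) integrable_on S"
  shows "(integral S (\<lambda>x. f x * g x))\<^sup>2 \<le> integral S (\<lambda>x. (f x)\<^sup>2) * integral S (\<lambda>x. (g x)\<^sup>2)"
proof -
  define A B C where "A = integral S (\<lambda>x. (f x)\<^sup>2)" and "B = integral S (\<lambda>x. (g x)\<^sup>2)"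
    and "C = integral S (\<lambda>x. f x * g x)"
  have AB: "A \<ge> 0" "B \<ge> 0" unfolding A_def B_def using assms by (auto intro!: integral_nonneg)
  have Q: "A - 2 * k * C + k\<^sup>2 * B \<ge> 0" for k
  proof -
    have "((\<lambda>x. (f x)\<^sup>2 - 2 * k * (f x * g x) + k\<^sup>2 * (g x)\<^sup>2) has_integral
        A - 2 * k * C + k\<^sup>2 * B) S"
      unfolding A_def B_def C_def
      by (intro has_integral_add has_integral_diff has_integral_mult_right)
        (use assms in \<open>auto intro: integrable_integral\<close>)
    moreover have "(f x)\<^sup>2 - 2 * k * (f x * g x) + k\<^sup>2 * (g x)\<^sup>2 \<ge> 0" for x
      using zero_le_power2[of "f x - k * g x"] by (simp add: power2_diff power_mult_distrib algebra_simps)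
    ultimately show ?thesis using has_integral_nonneg by blast
  qed
  have "C\<^sup>2 \<le> A * B"
  proof (cases "B = 0")
    case True
    have "C = 0"
    proof (rule ccontr)
      assume "C \<noteq> 0"
      \<comment> \<open>For B = 0 the quadratic is linear in k, and this k gives it the value
        -1.\<close>
      then show False using Q[of "(A + 1) / (2 * C)"] True by simp
    qed
    then show ?thesis using AB by simp
  next
    case False
    then have B: "B > 0" using AB by simp
    have "0 \<le> (A - 2 * (C / B) * C + (C / B)\<^sup>2 * B) * B" using Q[of "C / B"] B by simp
    also have "\<dots> = A * B - C\<^sup>2" using B by (simp add: field_simps power2_eq_square)
    finally show ?thesis by simp
  qed
  then show ?thesis by (simp add: A_def B_def C_def)
qed

lemma rect_Cauchy_Schwarz:
  fixes f g :: "real \<times> real \<Rightarrow> real"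
  assumes "continuous_on ({a..b} \<times> {c..d}) f" "continuous_on ({a..b} \<times> {c..d}) g"
  shows "integral ({a..b} \<times> {c..d}) (\<lambda>p. \<bar>f p\<bar> * \<bar>g p\<bar>) \<le>
    sqrt (integral ({a..b} \<times> {c..d}) (\<lambda>p. (f p)\<^sup>2) * integral ({a..b} \<times> {c..d}) (\<lambda>p. (g p)\<^sup>2))"
proof (rule real_le_rsqrt)
  have "(\<lambda>p. \<bar>f p\<bar>) integrable_on {a..b} \<times> {c..d}" "(\<lambda>p. \<bar>g p\<bar>) integrable_on {a..b} \<times> {c..d}"
    "(\<lambda>p. \<bar>f p\<bar>\<^sup>2) integrable_on {a..b} \<times> {c..d}" "(\<lambda>p. \<bar>g p\<bar>\<^sup>2) integrable_on {a..b} \<times> {c..d}"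
    "(\<lambda>p. \<bar>f p\<bar> * \<bar>g p\<bar>) integrable_on {a..b} \<times> {c..d}"
    using assms by (auto intro!: rect_integrable continuous_intros)
  from integral_Cauchy_Schwarz[OF this]
  show "(integral ({a..b} \<times> {c..d}) (\<lambda>p. \<bar>f p\<bar> * \<bar>g p\<bar>))\<^sup>2 \<le>
    integral ({a..b} \<times> {c..d}) (\<lambda>p. (f p)\<^sup>2) * integral ({a..b} \<times> {c..d}) (\<lambda>p. (g p)\<^sup>2)"
    by simp
qed

lemma interval_Cauchy_Schwarz:
  fixes f :: "real \<Rightarrow> real"
  assumes "continuous_on {a..b} f" "a \<le> b"
  shows "(integral {a..b} (\<lambda>y. \<bar>f y\<bar>))\<^sup>2 \<le> (b - a) * integral {a..b} (\<lambda>y. (f y)\<^sup>2)"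
  using integral_Cauchy_Schwarz[of "\<lambda>_. 1" "{a..b}" "\<lambda>y. \<bar>f y\<bar>"] assms
  by (auto intro!: integrable_continuous_real continuous_intros)

text \<open>Selects a line on which a slice integral equals its average. The energy bounds are area
  integrals, so a single vertical or horizontal line is controlled only after such a choice.\<close>

lemma integral_mean_value:
  fixes h :: "real \<Rightarrow> real"
  assumes "a < b" "continuous_on {a..b} h"
  shows "\<exists>x\<in>{a..b}. integral {a..b} h = h x * (b - a)"
proof -
  have "\<exists>x\<in>{a<..<b}. integral {a..b} h - integral {a..a} h = h x * (b - a)"
  proof (rule mvt_simple[OF assms(1)])
    fix x assume "a \<le> x" "x \<le> b"
    then have "((\<lambda>u. integral {a..u} h) has_real_derivative h x) (at x within {a..b})"
      using assms by (intro integral_has_real_derivative) auto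
    then show "((\<lambda>u. integral {a..u} h) has_derivative (*) (h x)) (at x within {a..b})"
      by (simp add: has_field_derivative_def)
  qed
  then show ?thesis by (auto intro: less_imp_le)
qed

section \<open>Boundary fluxes far out in the strip\<close>

lemma abs_integral_le:
  fixes f g :: "'a::euclidean_space \<Rightarrow> real"
  assumes "f integrable_on S" "g integrable_on S" "\<And>x. x \<in> S \<Longrightarrow> \<bar>f x\<bar> \<le> g x"
  shows "\<bar>integral S f\<bar> \<le> integral S g"
  using integral_norm_bound_integral[OF assms(1,2)] assms(3) by auto

text \<open>No pointwise bound on \<open>Sx\<close> is at hand. Averaged over R in a unit interval,
  its integral is a difference of values of S, hence small, and some R attains the average. In the
  advective part S may be replaced by S - s because cos has mean zero over {0..pi}: the net flow
  through a vertical line is zero.\<close>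

lemma flux_small:
  fixes S Sx :: "real \<times> real \<Rightarrow> real"
  assumes cont: "continuous_on (UNIV \<times> {0..pi}) S" "continuous_on (UNIV \<times> {0..pi}) Sx"
    and Sx: "\<And>x y. y \<in> {0..pi} \<Longrightarrow> ((\<lambda>s. S (s, y)) has_real_derivative Sx (x, y)) (at x)"
    and ab: "a \<ge> 0" "b \<ge> 0"
    and near: "\<And>x y. x \<in> {M..M+1} \<Longrightarrow> y \<in> {0..pi} \<Longrightarrow> \<bar>S (x, y) - s\<bar> \<le> e"
  shows "\<exists>R\<in>{M..M+1}. \<bar>integral {0..pi} (\<lambda>y. b * Sx (R, y) - a * (sin R * cos y * S (R, y)))\<bar>
    \<le> pi * (2 * b + a) * e"
proof -
  have c: "continuous_on ({M..M+1} \<times> {0..pi}) S" "continuous_on ({M..M+1} \<times> {0..pi}) Sx"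
    using cont by (auto intro: continuous_on_subset)
  have e: "e \<ge> 0" using near[of M 0] by auto
  obtain R where R: "R \<in> {M..M+1}"
    "integral {M..M+1} (\<lambda>x. integral {0..pi} (\<lambda>y. Sx (x, y))) = integral {0..pi} (\<lambda>y. Sx (R, y))"
    using integral_mean_value[of M "M + 1" "\<lambda>x. integral {0..pi} (\<lambda>y. Sx (x, y))"]
      continuous_on_slice_integral[OF c(2)] by auto
  have "integral {0..pi} (\<lambda>y. Sx (R, y)) = integral {0..pi} (\<lambda>y. integral {M..M+1} (\<lambda>x. Sx (x, y)))"
    using R rect_Fubini_swap[OF c(2)] rect_Fubini[OF c(2)] by simp
  also have "\<dots> = integral {0..pi} (\<lambda>y. S (M + 1, y) - S (M, y))"
    by (intro integral_cong integral_unique fundamental_theorem_of_calculus)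
      (auto simp: has_real_derivative_iff_has_vector_derivative[symmetric]
        intro!: has_field_derivative_at_within[OF Sx])
  also have "\<bar>\<dots>\<bar> \<le> integral {0..pi} (\<lambda>y. 2 * e)"
  proof (rule abs_integral_le)
    show "(\<lambda>y. S (M + 1, y) - S (M, y)) integrable_on {0..pi}"
      using continuous_on_slice[OF c(1)] by (auto intro!: integrable_continuous_real continuous_intros)
    show "\<bar>S (M + 1, y) - S (M, y)\<bar> \<le> 2 * e" if "y \<in> {0..pi}" for y
      using near[of M y] near[of "M + 1" y] that by auto
  qed auto
  finally have 1: "\<bar>integral {0..pi} (\<lambda>y. Sx (R, y))\<bar> \<le> pi * 2 * e" by simp
  have slice: "continuous_on {0..pi} (\<lambda>y. S (R, y))" "continuous_on {0..pi} (\<lambda>y. Sx (R, y))"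
    using continuous_on_slice[OF c(1)] continuous_on_slice[OF c(2)] R by auto
  have cos0: "(cos has_integral (sin pi - sin 0)) {0..pi}"
    by (rule fundamental_theorem_of_calculus)
      (auto simp: has_real_derivative_iff_has_vector_derivative[symmetric] intro!: derivative_eq_intros)
  have "integral {0..pi} (\<lambda>y. b * Sx (R, y) - a * (sin R * cos y * S (R, y)))
      = integral {0..pi} (\<lambda>y. b * Sx (R, y) - a * (sin R * cos y * (S (R, y) - s)) - (a * sin R * s) * cos y)"
    by (rule integral_cong) (simp add: algebra_simps)
  also have "\<dots> = b * integral {0..pi} (\<lambda>y. Sx (R, y))
      - integral {0..pi} (\<lambda>y. a * (sin R * cos y * (S (R, y) - s))) - (a * sin R * s) * integral {0..pi} cos"
  proof -
    have i: "(\<lambda>y. b * Sx (R, y)) integrable_on {0..pi}"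
      "(\<lambda>y. a * (sin R * cos y * (S (R, y) - s))) integrable_on {0..pi}"
      "(\<lambda>y. (a * sin R * s) * cos y) integrable_on {0..pi}"
      using slice by (auto intro!: integrable_continuous_real continuous_intros)
    show ?thesis
      using integral_diff[OF integrable_diff[OF i(1,2)] i(3)] integral_diff[OF i(1,2)] by simp
  qed
  also have "\<dots> = b * integral {0..pi} (\<lambda>y. Sx (R, y))
      - integral {0..pi} (\<lambda>y. a * (sin R * cos y * (S (R, y) - s)))"
    using integral_unique[OF cos0] by simp
  finally have 2: "integral {0..pi} (\<lambda>y. b * Sx (R, y) - a * (sin R * cos y * S (R, y))) = \<dots>" .
  have "\<bar>integral {0..pi} (\<lambda>y. a * (sin R * cos y * (S (R, y) - s)))\<bar> \<le> integral {0..pi} (\<lambda>y. a * e)"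
  proof (rule abs_integral_le)
    show "(\<lambda>y. a * (sin R * cos y * (S (R, y) - s))) integrable_on {0..pi}"
      using slice by (auto intro!: integrable_continuous_real continuous_intros)
    show "\<bar>a * (sin R * cos y * (S (R, y) - s))\<bar> \<le> a * e" if "y \<in> {0..pi}" for y
    proof -
      have "\<bar>sin R * cos y\<bar> \<le> 1" by (simp add: abs_mult mult_le_one)
      then have "\<bar>sin R * cos y\<bar> * \<bar>S (R, y) - s\<bar> \<le> 1 * e"
        using near[of R y] R(1) that e by (intro mult_mono) auto
      then show ?thesis using ab by (simp add: abs_mult mult_left_mono mult.assoc)
    qed
  qed auto
  then have 3: "\<bar>integral {0..pi} (\<lambda>y. a * (sin R * cos y * (S (R, y) - s)))\<bar> \<le> pi * (a * e)" by (simp add: mult.left_commute)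
  have "\<bar>b * integral {0..pi} (\<lambda>y. Sx (R, y))\<bar> \<le> b * (pi * 2 * e)"
    using 1 ab by (simp add: abs_mult mult_left_mono)
  with 3 have "\<bar>integral {0..pi} (\<lambda>y. b * Sx (R, y) - a * (sin R * cos y * S (R, y)))\<bar>
    \<le> b * (pi * 2 * e) + pi * (a * e)" unfolding 2 by linarith
  also have "\<dots> = pi * (2 * b + a) * e" by (simp add: algebra_simps)
  finally show ?thesis using R(1) by blast
qed

text \<open>Kept general in S because it is applied both to T and to T - T^2/2. The integrand is a
  divergence, the flow being incompressible. On y = 0 and y = pi the advective flux vanishes with
  sin and the diffusive fluxes cancel by \<open>bc\<close>; only two vertical lines remain.\<close>

lemma strip_flux_vanishes:
  fixes S Sx Sy Sxx Syy :: "real \<times> real \<Rightarrow> real"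
  assumes cont: "continuous_on (UNIV \<times> {0..pi}) S" "continuous_on (UNIV \<times> {0..pi}) Sx"
      "continuous_on (UNIV \<times> {0..pi}) Sy" "continuous_on (UNIV \<times> {0..pi}) Sxx"
      "continuous_on (UNIV \<times> {0..pi}) Syy"
    and Sx: "\<And>x y. y \<in> {0..pi} \<Longrightarrow> ((\<lambda>s. S (s, y)) has_real_derivative Sx (x, y)) (at x)"
    and Sxx: "\<And>x y. y \<in> {0..pi} \<Longrightarrow> ((\<lambda>s. Sx (s, y)) has_real_derivative Sxx (x, y)) (at x)"
    and Sy: "\<And>x y. y \<in> {0..pi} \<Longrightarrow> ((\<lambda>s. S (x, s)) has_real_derivative Sy (x, y)) (at y within {0..pi})"
    and Syy: "\<And>x y. y \<in> {0..pi} \<Longrightarrow> ((\<lambda>s. Sy (x, s)) has_real_derivative Syy (x, y)) (at y within {0..pi})"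
    and bc: "\<And>x. Sy (x, 0) = Sy (x, pi)"
    and ab: "a \<ge> 0" "b \<ge> 0"
    and right: "\<And>e. e > 0 \<Longrightarrow> \<exists>N. \<forall>x\<ge>N. \<forall>y\<in>{0..pi}. \<bar>S (x, y) - sr\<bar> \<le> e"
    and left: "\<And>e. e > 0 \<Longrightarrow> \<exists>N. \<forall>x\<le>N. \<forall>y\<in>{0..pi}. \<bar>S (x, y) - sl\<bar> \<le> e"
    and "\<epsilon> > 0"
  shows "\<exists>x1\<le>- N. \<exists>x2\<ge>N. \<bar>integral ({x1..x2} \<times> {0..pi})
    (\<lambda>p. b * (Sxx p + Syy p) - a * (sin (fst p) * cos (snd p) * Sx p - cos (fst p) * sin (snd p) * Sy p))\<bar> \<le> \<epsilon>"
proof -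
  let ?F = "\<lambda>x. integral {0..pi} (\<lambda>y. b * Sx (x, y) - a * (sin x * cos y * S (x, y)))"
  define e where "e = \<epsilon> / (2 * pi * (2 * b + a) + 1)"
  have den: "2 * pi * (2 * b + a) + 1 > 0" using ab pi_gt_zero by (smt (verit) mult_nonneg_nonneg)
  have e: "e > 0" using den \<open>\<epsilon> > 0\<close> by (simp add: e_def)
  have e2: "2 * (pi * (2 * b + a) * e) \<le> \<epsilon>"
  proof -
    have "\<epsilon> = e * (2 * pi * (2 * b + a) + 1)" using den by (simp add: e_def)
    then show ?thesis using e by (simp add: algebra_simps)
  qed
  obtain Nr Nl where Nr: "\<And>x y. x \<ge> Nr \<Longrightarrow> y \<in> {0..pi} \<Longrightarrow> \<bar>S (x, y) - sr\<bar> \<le> e"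
    and Nl: "\<And>x y. x \<le> Nl \<Longrightarrow> y \<in> {0..pi} \<Longrightarrow> \<bar>S (x, y) - sl\<bar> \<le> e"
    using right[OF e] left[OF e] by metis
  define M where "M = max N (max Nr (max (- Nl) 0)) + 1"
  have M: "M \<ge> Nr" "- M + 1 \<le> Nl" by (auto simp: M_def)
  have "\<bar>S (x, y) - sr\<bar> \<le> e" if "x \<in> {M..M+1}" "y \<in> {0..pi}" for x y
    using Nr[of x y] that M by auto
  from flux_small[OF cont(1,2) Sx ab this]
  obtain x2 where x2: "x2 \<in> {M..M+1}" "\<bar>?F x2\<bar> \<le> pi * (2 * b + a) * e" by blast
  have "\<bar>S (x, y) - sl\<bar> \<le> e" if "x \<in> {-M..-M+1}" "y \<in> {0..pi}" for x y
    using Nl[of x y] that M by auto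
  from flux_small[OF cont(1,2) Sx ab this]
  obtain x1 where x1: "x1 \<in> {-M..-M+1}" "\<bar>?F x1\<bar> \<le> pi * (2 * b + a) * e" by blast
  have "M \<ge> 1" "M \<ge> N + 1" by (auto simp: M_def)
  then have le: "x1 \<le> x2" "x1 \<le> - N" "x2 \<ge> N" using x1(1) x2(1) by auto
  have c: "continuous_on ({x1..x2} \<times> {0..pi}) h" if "continuous_on (UNIV \<times> {0..pi}) h"
    for h :: "real \<times> real \<Rightarrow> real" using that by (rule continuous_on_subset) auto
  have sl: "continuous_on {0..pi} (\<lambda>y. h (x, y))" if "continuous_on (UNIV \<times> {0..pi}) h"
    for h :: "real \<times> real \<Rightarrow> real" and x using continuous_on_slice[OF that] by auto
  define P where "P = (\<lambda>p. b * Sx p - a * (sin (fst p) * cos (snd p) * S p))"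
  define Px where "Px = (\<lambda>p. b * Sxx p - a * (cos (fst p) * cos (snd p) * S p + sin (fst p) * cos (snd p) * Sx p))"
  define Q where "Q = (\<lambda>p. b * Sy p + a * (cos (fst p) * sin (snd p) * S p))"
  define Qy where "Qy = (\<lambda>p. b * Syy p + a * (cos (fst p) * cos (snd p) * S p + cos (fst p) * sin (snd p) * Sy p))"
  have "integral ({x1..x2} \<times> {0..pi})
    (\<lambda>p. b * (Sxx p + Syy p) - a * (sin (fst p) * cos (snd p) * Sx p - cos (fst p) * sin (snd p) * Sy p))
    = integral ({x1..x2} \<times> {0..pi}) (\<lambda>p. Px p + Qy p)"
    by (rule integral_cong) (simp add: Px_def Qy_def algebra_simps)
  also have "\<dots> = integral {0..pi} (\<lambda>y. P (x2, y) - P (x1, y)) + integral {x1..x2} (\<lambda>x. Q (x, pi) - Q (x, 0))"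
  proof (rule rect_divergence[OF le(1)])
    show "((\<lambda>s. P (s, y)) has_real_derivative Px (x, y)) (at x within {x1..x2})" if "y \<in> {0..pi}" for x y
      unfolding P_def Px_def using that
      by (auto intro!: derivative_eq_intros has_field_derivative_at_within[OF Sx]
          has_field_derivative_at_within[OF Sxx] simp: algebra_simps)
    show "((\<lambda>s. Q (x, s)) has_real_derivative Qy (x, y)) (at y within {0..pi})" if "y \<in> {0..pi}" for x y
      unfolding Q_def Qy_def using that
      by (auto intro!: derivative_eq_intros Sy Syy simp: algebra_simps)
    show "continuous_on ({x1..x2} \<times> {0..pi}) Px" "continuous_on ({x1..x2} \<times> {0..pi}) Qy"
      unfolding Px_def Qy_def by (intro continuous_intros c cont)+
  qed auto
  also have "integral {x1..x2} (\<lambda>x. Q (x, pi) - Q (x, 0)) = 0"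
    using bc by (simp add: Q_def)
  also have "integral {0..pi} (\<lambda>y. P (x2, y) - P (x1, y)) = ?F x2 - ?F x1"
    unfolding P_def using sl[OF cont(1)] sl[OF cont(2)]
    by (subst integral_diff) (auto intro!: integrable_continuous_real continuous_intros)
  finally show ?thesis using x1(2) x2(2) e2 le(2,3) by (intro exI[of _ x1] exI[of _ x2] conjI) auto
qed

section \<open>Reaction and dissipation at a fixed time\<close>

text \<open>A snapshot at one positive time: w is the time derivative, of which only the sign, the
  continuity and the equation are kept, so that time no longer appears.\<close>

locale cellular_profile =
  fixes a b c L K \<mu> :: real and f :: "real \<Rightarrow> real"
    and T Tx Ty Txx Tyy w :: "real \<times> real \<Rightarrow> real"
  assumes pos: "a > 0" "b > 0" "c > 0" "L \<ge> 0" "K \<ge> 0" "\<mu> > 0"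
    and cont: "continuous_on (UNIV \<times> {0..pi}) T" "continuous_on (UNIV \<times> {0..pi}) Tx"
      "continuous_on (UNIV \<times> {0..pi}) Ty" "continuous_on (UNIV \<times> {0..pi}) Txx"
      "continuous_on (UNIV \<times> {0..pi}) Tyy" "continuous_on (UNIV \<times> {0..pi}) w"
    and Tx: "\<And>x y. y \<in> {0..pi} \<Longrightarrow> ((\<lambda>s. T (s, y)) has_real_derivative Tx (x, y)) (at x)"
    and Txx: "\<And>x y. y \<in> {0..pi} \<Longrightarrow> ((\<lambda>s. Tx (s, y)) has_real_derivative Txx (x, y)) (at x)"
    and Ty: "\<And>x y. y \<in> {0..pi} \<Longrightarrow>
      ((\<lambda>s. T (x, s)) has_real_derivative Ty (x, y)) (at y within {0..pi})"
    and Tyy: "\<And>x y. y \<in> {0..pi} \<Longrightarrow>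
      ((\<lambda>s. Ty (x, s)) has_real_derivative Tyy (x, y)) (at y within {0..pi})"
    and bc: "\<And>x. (Ty (x, 0) = 0 \<and> Ty (x, pi) = 0) \<or> (T (x, 0) = T (x, pi) \<and> Ty (x, 0) = Ty (x, pi))"
    and f_nonneg: "\<And>s. s \<in> {0..1} \<Longrightarrow> f s \<ge> 0" and f0: "f 0 = 0" and f1: "f 1 = 0"
    and f_lipschitz: "\<And>s r. s \<in> {0..1} \<Longrightarrow> r \<in> {0..1} \<Longrightarrow> \<bar>f s - f r\<bar> \<le> L * \<bar>s - r\<bar>"
    and T_range: "\<And>x y. y \<in> {0..pi} \<Longrightarrow> T (x, y) \<in> {0..1}"
    and w_nonneg: "\<And>x y. y \<in> {0..pi} \<Longrightarrow> w (x, y) \<ge> 0"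
    and decay_right: "\<And>x y. y \<in> {0..pi} \<Longrightarrow> T (x, y) \<le> K * exp (- \<mu> * x)"
    and decay_left: "\<And>x y. y \<in> {0..pi} \<Longrightarrow> 1 - T (x, y) \<le> K * exp (\<mu> * x)"
    and eq: "\<And>x y. y \<in> {0..pi} \<Longrightarrow>
      w (x, y) + a * (sin x * cos y * Tx (x, y) - cos x * sin y * Ty (x, y)) =
        b * (Txx (x, y) + Tyy (x, y)) + c * f (T (x, y))"
begin

lemma continuous_on_rect:
  fixes h :: "real \<times> real \<Rightarrow> real"
  assumes "continuous_on (UNIV \<times> {0..pi}) h" "{y1..y2} \<subseteq> {0..pi}"
  shows "continuous_on ({x1..x2} \<times> {y1..y2}) h"
  using assms(1) by (rule continuous_on_subset) (use assms(2) in auto)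

lemma continuous_f: "continuous_on {0..1} f"
proof -
  have "L-lipschitz_on {0..1} f"
    by (rule lipschitz_onI) (use f_lipschitz pos in \<open>auto simp: dist_real_def\<close>)
  then show ?thesis by (rule lipschitz_on_continuous_on)
qed

lemma continuous_fT: "continuous_on (UNIV \<times> {0..pi}) (\<lambda>p. f (T p))"
  by (rule continuous_on_compose2[OF continuous_f cont(1)]) (use T_range in auto)

lemma fT_nonneg: "y \<in> {0..pi} \<Longrightarrow> f (T (x, y)) \<ge> 0"
  using f_nonneg T_range by blast

lemma fT_decay:
  assumes "y \<in> {0..pi}"
  shows "f (T (x, y)) \<le> L * K * exp (- \<mu> * x)" "f (T (x, y)) \<le> L * K * exp (\<mu> * x)"
proof -
  have T: "T (x, y) \<in> {0..1}" by (rule T_range[OF assms])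
  have "f (T (x, y)) \<le> L * T (x, y)"
    using f_lipschitz[of "T (x, y)" 0] T f0 by auto
  also have "\<dots> \<le> L * (K * exp (- \<mu> * x))"
    using decay_right[OF assms] pos by (intro mult_left_mono) auto
  finally show "f (T (x, y)) \<le> L * K * exp (- \<mu> * x)" by simp
  have "f (T (x, y)) \<le> L * (1 - T (x, y))"
    using f_lipschitz[of "T (x, y)" 1] T f1 by auto
  also have "\<dots> \<le> L * (K * exp (\<mu> * x))"
    using decay_left[OF assms] pos by (intro mult_left_mono) auto
  finally show "f (T (x, y)) \<le> L * K * exp (\<mu> * x)" by simp
qed

lemma exp_small: "e > 0 \<Longrightarrow> \<exists>N. \<forall>x\<ge>N. K * exp (- \<mu> * x) \<le> e"
proof -
  assume "e > 0"
  \<comment> \<open>K + 1 replaces K because K = 0 is allowed.\<close>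
  define N where "N = - ln (e / (K + 1)) / \<mu>"
  have "K * exp (- \<mu> * x) \<le> e" if "x \<ge> N" for x
  proof -
    have "- \<mu> * x \<le> ln (e / (K + 1))"
      using that pos by (simp add: N_def field_simps)
    then have "exp (- \<mu> * x) \<le> e / (K + 1)"
      using \<open>e > 0\<close> pos by (simp add: ln_ge_iff)
    then have "(K + 1) * exp (- \<mu> * x) \<le> e" using pos by (simp add: field_simps)
    then have "K * exp (- \<mu> * x) + exp (- \<mu> * x) \<le> e" by (simp add: distrib_right)
    then show ?thesis using exp_gt_zero[of "- \<mu> * x"] by linarith
  qed
  then show ?thesis by blast
qed

lemma T_limit_right: "e > 0 \<Longrightarrow> \<exists>N. \<forall>x\<ge>N. \<forall>y\<in>{0..pi}. T (x, y) \<le> e"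
  using exp_small decay_right by (meson order_trans)

lemma T_limit_left: "e > 0 \<Longrightarrow> \<exists>N. \<forall>x\<le>N. \<forall>y\<in>{0..pi}. 1 - T (x, y) \<le> e"
proof -
  assume "e > 0"
  then obtain N where N: "\<And>x. x \<ge> N \<Longrightarrow> K * exp (- \<mu> * x) \<le> e" using exp_small by blast
  have "1 - T (x, y) \<le> e" if "x \<le> - N" "y \<in> {0..pi}" for x y
    using N[of "- x"] decay_left[of y x] that by auto
  then show ?thesis by blast
qed

text \<open>By the equation w - c f(T) is a divergence. The window cannot be prescribed exactly,
  only made to exceed N; this suffices for integrals of nonnegative functions.\<close>

lemma burning_flux_vanishes:
  assumes "\<epsilon> > 0"
  shows "\<exists>x1\<le>- N. \<exists>x2\<ge>N. \<bar>integral ({x1..x2} \<times> {0..pi}) (\<lambda>p. w p - c * f (T p))\<bar> \<le> \<epsilon>"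
proof -
  have bc': "Ty (x, 0) = Ty (x, pi)" for x using bc[of x] by auto
  have "\<exists>x1\<le>- N. \<exists>x2\<ge>N. \<bar>integral ({x1..x2} \<times> {0..pi}) (\<lambda>p. b * (Txx p + Tyy p)
      - a * (sin (fst p) * cos (snd p) * Tx p - cos (fst p) * sin (snd p) * Ty p))\<bar> \<le> \<epsilon>"
  proof (rule strip_flux_vanishes[OF cont(1-5) Tx Txx Ty Tyy bc'])
    show "\<exists>N. \<forall>x\<ge>N. \<forall>y\<in>{0..pi}. \<bar>T (x, y) - 0\<bar> \<le> e" if "e > 0" for e
      using T_limit_right[OF that] T_range by (metis abs_of_nonneg atLeastAtMost_iff diff_zero)
    show "\<exists>N. \<forall>x\<le>N. \<forall>y\<in>{0..pi}. \<bar>T (x, y) - 1\<bar> \<le> e" if "e > 0" for e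
    proof -
      have "\<bar>T (x, y) - 1\<bar> = 1 - T (x, y)" if "y \<in> {0..pi}" for x y using T_range[OF that, of x] by auto
      then show ?thesis using T_limit_left[OF that] by simp
    qed
  qed (use pos assms in auto)
  moreover have "integral ({x1..x2} \<times> {0..pi}) (\<lambda>p. b * (Txx p + Tyy p)
      - a * (sin (fst p) * cos (snd p) * Tx p - cos (fst p) * sin (snd p) * Ty p)) =
    integral ({x1..x2} \<times> {0..pi}) (\<lambda>p. w p - c * f (T p))" for x1 x2
    by (rule integral_cong) (use eq in \<open>force simp: algebra_simps\<close>)
  ultimately show ?thesis by simp
qed

text \<open>Multiplying by 1 - T means passing to its antiderivative S = T - T^2/2: the advective
  term stays a divergence, and the Laplacian leaves b |grad T|^2 behind. S tends to 0 on the right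
  and to 1/2 on the left.\<close>

lemma dissipation_flux_vanishes:
  assumes "\<epsilon> > 0"
  shows "\<exists>x1\<le>- N. \<exists>x2\<ge>N. \<bar>integral ({x1..x2} \<times> {0..pi})
    (\<lambda>p. (1 - T p) * (w p - c * f (T p)) - b * ((Tx p)\<^sup>2 + (Ty p)\<^sup>2))\<bar> \<le> \<epsilon>"
proof -
  define S Sx Sy Sxx Syy where "S = (\<lambda>p. T p - (T p)\<^sup>2 / 2)"
    and "Sx = (\<lambda>p. (1 - T p) * Tx p)" and "Sy = (\<lambda>p. (1 - T p) * Ty p)"
    and "Sxx = (\<lambda>p. (1 - T p) * Txx p - (Tx p)\<^sup>2)" and "Syy = (\<lambda>p. (1 - T p) * Tyy p - (Ty p)\<^sup>2)"
  note S = S_def Sx_def Sy_def Sxx_def Syy_def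
  have "\<exists>x1\<le>- N. \<exists>x2\<ge>N. \<bar>integral ({x1..x2} \<times> {0..pi}) (\<lambda>p. b * (Sxx p + Syy p)
      - a * (sin (fst p) * cos (snd p) * Sx p - cos (fst p) * sin (snd p) * Sy p))\<bar> \<le> \<epsilon>"
  proof (rule strip_flux_vanishes)
    show "continuous_on (UNIV \<times> {0..pi}) S" "continuous_on (UNIV \<times> {0..pi}) Sx"
      "continuous_on (UNIV \<times> {0..pi}) Sy" "continuous_on (UNIV \<times> {0..pi}) Sxx"
      "continuous_on (UNIV \<times> {0..pi}) Syy"
      unfolding S by (intro continuous_intros cont; simp)+
    show "((\<lambda>s. S (s, y)) has_real_derivative Sx (x, y)) (at x)" if "y \<in> {0..pi}" for x y
      unfolding S using that by (auto intro!: derivative_eq_intros Tx simp: algebra_simps)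
    show "((\<lambda>s. Sx (s, y)) has_real_derivative Sxx (x, y)) (at x)" if "y \<in> {0..pi}" for x y
      unfolding S using that
      by (auto intro!: derivative_eq_intros Tx Txx simp: algebra_simps power2_eq_square)
    show "((\<lambda>s. S (x, s)) has_real_derivative Sy (x, y)) (at y within {0..pi})"
      if "y \<in> {0..pi}" for x y
      unfolding S using that by (auto intro!: derivative_eq_intros Ty simp: algebra_simps)
    show "((\<lambda>s. Sy (x, s)) has_real_derivative Syy (x, y)) (at y within {0..pi})"
      if "y \<in> {0..pi}" for x y
      unfolding S using that
      by (auto intro!: derivative_eq_intros Ty Tyy simp: algebra_simps power2_eq_square)
    show "Sy (x, 0) = Sy (x, pi)" for x using bc[of x] by (auto simp: S)
    have r: "\<bar>S (x, y) - 0\<bar> \<le> T (x, y)" "\<bar>S (x, y) - 1 / 2\<bar> \<le> 1 - T (x, y)"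
      if "y \<in> {0..pi}" for x y
    proof -
      define s where "s = T (x, y)"
      have s: "s \<ge> 0" "s \<le> 1" using T_range[OF that, of x] by (auto simp: s_def)
      have q: "s\<^sup>2 \<le> s" "s\<^sup>2 \<ge> 0" using s by (auto simp: power2_eq_square mult_left_le)
      have "(1 - s)\<^sup>2 \<le> 1 - s" using s by (simp add: power2_eq_square mult_left_le)
      then have q': "2 * s - s\<^sup>2 \<ge> s" "2 * s - s\<^sup>2 \<le> 1"
        using zero_le_power2[of "1 - s"] by (simp_all add: power2_diff)
      show "\<bar>S (x, y) - 0\<bar> \<le> T (x, y)" "\<bar>S (x, y) - 1 / 2\<bar> \<le> 1 - T (x, y)"
        using q q' s by (simp_all add: S abs_le_iff flip: s_def)
    qed
    show "\<exists>N. \<forall>x\<ge>N. \<forall>y\<in>{0..pi}. \<bar>S (x, y) - 0\<bar> \<le> e" if "e > 0" for e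
      using T_limit_right[OF that] r(1) by (meson order_trans)
    show "\<exists>N. \<forall>x\<le>N. \<forall>y\<in>{0..pi}. \<bar>S (x, y) - 1 / 2\<bar> \<le> e" if "e > 0" for e
      using T_limit_left[OF that] r(2) by (meson order_trans)
  qed (use pos assms in auto)
  moreover have "integral ({x1..x2} \<times> {0..pi}) (\<lambda>p. b * (Sxx p + Syy p)
      - a * (sin (fst p) * cos (snd p) * Sx p - cos (fst p) * sin (snd p) * Sy p)) =
    integral ({x1..x2} \<times> {0..pi})
      (\<lambda>p. (1 - T p) * (w p - c * f (T p)) - b * ((Tx p)\<^sup>2 + (Ty p)\<^sup>2))" for x1 x2
  proof (rule integral_cong)
    fix p assume "p \<in> {x1..x2} \<times> {0..pi}"
    then obtain x y where p: "p = (x, y)" "y \<in> {0..pi}" by auto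
    have wf: "w p - c * f (T p) = b * (Txx p + Tyy p) - a * (sin x * cos y * Tx p - cos x * sin y * Ty p)"
      using eq[OF p(2), of x] by (simp add: p(1))
    show "b * (Sxx p + Syy p) - a * (sin (fst p) * cos (snd p) * Sx p - cos (fst p) * sin (snd p) * Sy p)
      = (1 - T p) * (w p - c * f (T p)) - b * ((Tx p)\<^sup>2 + (Ty p)\<^sup>2)"
      unfolding wf unfolding S by (simp add: p(1) algebra_simps)
  qed
  ultimately show ?thesis by simp
qed

lemma reaction_half_line:
  assumes "R \<ge> 0"
  shows "integral ({0..R} \<times> {0..pi}) (\<lambda>p. c * f (T p)) \<le> pi * (c * L * K / \<mu>)"
    and "integral ({- R..0} \<times> {0..pi}) (\<lambda>p. c * f (T p)) \<le> pi * (c * L * K / \<mu>)"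
proof -
  let ?G = "c * L * K"
  have G: "?G \<ge> 0" using pos by simp
  have cf: "continuous_on ({x1..x2} \<times> {0..pi}) (\<lambda>p. c * f (T p))" for x1 x2
    by (intro continuous_on_rect continuous_intros continuous_fT) auto
  have "integral ({0..R} \<times> {0..pi}) (\<lambda>p. c * f (T p))
      \<le> integral ({0..R} \<times> {0..pi}) (\<lambda>p. ?G * exp (- \<mu> * fst p))"
    using fT_decay(1) pos
    by (intro rect_mono cf continuous_intros) (auto simp: mult.assoc intro!: mult_left_mono)
  also have "\<dots> = integral {0..pi} (\<lambda>y. integral {0..R} (\<lambda>x. ?G * exp (- \<mu> * x)))"
    by (subst rect_Fubini_swap) (auto intro!: continuous_intros)
  also have "integral {0..R} (\<lambda>x. ?G * exp (- \<mu> * x)) = - ?G / \<mu> * exp (- \<mu> * R) - - ?G / \<mu> * exp (- \<mu> * 0)"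
    by (intro integral_unique fundamental_theorem_of_calculus)
      (use assms pos in \<open>auto simp: has_real_derivative_iff_has_vector_derivative[symmetric]
         intro!: derivative_eq_intros\<close>)
  also have "integral {0..pi} (\<lambda>y. - ?G / \<mu> * exp (- \<mu> * R) - - ?G / \<mu> * exp (- \<mu> * 0)) \<le> pi * (?G / \<mu>)"
  proof -
    have "- ?G / \<mu> * exp (- \<mu> * R) - - ?G / \<mu> * exp (- \<mu> * 0) \<le> ?G / \<mu>" using G pos by simp
    then have "pi * (- ?G / \<mu> * exp (- \<mu> * R) - - ?G / \<mu> * exp (- \<mu> * 0)) \<le> pi * (?G / \<mu>)" by (intro mult_left_mono) auto
    then show ?thesis by simp
  qed
  finally show "integral ({0..R} \<times> {0..pi}) (\<lambda>p. c * f (T p)) \<le> pi * (c * L * K / \<mu>)" .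
  have "integral ({- R..0} \<times> {0..pi}) (\<lambda>p. c * f (T p))
      \<le> integral ({- R..0} \<times> {0..pi}) (\<lambda>p. ?G * exp (\<mu> * fst p))"
    using fT_decay(2) pos
    by (intro rect_mono cf continuous_intros) (auto simp: mult.assoc intro!: mult_left_mono)
  also have "\<dots> = integral {0..pi} (\<lambda>y. integral {- R..0} (\<lambda>x. ?G * exp (\<mu> * x)))"
    by (subst rect_Fubini_swap) (auto intro!: continuous_intros)
  also have "integral {- R..0} (\<lambda>x. ?G * exp (\<mu> * x)) = ?G / \<mu> * exp (\<mu> * 0) - ?G / \<mu> * exp (\<mu> * (- R))"
    by (intro integral_unique fundamental_theorem_of_calculus)
      (use assms pos in \<open>auto simp: has_real_derivative_iff_has_vector_derivative[symmetric]
         intro!: derivative_eq_intros\<close>)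
  also have "integral {0..pi} (\<lambda>y. ?G / \<mu> * exp (\<mu> * 0) - ?G / \<mu> * exp (\<mu> * (- R))) \<le> pi * (?G / \<mu>)"
  proof -
    have "?G / \<mu> * exp (\<mu> * 0) - ?G / \<mu> * exp (\<mu> * (- R)) \<le> ?G / \<mu>" using G pos by simp
    then have "pi * (?G / \<mu> * exp (\<mu> * 0) - ?G / \<mu> * exp (\<mu> * (- R))) \<le> pi * (?G / \<mu>)" by (intro mult_left_mono) auto
    then show ?thesis by simp
  qed
  finally show "integral ({- R..0} \<times> {0..pi}) (\<lambda>p. c * f (T p)) \<le> pi * (c * L * K / \<mu>)" .
qed

lemma reaction_bounded:
  "integral ({x1..x2} \<times> {0..pi}) (\<lambda>p. c * f (T p)) \<le> 2 * pi * (c * L * K / \<mu>)"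
proof -
  define R where "R = max \<bar>x1\<bar> \<bar>x2\<bar>"
  have cf: "continuous_on ({x1..x2} \<times> {0..pi}) (\<lambda>p. c * f (T p))" for x1 x2
    by (intro continuous_on_rect continuous_intros continuous_fT) auto
  have "integral ({x1..x2} \<times> {0..pi}) (\<lambda>p. c * f (T p)) \<le> integral ({- R..R} \<times> {0..pi}) (\<lambda>p. c * f (T p))"
    by (rule rect_subset_le[OF cf]) (use fT_nonneg pos in \<open>auto simp: R_def\<close>)
  also have "\<dots> = integral ({- R..0} \<times> {0..pi}) (\<lambda>p. c * f (T p)) + integral ({0..R} \<times> {0..pi}) (\<lambda>p. c * f (T p))"
    by (rule rect_combine[OF cf]) (auto simp: R_def)
  also have "\<dots> \<le> 2 * pi * (c * L * K / \<mu>)"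
  proof -
    have "R \<ge> 0" by (simp add: R_def)
    from reaction_half_line[OF this] show ?thesis unfolding mult_2 distrib_right by linarith
  qed
  finally show ?thesis .
qed

text \<open>Only finiteness matters: it makes w integrable over the strip, so that its Lebesgue
  integral is a true value and not the default 0.\<close>

lemma burning_rate_bounded: "\<exists>B. \<forall>x1 x2. integral ({x1..x2} \<times> {0..pi}) w \<le> B"
proof (intro exI allI)
  fix x1 x2
  obtain z1 z2 where z: "z1 \<le> - max \<bar>x1\<bar> \<bar>x2\<bar>" "z2 \<ge> max \<bar>x1\<bar> \<bar>x2\<bar>"
    "\<bar>integral ({z1..z2} \<times> {0..pi}) (\<lambda>p. w p - c * f (T p))\<bar> \<le> 1"
    using burning_flux_vanishes[of 1 "max \<bar>x1\<bar> \<bar>x2\<bar>"] by auto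
  have cw: "continuous_on ({z1..z2} \<times> {0..pi}) w" by (intro continuous_on_rect cont) auto
  have "integral ({x1..x2} \<times> {0..pi}) w \<le> integral ({z1..z2} \<times> {0..pi}) w"
    by (rule rect_subset_le[OF cw]) (use w_nonneg z in auto)
  also have "\<dots> = integral ({z1..z2} \<times> {0..pi}) (\<lambda>p. w p - c * f (T p))
      + integral ({z1..z2} \<times> {0..pi}) (\<lambda>p. c * f (T p))"
    by (subst integral_diff) (auto intro!: rect_integrable continuous_on_rect continuous_intros cont continuous_fT)
  also have "\<dots> \<le> 1 + 2 * pi * (c * L * K / \<mu>)" using z(3) reaction_bounded[of z1 z2] by linarith
  finally show "integral ({x1..x2} \<times> {0..pi}) w \<le> 1 + 2 * pi * (c * L * K / \<mu>)" .
qed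

text \<open>V may be any common bound of the window integrals of w. The window is enlarged to one of
  net flux at most e, which is harmless for a nonnegative integrand.\<close>

lemma reaction_le_burning_rate:
  assumes V: "\<And>x1 x2. integral ({x1..x2} \<times> {0..pi}) w \<le> V"
  shows "integral ({x1..x2} \<times> {0..pi}) (\<lambda>p. c * f (T p)) \<le> V"
proof (rule field_le_epsilon)
  fix e :: real assume "e > 0"
  obtain z1 z2 where z: "z1 \<le> - max \<bar>x1\<bar> \<bar>x2\<bar>" "z2 \<ge> max \<bar>x1\<bar> \<bar>x2\<bar>"
    "\<bar>integral ({z1..z2} \<times> {0..pi}) (\<lambda>p. w p - c * f (T p))\<bar> \<le> e"
    using burning_flux_vanishes[OF \<open>e > 0\<close>, of "max \<bar>x1\<bar> \<bar>x2\<bar>"] by auto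
  have cf: "continuous_on ({z1..z2} \<times> {0..pi}) (\<lambda>p. c * f (T p))"
    by (intro continuous_on_rect continuous_intros continuous_fT) auto
  have "integral ({x1..x2} \<times> {0..pi}) (\<lambda>p. c * f (T p)) \<le> integral ({z1..z2} \<times> {0..pi}) (\<lambda>p. c * f (T p))"
    by (rule rect_subset_le[OF cf]) (use fT_nonneg pos z in auto)
  also have "\<dots> = integral ({z1..z2} \<times> {0..pi}) w
      - integral ({z1..z2} \<times> {0..pi}) (\<lambda>p. w p - c * f (T p))"
    by (subst integral_diff) (auto intro!: rect_integrable continuous_on_rect continuous_intros cont continuous_fT)
  also have "\<dots> \<le> V + e" using z(3) V[of z1 z2] by linarith
  finally show "integral ({x1..x2} \<times> {0..pi}) (\<lambda>p. c * f (T p)) \<le> V + e" .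
qed

lemma dissipation_le_burning_rate:
  assumes V: "\<And>x1 x2. integral ({x1..x2} \<times> {0..pi}) w \<le> V"
  shows "integral ({x1..x2} \<times> {0..pi}) (\<lambda>p. b * ((Tx p)\<^sup>2 + (Ty p)\<^sup>2)) \<le> V"
proof (rule field_le_epsilon)
  fix e :: real assume "e > 0"
  let ?g = "\<lambda>p. b * ((Tx p)\<^sup>2 + (Ty p)\<^sup>2)" and ?h = "\<lambda>p. (1 - T p) * (w p - c * f (T p))"
  obtain z1 z2 where z: "z1 \<le> - max \<bar>x1\<bar> \<bar>x2\<bar>" "z2 \<ge> max \<bar>x1\<bar> \<bar>x2\<bar>"
    "\<bar>integral ({z1..z2} \<times> {0..pi}) (\<lambda>p. ?h p - ?g p)\<bar> \<le> e"
    using dissipation_flux_vanishes[OF \<open>e > 0\<close>, of "max \<bar>x1\<bar> \<bar>x2\<bar>"] by auto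
  have cg: "continuous_on ({z1..z2} \<times> {0..pi}) ?g"
    by (intro continuous_on_rect continuous_intros cont) auto
  have ch: "continuous_on ({z1..z2} \<times> {0..pi}) ?h"
    by (intro continuous_on_rect continuous_intros cont continuous_fT) auto
  have cw: "continuous_on ({z1..z2} \<times> {0..pi}) w" by (intro continuous_on_rect cont) auto
  have "integral ({x1..x2} \<times> {0..pi}) ?g \<le> integral ({z1..z2} \<times> {0..pi}) ?g"
    by (rule rect_subset_le[OF cg]) (use pos z in auto)
  also have "\<dots> = integral ({z1..z2} \<times> {0..pi}) ?h
      - integral ({z1..z2} \<times> {0..pi}) (\<lambda>p. ?h p - ?g p)"
    by (subst integral_diff[OF rect_integrable[OF ch] rect_integrable[OF cg]]) simp
  \<comment> \<open>The weight 1 - T only lowers w, and the reaction enters with the favourable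
    sign.\<close>
  also have "integral ({z1..z2} \<times> {0..pi}) ?h \<le> integral ({z1..z2} \<times> {0..pi}) w"
  proof (rule rect_mono[OF ch cw])
    fix x y assume y: "y \<in> {0..pi}"
    have "T (x, y) \<in> {0..1}" by (rule T_range[OF y])
    then have "(1 - T (x, y)) * w (x, y) \<le> w (x, y)" "(1 - T (x, y)) * (c * f (T (x, y))) \<ge> 0"
      using w_nonneg[OF y, of x] fT_nonneg[OF y, of x] pos by (auto simp: mult_left_le_one_le)
    then show "?h (x, y) \<le> w (x, y)" by (simp add: right_diff_distrib)
  qed
  finally show "integral ({x1..x2} \<times> {0..pi}) ?g \<le> V + e" using z(3) V[of z1 z2] by linarith
qed

end

section \<open>Bump functions of the stream function\<close>

text \<open>Continuously differentiable, odd, supported in [-1, 1] and positive on (0, 1). Oddness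
  matches the horizontal velocity, which changes sign with the stream function at x = 0; the zero at
  0 removes the flux through y = 0.\<close>

definition bump :: "real \<Rightarrow> real" where
  "bump s = s * (max 0 (1 - s\<^sup>2))\<^sup>2"

definition bump' :: "real \<Rightarrow> real" where
  "bump' s = (max 0 (1 - s\<^sup>2))\<^sup>2 - 4 * s\<^sup>2 * max 0 (1 - s\<^sup>2)"

text \<open>The antiderivative of \<open>bump\<close> with the same support; its value -1/6 at 0 is
  the origin of the factor 6 in \<open>tube_mean\<close>.\<close>

definition Bump :: "real \<Rightarrow> real" where
  "Bump s = - ((max 0 (1 - s\<^sup>2)) ^ 3) / 6"

lemma one_plus_square_pos: "1 + (z::real)\<^sup>2 > 0"
  by (smt (verit) zero_le_power2)

text \<open>An exponent of at least 2 makes the positive part differentiable at 0: the difference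
  quotient there is dominated by \<open>(max 0 y) ^ Suc n\<close>.\<close>

lemma DERIV_pos_part_power:
  fixes x :: real
  shows "((\<lambda>x. (max 0 x) ^ Suc (Suc n)) has_real_derivative real (Suc (Suc n)) * (max 0 x) ^ Suc n) (at x)"
proof (cases "x = 0")
  case False
  then consider "x > 0" | "x < 0" by linarith
  then show ?thesis
  proof cases
    case 1
    have "((\<lambda>x. x ^ Suc (Suc n)) has_real_derivative real (Suc (Suc n)) * (max 0 x) ^ Suc n) (at x)"
      using DERIV_pow[of "Suc (Suc n)" x UNIV] 1 by (simp add: max_def)
    moreover have "\<forall>\<^sub>F y in nhds x. (max 0 y) ^ Suc (Suc n) = y ^ Suc (Suc n)"
      using eventually_nhds_in_open[of "{0<..}" x] 1 by (auto elim!: eventually_mono)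
    ultimately show ?thesis by (subst DERIV_cong_ev[OF refl _ refl])
  next
    case 2
    have "((\<lambda>x. 0) has_real_derivative real (Suc (Suc n)) * (max 0 x) ^ Suc n) (at x)"
      using 2 by auto
    moreover have "\<forall>\<^sub>F y in nhds x. (max 0 y) ^ Suc (Suc n) = 0"
      using eventually_nhds_in_open[of "{..<0}" x] 2 by (auto elim!: eventually_mono)
    ultimately show ?thesis by (subst DERIV_cong_ev[OF refl _ refl])
  qed
next
  case True
  have "((\<lambda>y. \<bar>(max 0 y) ^ Suc n\<bar>) \<longlongrightarrow> \<bar>(max 0 0) ^ Suc n\<bar>) (at (0::real))"
    by (intro tendsto_intros)
  then have lim: "((\<lambda>y. \<bar>(max 0 y) ^ Suc n\<bar>) \<longlongrightarrow> 0) (at (0::real))" by simp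
  have "((\<lambda>y. (max 0 y) ^ Suc (Suc n) / y) \<longlongrightarrow> 0) (at (0::real))"
    by (rule Lim_null_comparison[OF always_eventually lim]) (auto simp: abs_mult max_def)
  then show ?thesis using True by (simp add: DERIV_def)
qed

lemma bump_simps:
  "\<bar>s\<bar> \<ge> 1 \<Longrightarrow> bump s = 0" "\<bar>s\<bar> \<ge> 1 \<Longrightarrow> bump' s = 0" "\<bar>s\<bar> \<ge> 1 \<Longrightarrow> Bump s = 0"
  "bump 0 = 0" "Bump 0 = - 1 / 6" "bump (- s) = - bump s"
proof -
  have "max 0 (1 - s\<^sup>2) = 0" if "\<bar>s\<bar> \<ge> 1"
    using that abs_le_square_iff[of 1 s] by simp
  then show "\<bar>s\<bar> \<ge> 1 \<Longrightarrow> bump s = 0" "\<bar>s\<bar> \<ge> 1 \<Longrightarrow> bump' s = 0" "\<bar>s\<bar> \<ge> 1 \<Longrightarrow> Bump s = 0"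
    by (simp_all add: bump_def bump'_def Bump_def)
qed (simp_all add: bump_def Bump_def)

lemma bump_nonneg: "s \<ge> 0 \<Longrightarrow> bump s \<ge> 0"
  by (simp add: bump_def)

lemma DERIV_bump: "(bump has_real_derivative bump' s) (at s)"
proof -
  have "((\<lambda>s. (max 0 (1 - s\<^sup>2)) ^ Suc (Suc 0)) has_real_derivative
      real (Suc (Suc 0)) * (max 0 (1 - s\<^sup>2)) ^ Suc 0 * (- 2 * s)) (at s)"
    by (rule DERIV_chain2[OF DERIV_pos_part_power]) (auto intro!: derivative_eq_intros)
  from DERIV_mult[OF DERIV_ident this] show ?thesis
    by (simp add: bump_def[abs_def] bump'_def power2_eq_square algebra_simps)
qed

lemma DERIV_Bump: "(Bump has_real_derivative bump s) (at s)"
proof -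
  have "((\<lambda>s. (max 0 (1 - s\<^sup>2)) ^ Suc (Suc 1)) has_real_derivative
      real (Suc (Suc 1)) * (max 0 (1 - s\<^sup>2)) ^ Suc 1 * (- 2 * s)) (at s)"
    by (rule DERIV_chain2[OF DERIV_pos_part_power]) (auto intro!: derivative_eq_intros)
  from DERIV_cmult[OF this, of "- 1 / 6"] show ?thesis
    by (simp add: bump_def Bump_def[abs_def] eval_nat_numeral algebra_simps)
qed

lemma continuous_on_bump [continuous_intros]:
  assumes "continuous_on A g"
  shows "continuous_on A (\<lambda>x. bump (g x))" "continuous_on A (\<lambda>x. bump' (g x))"
    "continuous_on A (\<lambda>x. Bump (g x))"
  unfolding bump_def bump'_def Bump_def by (intro continuous_intros assms; simp)+

text \<open>The bound on \<open>bump'\<close> has the shape of the derivative of arctan, so that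
  integrals along straight lines have closed forms. The factor 2 comes from 1 + s^2 \<le> 2 on the
  support.\<close>

lemma bump_bounds:
  "\<bar>bump s\<bar> \<le> 1" "(bump' s)\<^sup>2 \<le> 2 / (1 + s\<^sup>2)" "(Bump s)\<^sup>2 \<le> 1 / 36"
proof -
  show "\<bar>bump s\<bar> \<le> 1"
  proof (cases "\<bar>s\<bar> \<ge> 1")
    case False
    then have "\<bar>s\<bar> * (max 0 (1 - s\<^sup>2))\<^sup>2 \<le> 1 * 1"
      by (intro mult_mono power_le_one) auto
    then show ?thesis by (simp add: bump_def abs_mult)
  qed (simp add: bump_simps)
  show "(bump' s)\<^sup>2 \<le> 2 / (1 + s\<^sup>2)"
  proof (cases "\<bar>s\<bar> \<ge> 1")
    case False
    define q where "q = s\<^sup>2"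
    have q: "0 \<le> q" "q < 1" using False by (auto simp: q_def abs_square_less_1)
    have m: "max 0 (1 - s\<^sup>2) = 1 - q" using q by (simp add: q_def)
    have b: "bump' s = (1 - q) * (1 - 5 * q)"
      unfolding bump'_def m unfolding q_def[symmetric] by (simp add: power2_eq_square algebra_simps)
    have "q * (6 - 5 * q) \<ge> 0" using q by (intro mult_nonneg_nonneg) auto
    then have "(1 - q) * (1 - 5 * q) \<le> 1" by (simp add: algebra_simps)
    \<comment> \<open>Completing the square: 5 ((1 - q)(1 - 5 q) + 1) = (5 q - 3)^2 + 1.\<close>
    moreover have "(1 - q) * (1 - 5 * q) \<ge> - 1"
      using zero_le_power2[of "5 * q - 3"] by (simp add: power2_eq_square algebra_simps)
    ultimately have "\<bar>bump' s\<bar> \<le> 1" by (simp add: b abs_le_iff)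
    then have "(bump' s)\<^sup>2 \<le> 1" by (simp add: abs_square_le_1)
    also have "1 \<le> 2 / (1 + q)" using q by simp
    finally show ?thesis by (simp add: q_def)
  qed (simp add: bump_simps add_nonneg_nonneg)
  have "(max 0 (1 - s\<^sup>2)) ^ 3 \<le> 1" by (rule power_le_one) auto
  then have "((max 0 (1 - s\<^sup>2)) ^ 3)\<^sup>2 \<le> 1" by (intro power_le_one) auto
  then show "(Bump s)\<^sup>2 \<le> 1 / 36" by (simp add: Bump_def power_divide)
qed

section \<open>Tube integrals by arctangent majorants\<close>

lemma integral_arctan:
  fixes g :: "real \<Rightarrow> real"
  assumes "a \<le> b" "\<And>x. x \<in> {a..b} \<Longrightarrow> (g has_real_derivative g' x) (at x within {a..b})"
  shows "integral {a..b} (\<lambda>x. g' x / (1 + (g x)\<^sup>2)) = arctan (g b) - arctan (g a)"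
proof (rule integral_unique, rule fundamental_theorem_of_calculus[OF assms(1)])
  fix x assume "x \<in> {a..b}"
  from DERIV_chain2[OF DERIV_arctan assms(2)[OF this]]
  have "((\<lambda>x. arctan (g x)) has_real_derivative inverse (1 + (g x)\<^sup>2) * g' x) (at x within {a..b})" .
  then show "((\<lambda>x. arctan (g x)) has_vector_derivative g' x / (1 + (g x)\<^sup>2)) (at x within {a..b})"
    by (simp add: has_real_derivative_iff_has_vector_derivative divide_inverse mult.commute)
qed

text \<open>The bound is the same for every g; with g = \<psi>/\<eta> along a line it is uniform in
  \<eta> and in the position of the line.\<close>

lemma integral_arctan_le:
  fixes g :: "real \<Rightarrow> real"
  assumes "a \<le> b" "\<And>x. x \<in> {a..b} \<Longrightarrow> (g has_real_derivative g' x) (at x within {a..b})"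
  shows "integral {a..b} (\<lambda>x. g' x / (1 + (g x)\<^sup>2)) \<le> pi"
  using integral_arctan[of a b g g', OF assms] arctan_bounded[of "g a"] arctan_bounded[of "g b"]
  by linarith

abbreviation corner_rect :: "(real \<times> real) set" where
  "corner_rect \<equiv> {- (pi/2)..pi/2} \<times> {0..pi/2}"

definition tube :: "real \<Rightarrow> real \<times> real \<Rightarrow> real" where
  "tube \<eta> p = sin (fst p) * sin (snd p) / \<eta>"

lemma continuous_on_tube [continuous_intros]: "continuous_on A (tube \<eta>)"
  unfolding tube_def[abs_def] divide_inverse by (intro continuous_intros)

text \<open>One of the two factors cos x sin y is estimated by 1; the other is the x-derivative of
  the stream function, so every horizontal line integrates to a difference of arctans. The tube
  itself has area of order \<eta> log(1/\<eta>) because of the stagnation point; the factor kept is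
  small there and avoids the logarithm.\<close>

lemma bump_tube_gradient_x:
  assumes "\<eta> > 0"
  shows "integral corner_rect (\<lambda>p. (bump' (tube \<eta> p) * (cos (fst p) * sin (snd p) / \<eta>))\<^sup>2) \<le> 16 / \<eta>"
proof -
  let ?g = "\<lambda>p. 2 / \<eta> * ((cos (fst p) * sin (snd p) / \<eta>) / (1 + (tube \<eta> p)\<^sup>2))"
  have nz: "1 + (z::real)\<^sup>2 \<noteq> 0" for z using one_plus_square_pos[of z] by linarith
  have cg: "continuous_on A ?g" for A
    using assms nz by (auto intro!: continuous_intros simp: tube_def)
  have cf: "continuous_on A (\<lambda>p. (bump' (tube \<eta> p) * (cos (fst p) * sin (snd p) / \<eta>))\<^sup>2)" for A
    using assms by (auto intro!: continuous_intros)
  have "integral corner_rect (\<lambda>p. (bump' (tube \<eta> p) * (cos (fst p) * sin (snd p) / \<eta>))\<^sup>2)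
      \<le> integral corner_rect ?g"
  proof (rule rect_mono[OF cf cg])
    fix x y :: real assume "x \<in> {- (pi/2)..pi/2}" "y \<in> {0..pi/2}"
    then have "cos x \<ge> 0" "sin y \<ge> 0" by (auto intro!: cos_ge_zero sin_ge_zero)
    then have cs: "0 \<le> cos x * sin y" "cos x * sin y \<le> 1" by (auto simp: mult_le_one)
    have "(bump' (tube \<eta> (x, y)))\<^sup>2 * (cos x * sin y)\<^sup>2 \<le> 2 / (1 + (tube \<eta> (x, y))\<^sup>2) * (cos x * sin y)"
      using cs one_plus_square_pos[of "tube \<eta> (x, y)"]
      by (intro mult_mono bump_bounds) (auto simp: power2_eq_square[of "cos x * sin y"] mult_left_le)
    then have "(bump' (tube \<eta> (x, y)))\<^sup>2 * (cos x * sin y)\<^sup>2 / \<eta>\<^sup>2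
        \<le> 2 / (1 + (tube \<eta> (x, y))\<^sup>2) * (cos x * sin y) / \<eta>\<^sup>2"
      by (intro divide_right_mono) auto
    then show "(bump' (tube \<eta> (x, y)) * (cos (fst (x, y)) * sin (snd (x, y)) / \<eta>))\<^sup>2 \<le> ?g (x, y)"
      by (simp add: power_mult_distrib power_divide power2_eq_square[of \<eta>] mult.commute)
  qed
  also have "\<dots> = integral {0..pi/2} (\<lambda>y. integral {- (pi/2)..pi/2} (\<lambda>x. ?g (x, y)))"
    by (rule rect_Fubini_swap[OF cg])
  also have "\<dots> \<le> integral {0..pi/2} (\<lambda>y. 2 / \<eta> * pi)"
  proof (rule integral_le)
    show "(\<lambda>y. integral {- (pi/2)..pi/2} (\<lambda>x. ?g (x, y))) integrable_on {0..pi/2}"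
      by (intro integrable_continuous_real continuous_on_slice_integral_swap cg)
    fix y :: real
    have "integral {- (pi/2)..pi/2} (\<lambda>x. (cos x * sin y / \<eta>) / (1 + (sin x * sin y / \<eta>)\<^sup>2)) \<le> pi"
      by (rule integral_arctan_le) (use assms in \<open>auto intro!: derivative_eq_intros\<close>)
    then have "2 / \<eta> * integral {- (pi/2)..pi/2} (\<lambda>x. (cos x * sin y / \<eta>) / (1 + (sin x * sin y / \<eta>)\<^sup>2))
        \<le> 2 / \<eta> * pi"
      using assms by (intro mult_left_mono) auto
    then show "integral {- (pi/2)..pi/2} (\<lambda>x. ?g (x, y)) \<le> 2 / \<eta> * pi"
      unfolding tube_def fst_conv snd_conv integral_mult_right .
  qed auto
  also have "\<dots> = pi * pi / \<eta>" by simp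
  also have "\<dots> \<le> 4 * 4 / \<eta>"
    using assms pi_less_4 pi_gt_zero by (intro divide_right_mono mult_mono) auto
  finally show ?thesis by simp
qed

text \<open>The same along vertical lines. As sin x changes sign on the rectangle, its absolute
  value is used, which does not alter the square of \<open>tube\<close>.\<close>

lemma bump_tube_gradient_y:
  assumes "\<eta> > 0"
  shows "integral corner_rect (\<lambda>p. (bump' (tube \<eta> p) * (sin (fst p) * cos (snd p) / \<eta>))\<^sup>2) \<le> 16 / \<eta>"
proof -
  let ?g = "\<lambda>p. 2 / \<eta> * ((\<bar>sin (fst p)\<bar> * cos (snd p) / \<eta>) / (1 + (tube \<eta> p)\<^sup>2))"
  have nz: "1 + (z::real)\<^sup>2 \<noteq> 0" for z using one_plus_square_pos[of z] by linarith
  have cg: "continuous_on A ?g" for A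
    using assms nz by (auto intro!: continuous_intros simp: tube_def)
  have cf: "continuous_on A (\<lambda>p. (bump' (tube \<eta> p) * (sin (fst p) * cos (snd p) / \<eta>))\<^sup>2)" for A
    using assms by (auto intro!: continuous_intros)
  have "integral corner_rect (\<lambda>p. (bump' (tube \<eta> p) * (sin (fst p) * cos (snd p) / \<eta>))\<^sup>2)
      \<le> integral corner_rect ?g"
  proof (rule rect_mono[OF cf cg])
    fix x y :: real assume "x \<in> {- (pi/2)..pi/2}" "y \<in> {0..pi/2}"
    then have "cos y \<ge> 0" by (auto intro!: cos_ge_zero)
    then have cs: "0 \<le> \<bar>sin x\<bar> * cos y" "\<bar>sin x\<bar> * cos y \<le> 1" by (auto simp: mult_le_one)
    have "(bump' (tube \<eta> (x, y)))\<^sup>2 * (\<bar>sin x\<bar> * cos y)\<^sup>2 \<le> 2 / (1 + (tube \<eta> (x, y))\<^sup>2) * (\<bar>sin x\<bar> * cos y)"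
      using cs one_plus_square_pos[of "tube \<eta> (x, y)"]
      by (intro mult_mono bump_bounds) (auto simp: power2_eq_square[of "\<bar>sin x\<bar> * cos y"] mult_left_le)
    then have "(bump' (tube \<eta> (x, y)))\<^sup>2 * (\<bar>sin x\<bar> * cos y)\<^sup>2 / \<eta>\<^sup>2
        \<le> 2 / (1 + (tube \<eta> (x, y))\<^sup>2) * (\<bar>sin x\<bar> * cos y) / \<eta>\<^sup>2"
      by (intro divide_right_mono) auto
    then show "(bump' (tube \<eta> (x, y)) * (sin (fst (x, y)) * cos (snd (x, y)) / \<eta>))\<^sup>2 \<le> ?g (x, y)"
      by (simp add: power_mult_distrib power_divide power2_eq_square[of \<eta>] mult.commute)
  qed
  also have "\<dots> = integral {- (pi/2)..pi/2} (\<lambda>x. integral {0..pi/2} (\<lambda>y. ?g (x, y)))"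
    by (rule rect_Fubini[OF cg])
  also have "\<dots> \<le> integral {- (pi/2)..pi/2} (\<lambda>x. 2 / \<eta> * (pi / 2))"
  proof (rule integral_le)
    show "(\<lambda>x. integral {0..pi/2} (\<lambda>y. ?g (x, y))) integrable_on {- (pi/2)..pi/2}"
      by (intro integrable_continuous_real continuous_on_slice_integral cg)
    fix x :: real
    have half: "integral {0..pi/2} (\<lambda>y. (r * cos y / \<eta>) / (1 + (r * sin y / \<eta>)\<^sup>2)) \<le> pi / 2" for r
    proof -
      have "integral {0..pi/2} (\<lambda>y. (r * cos y / \<eta>) / (1 + (r * sin y / \<eta>)\<^sup>2))
          = arctan (r * sin (pi/2) / \<eta>) - arctan (r * sin 0 / \<eta>)"
        by (rule integral_arctan) (use assms in \<open>auto intro!: derivative_eq_intros\<close>)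
      then show ?thesis using arctan_ubound[of "r * sin (pi/2) / \<eta>"] by simp
    qed
    have "integral {0..pi/2} (\<lambda>y. (\<bar>sin x\<bar> * cos y / \<eta>) / (1 + (\<bar>sin x\<bar> * sin y / \<eta>)\<^sup>2)) \<le> pi / 2"
      by (rule half)
    then have "2 / \<eta> * integral {0..pi/2} (\<lambda>y. (\<bar>sin x\<bar> * cos y / \<eta>) / (1 + (\<bar>sin x\<bar> * sin y / \<eta>)\<^sup>2))
        \<le> 2 / \<eta> * (pi / 2)"
      using assms by (intro mult_left_mono) auto
    moreover have "(tube \<eta> (x, y))\<^sup>2 = (\<bar>sin x\<bar> * sin y / \<eta>)\<^sup>2" for y
      by (simp add: tube_def power_mult_distrib power_divide)
    ultimately show "integral {0..pi/2} (\<lambda>y. ?g (x, y)) \<le> 2 / \<eta> * (pi / 2)"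
      unfolding fst_conv snd_conv integral_mult_right by simp
  qed auto
  also have "\<dots> = pi * pi / \<eta>" by simp
  also have "\<dots> \<le> 4 * 4 / \<eta>"
    using assms pi_less_4 pi_gt_zero by (intro divide_right_mono mult_mono) auto
  finally show ?thesis by simp
qed

text \<open>For y \<ge> pi/3 one has sin y \<ge> 1/2, so |\<psi>| < \<eta> \<le> 1/4 forces |sin x|
  < 1/2: away from the bottom line the tube is a neighbourhood of the separatrix x = 0 of width
  comparable with \<eta>.\<close>

lemma Bump_tube_square:
  assumes "\<eta> > 0" "\<eta> \<le> 1/4"
  shows "integral ({- (pi/2)..pi/2} \<times> {pi/3..pi/2}) (\<lambda>p. (Bump (tube \<eta> p))\<^sup>2) \<le> 6 * \<eta>"
proof -
  let ?g = "\<lambda>p. 2 * \<eta> * ((cos (fst p) * sin (snd p) / \<eta>) / (1 + (tube \<eta> p)\<^sup>2))"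
  have nz: "1 + (z::real)\<^sup>2 \<noteq> 0" for z using one_plus_square_pos[of z] by linarith
  have cg: "continuous_on A ?g" for A
    using assms nz by (auto intro!: continuous_intros simp: tube_def)
  have cf: "continuous_on A (\<lambda>p. (Bump (tube \<eta> p))\<^sup>2)" for A
    using assms by (auto intro!: continuous_intros)
  have "integral ({- (pi/2)..pi/2} \<times> {pi/3..pi/2}) (\<lambda>p. (Bump (tube \<eta> p))\<^sup>2)
      \<le> integral ({- (pi/2)..pi/2} \<times> {pi/3..pi/2}) ?g"
  proof (rule rect_mono[OF cf cg])
    fix x y :: real assume x: "x \<in> {- (pi/2)..pi/2}" and y: "y \<in> {pi/3..pi/2}"
    have c0: "cos x \<ge> 0" using x by (auto intro!: cos_ge_zero)
    have "sin (pi/6) \<le> sin y" using y by (intro sin_monotone_2pi_le) auto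
    then have s: "sin y \<ge> 1 / 2" by (simp add: sin_30)
    define v where "v = tube \<eta> (x, y)"
    show "(Bump (tube \<eta> (x, y)))\<^sup>2 \<le> ?g (x, y)"
    proof (cases "\<bar>v\<bar> \<ge> 1")
      case True
      then show ?thesis
        using c0 s assms by (auto simp: v_def bump_simps intro!: mult_nonneg_nonneg divide_nonneg_nonneg)
    next
      case False
      then have "\<bar>sin x\<bar> * sin y < \<eta>"
        using assms s by (simp add: v_def tube_def abs_mult)
      moreover have "\<bar>sin x\<bar> * sin y \<ge> \<bar>sin x\<bar> * (1 / 2)" using s by (intro mult_left_mono) auto
      ultimately have "\<bar>sin x\<bar> \<le> 1 / 2" using assms by linarith
      then have "\<bar>sin x\<bar>\<^sup>2 \<le> (1 / 2)\<^sup>2" by (intro power_mono) auto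
      then have "(cos x)\<^sup>2 \<ge> (1 / 2)\<^sup>2" using sin_cos_squared_add[of x] by (simp add: power2_eq_square)
      then have c: "cos x \<ge> 1 / 2" using c0 by (rule power2_le_imp_le)
      have "(1 / 2) * (1 / 2) \<le> cos x * sin y" using c s by (intro mult_mono) auto
      moreover have "1 / (1 + v\<^sup>2) \<ge> 1 / 2"
        using False one_plus_square_pos[of v] by (intro frac_le) (auto simp: abs_square_le_1)
      \<comment> \<open>On the tube the majorant is thus at least 1/4, well above the bound 1/36 for
        the square of \<open>Bump\<close>.\<close>
      ultimately have "(1/4) * (1 / 2) \<le> (cos x * sin y) * (1 / (1 + v\<^sup>2))" by (intro mult_mono) auto
      moreover have "?g (x, y) = 2 * ((cos x * sin y) * (1 / (1 + v\<^sup>2)))" using assms by (simp add: v_def)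
      ultimately show ?thesis using bump_bounds(3)[of v] by (simp add: v_def)
    qed
  qed
  also have "\<dots> = integral {pi/3..pi/2} (\<lambda>y. integral {- (pi/2)..pi/2} (\<lambda>x. ?g (x, y)))"
    by (rule rect_Fubini_swap[OF cg])
  also have "\<dots> \<le> integral {pi/3..pi/2} (\<lambda>y. 2 * \<eta> * pi)"
  proof (rule integral_le)
    show "(\<lambda>y. integral {- (pi/2)..pi/2} (\<lambda>x. ?g (x, y))) integrable_on {pi/3..pi/2}"
      by (intro integrable_continuous_real continuous_on_slice_integral_swap cg)
    fix y :: real
    have "integral {- (pi/2)..pi/2} (\<lambda>x. (cos x * sin y / \<eta>) / (1 + (sin x * sin y / \<eta>)\<^sup>2)) \<le> pi"
      by (rule integral_arctan_le) (use assms in \<open>auto intro!: derivative_eq_intros\<close>)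
    then have "2 * \<eta> * integral {- (pi/2)..pi/2} (\<lambda>x. (cos x * sin y / \<eta>) / (1 + (sin x * sin y / \<eta>)\<^sup>2))
        \<le> 2 * \<eta> * pi"
      using assms by (intro mult_left_mono) auto
    then show "integral {- (pi/2)..pi/2} (\<lambda>x. ?g (x, y)) \<le> 2 * \<eta> * pi"
      unfolding tube_def fst_conv snd_conv integral_mult_right .
  qed auto
  also have "\<dots> = \<eta> * (pi * pi) / 3" by (simp add: field_simps)
  also have "\<dots> \<le> \<eta> * (4 * 4) / 3"
    using assms pi_less_4 pi_gt_zero by (intro divide_right_mono mult_left_mono mult_mono) auto
  also have "\<dots> \<le> 6 * \<eta>" using assms by simp
  finally show ?thesis .
qed

section \<open>Streamline tubes near a corner of a cell\<close>

text \<open>With z = y/2: sin y = 2 sin z cos z, z \<le> tan z, and cos^2 z \<ge> 1/2 for z \<le>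
  pi/4. It serves to bound the height of the tube above the bottom line.\<close>

lemma sin_ge_half:
  assumes "0 \<le> y" "y \<le> pi / 2"
  shows "y / 2 \<le> sin y"
proof -
  define z where "z = y / 2"
  have z: "0 \<le> z" "z \<le> pi / 4" using assms by (auto simp: z_def)
  have z2: "- (pi / 2) < z" "z < pi / 2" using z pi_gt_zero by linarith+
  then have c: "cos z > 0" by (rule cos_gt_zero_pi)
  have "sin z \<ge> 0" using z by (intro sin_ge_zero) auto
  then have "z \<le> sin z / cos z"
    using abs_tan_ge[of z] z z2 c by (simp add: tan_def)
  then have s: "z * cos z \<le> sin z" using c by (simp add: pos_le_divide_eq)
  have "cos (pi / 4) \<le> cos z" using z by (intro cos_monotone_0_pi_le) auto
  then have "(cos (pi / 4))\<^sup>2 \<le> (cos z)\<^sup>2" by (intro power_mono) (auto simp: cos_45)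
  then have c2: "1 / 2 \<le> (cos z)\<^sup>2" by (simp add: cos_45 power_divide)
  have "z = z * (1 / 2) * 2" by simp
  also have "\<dots> \<le> z * (cos z)\<^sup>2 * 2" using z c2 by (intro mult_right_mono mult_left_mono) auto
  also have "\<dots> = 2 * (z * cos z) * cos z" by (simp add: power2_eq_square)
  also have "\<dots> \<le> 2 * sin z * cos z" using s c by (intro mult_right_mono mult_left_mono) auto
  also have "\<dots> = sin y" using sin_double[of z] by (simp add: z_def)
  finally show ?thesis by (simp add: z_def)
qed

text \<open>Coordinates are centred at a corner on the bottom line, and the rectangle reaches from
  the middle of one cell to the middle of the next. \<alpha> carries the sign of the flow, which
  alternates from corner to corner; h stands for the reaction term. The 16 in \<open>scale\<close>
  means 4 \<eta> = sqrt (b / |\<alpha>|).\<close>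

locale corner_flow =
  fixes \<alpha> b \<eta> :: real and h T Tx Ty Txx Tyy w :: "real \<times> real \<Rightarrow> real"
  assumes pos: "b > 0" "\<eta> > 0" "\<eta> \<le> 1/4" and scale: "16 * \<eta>\<^sup>2 * \<bar>\<alpha>\<bar> = b"
    and cont: "continuous_on corner_rect T" "continuous_on corner_rect Tx"
      "continuous_on corner_rect Ty" "continuous_on corner_rect Txx"
      "continuous_on corner_rect Tyy" "continuous_on corner_rect w" "continuous_on corner_rect h"
    and Tx: "\<And>x y. x \<in> {- (pi/2)..pi/2} \<Longrightarrow> y \<in> {0..pi/2} \<Longrightarrow>
      ((\<lambda>s. T (s, y)) has_real_derivative Tx (x, y)) (at x within {- (pi/2)..pi/2})"
    and Txx: "\<And>x y. x \<in> {- (pi/2)..pi/2} \<Longrightarrow> y \<in> {0..pi/2} \<Longrightarrow>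
      ((\<lambda>s. Tx (s, y)) has_real_derivative Txx (x, y)) (at x within {- (pi/2)..pi/2})"
    and Ty: "\<And>x y. x \<in> {- (pi/2)..pi/2} \<Longrightarrow> y \<in> {0..pi/2} \<Longrightarrow>
      ((\<lambda>s. T (x, s)) has_real_derivative Ty (x, y)) (at y within {0..pi/2})"
    and Tyy: "\<And>x y. x \<in> {- (pi/2)..pi/2} \<Longrightarrow> y \<in> {0..pi/2} \<Longrightarrow>
      ((\<lambda>s. Ty (x, s)) has_real_derivative Tyy (x, y)) (at y within {0..pi/2})"
    and h_nonneg: "\<And>x y. x \<in> {- (pi/2)..pi/2} \<Longrightarrow> y \<in> {0..pi/2} \<Longrightarrow> h (x, y) \<ge> 0"
    and w_nonneg: "\<And>x y. x \<in> {- (pi/2)..pi/2} \<Longrightarrow> y \<in> {0..pi/2} \<Longrightarrow> w (x, y) \<ge> 0"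
    and eq: "\<And>x y. x \<in> {- (pi/2)..pi/2} \<Longrightarrow> y \<in> {0..pi/2} \<Longrightarrow>
      w (x, y) + \<alpha> * (sin x * cos y * Tx (x, y) - cos x * sin y * Ty (x, y)) =
        b * (Txx (x, y) + Tyy (x, y)) + h (x, y)"
begin

definition "energy_density p = (Tx p)\<^sup>2 + (Ty p)\<^sup>2 + (h p + w p) / b"
definition "energy = integral corner_rect energy_density"
definition "tube_bump p = bump (tube \<eta> p)"
definition "tube_bump_x p = bump' (tube \<eta> p) * (cos (fst p) * sin (snd p) / \<eta>)"
definition "tube_bump_y p = bump' (tube \<eta> p) * (sin (fst p) * cos (snd p) / \<eta>)"
text \<open>Diffusion is included so that the balance of fluxes is exact. On both sides of s = 0 the
  weight \<open>tube_bump\<close> times sin s cos y is nonnegative.\<close>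

definition "flux s r =
  integral {0..r} (\<lambda>y. tube_bump (s, y) * (\<alpha> * (sin s * cos y * T (s, y)) - b * Tx (s, y)))"
definition "top_flux s1 s2 r =
  integral {s1..s2} (\<lambda>x. tube_bump (x, r) * (- \<alpha> * (cos x * sin r * T (x, r)) - b * Ty (x, r)))"
text \<open>For |sin s| \<ge> \<eta> the advective weight in \<open>flux\<close> has total mass
  \<eta>\<alpha>/6, so this is a weighted mean of T minus a diffusive correction. Dividing by the
  signed \<alpha> keeps the weight nonnegative at every corner.\<close>

definition "tube_mean s = 6 / (\<eta> * \<alpha>) * flux s (pi/2)"

lemma tube_bump_continuous [continuous_intros]:
  "continuous_on A tube_bump" "continuous_on A tube_bump_x" "continuous_on A tube_bump_y"
  using pos unfolding tube_bump_def[abs_def] tube_bump_x_def[abs_def] tube_bump_y_def[abs_def]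
  by (intro continuous_intros; simp)+

lemma DERIV_tube_bump:
  "((\<lambda>s. tube_bump (s, y)) has_real_derivative tube_bump_x (x, y)) (at x within A)"
  "((\<lambda>s. tube_bump (x, s)) has_real_derivative tube_bump_y (x, y)) (at y within A)"
proof -
  have "((\<lambda>s. bump (sin s * sin y / \<eta>)) has_real_derivative
      bump' (sin x * sin y / \<eta>) * (cos x * sin y / \<eta>)) (at x within A)"
    by (rule DERIV_chain2[OF DERIV_bump]) (use pos in \<open>auto intro!: derivative_eq_intros\<close>)
  then show "((\<lambda>s. tube_bump (s, y)) has_real_derivative tube_bump_x (x, y)) (at x within A)"
    by (simp add: tube_bump_def tube_bump_x_def tube_def)
  have "((\<lambda>s. bump (sin x * sin s / \<eta>)) has_real_derivative
      bump' (sin x * sin y / \<eta>) * (sin x * cos y / \<eta>)) (at y within A)"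
    by (rule DERIV_chain2[OF DERIV_bump]) (use pos in \<open>auto intro!: derivative_eq_intros\<close>)
  then show "((\<lambda>s. tube_bump (x, s)) has_real_derivative tube_bump_y (x, y)) (at y within A)"
    by (simp add: tube_bump_def tube_bump_y_def tube_def)
qed

lemma energy_density_continuous: "continuous_on corner_rect energy_density"
  using pos unfolding energy_density_def[abs_def] by (intro continuous_intros cont) auto

lemma energy_density_bounds:
  assumes "x \<in> {- (pi/2)..pi/2}" "y \<in> {0..pi/2}"
  shows "(Tx (x, y))\<^sup>2 \<le> energy_density (x, y)" "(Ty (x, y))\<^sup>2 \<le> energy_density (x, y)"
    "h (x, y) + w (x, y) \<le> b * energy_density (x, y)" "energy_density (x, y) \<ge> 0"
proof -
  have 1: "(h (x, y) + w (x, y)) / b \<ge> 0"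
    using h_nonneg[OF assms] w_nonneg[OF assms] pos by auto
  then show "(Tx (x, y))\<^sup>2 \<le> energy_density (x, y)" "(Ty (x, y))\<^sup>2 \<le> energy_density (x, y)"
    "energy_density (x, y) \<ge> 0" by (auto simp: energy_density_def)
  have "h (x, y) + w (x, y) = b * ((h (x, y) + w (x, y)) / b)" using pos by simp
  also have "\<dots> \<le> b * energy_density (x, y)"
    using pos by (intro mult_left_mono) (auto simp: energy_density_def)
  finally show "h (x, y) + w (x, y) \<le> b * energy_density (x, y)" .
qed

lemma energy_nonneg: "energy \<ge> 0"
  unfolding energy_def
  by (rule integral_nonneg) (use energy_density_bounds(4) in \<open>auto intro!: rect_integrable energy_density_continuous\<close>)

lemma subrect_energy:
  assumes "{s1..s2} \<subseteq> {- (pi/2)..pi/2}" "{r1..r2} \<subseteq> {0..pi/2}"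
  shows "integral ({s1..s2} \<times> {r1..r2}) energy_density \<le> energy"
  unfolding energy_def
  by (rule rect_subset_le[OF energy_density_continuous])
    (use assms energy_density_bounds(4) in \<open>auto intro: Sigma_mono\<close>)

lemma gradient_Cauchy_Schwarz:
  assumes sub: "{s1..s2} \<subseteq> {- (pi/2)..pi/2}" "{r1..r2} \<subseteq> {0..pi/2}"
    and g: "continuous_on ({s1..s2} \<times> {r1..r2}) g"
    and A: "integral ({s1..s2} \<times> {r1..r2}) (\<lambda>p. (g p)\<^sup>2) \<le> A"
  shows "integral ({s1..s2} \<times> {r1..r2}) (\<lambda>p. \<bar>g p\<bar> * \<bar>Tx p\<bar>) \<le> sqrt (A * energy)"
    and "integral ({s1..s2} \<times> {r1..r2}) (\<lambda>p. \<bar>g p\<bar> * \<bar>Ty p\<bar>) \<le> sqrt (A * energy)"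
proof -
  have D: "{s1..s2} \<times> {r1..r2} \<subseteq> corner_rect" using sub by (intro Sigma_mono) auto
  note c = continuous_on_subset[OF _ D]
  have en: "integral ({s1..s2} \<times> {r1..r2}) (\<lambda>p. (Tx p)\<^sup>2) \<le> energy"
    "integral ({s1..s2} \<times> {r1..r2}) (\<lambda>p. (Ty p)\<^sup>2) \<le> energy"
    by (rule order_trans[OF rect_mono subrect_energy[OF sub]];
      use sub energy_density_bounds in \<open>auto intro!: continuous_intros c cont energy_density_continuous\<close>)+
  have I: "0 \<le> integral ({s1..s2} \<times> {r1..r2}) (\<lambda>p. (g p)\<^sup>2)"
    by (rule integral_nonneg) (auto intro!: rect_integrable continuous_intros g)
  have J: "0 \<le> integral ({s1..s2} \<times> {r1..r2}) (\<lambda>p. (u p)\<^sup>2)" if "continuous_on corner_rect u"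
    for u :: "real \<times> real \<Rightarrow> real"
    by (rule integral_nonneg) (auto intro!: rect_integrable continuous_intros c that)
  show "integral ({s1..s2} \<times> {r1..r2}) (\<lambda>p. \<bar>g p\<bar> * \<bar>Tx p\<bar>) \<le> sqrt (A * energy)"
    by (rule order_trans[OF rect_Cauchy_Schwarz[OF g c[OF cont(2)]]])
      (use A en(1) I J[OF cont(2)] in \<open>auto intro!: real_sqrt_le_mono mult_mono\<close>)
  show "integral ({s1..s2} \<times> {r1..r2}) (\<lambda>p. \<bar>g p\<bar> * \<bar>Ty p\<bar>) \<le> sqrt (A * energy)"
    by (rule order_trans[OF rect_Cauchy_Schwarz[OF g c[OF cont(3)]]])
      (use A en(2) I J[OF cont(3)] in \<open>auto intro!: real_sqrt_le_mono mult_mono\<close>)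
qed

text \<open>Divergence theorem for the total flux times the bump. The gradient of the bump is
  orthogonal to the velocity, so T itself drops out of the interior; the bump vanishes on y = 0, so
  the bottom line contributes nothing.\<close>

lemma flux_identity:
  assumes s: "- (pi/2) \<le> s1" "s1 \<le> s2" "s2 \<le> pi/2" and r: "0 \<le> r" "r \<le> pi/2"
  shows "flux s2 r - flux s1 r + top_flux s1 s2 r = integral ({s1..s2} \<times> {0..r})
    (\<lambda>p. tube_bump p * (h p - w p) - b * (tube_bump_x p * Tx p + tube_bump_y p * Ty p))"
proof -
  have sub: "{s1..s2} \<subseteq> {- (pi/2)..pi/2}" "{0..r} \<subseteq> {0..pi/2}" using s r by auto
  have D: "{s1..s2} \<times> {0..r} \<subseteq> corner_rect" using sub by (intro Sigma_mono) auto
  note c = continuous_on_subset[OF _ D]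
  define P where "P = (\<lambda>p. tube_bump p * (\<alpha> * (sin (fst p) * cos (snd p) * T p) - b * Tx p))"
  define Px where "Px = (\<lambda>p. tube_bump_x p * (\<alpha> * (sin (fst p) * cos (snd p) * T p) - b * Tx p)
    + (\<alpha> * (cos (fst p) * cos (snd p) * T p + sin (fst p) * cos (snd p) * Tx p) - b * Txx p) * tube_bump p)"
  define Q where "Q = (\<lambda>p. tube_bump p * (- \<alpha> * (cos (fst p) * sin (snd p) * T p) - b * Ty p))"
  define Qy where "Qy = (\<lambda>p. tube_bump_y p * (- \<alpha> * (cos (fst p) * sin (snd p) * T p) - b * Ty p)
    + (- \<alpha> * (cos (fst p) * cos (snd p) * T p + cos (fst p) * sin (snd p) * Ty p) - b * Tyy p) * tube_bump p)"
  have "integral ({s1..s2} \<times> {0..r}) (\<lambda>p. Px p + Qy p) =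
      integral {0..r} (\<lambda>y. P (s2, y) - P (s1, y)) + integral {s1..s2} (\<lambda>x. Q (x, r) - Q (x, 0))"
  proof (rule rect_divergence)
    show "((\<lambda>s. P (s, y)) has_real_derivative Px (x, y)) (at x within {s1..s2})"
      if "x \<in> {s1..s2}" "y \<in> {0..r}" for x y
    proof -
      have xy: "x \<in> {- (pi/2)..pi/2}" "y \<in> {0..pi/2}" using that sub by blast+
      note d = DERIV_subset[OF Tx[OF xy] sub(1)] DERIV_subset[OF Txx[OF xy] sub(1)]
      have "((\<lambda>s. \<alpha> * (sin s * cos y * T (s, y)) - b * Tx (s, y)) has_real_derivative
          \<alpha> * (cos x * cos y * T (x, y) + sin x * cos y * Tx (x, y)) - b * Txx (x, y)) (at x within {s1..s2})"
        by (auto intro!: derivative_eq_intros d)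
      from DERIV_mult[OF DERIV_tube_bump(1) this] show ?thesis by (simp add: P_def Px_def)
    qed
    show "((\<lambda>s. Q (x, s)) has_real_derivative Qy (x, y)) (at y within {0..r})"
      if "x \<in> {s1..s2}" "y \<in> {0..r}" for x y
    proof -
      have xy: "x \<in> {- (pi/2)..pi/2}" "y \<in> {0..pi/2}" using that sub by blast+
      note d = DERIV_subset[OF Ty[OF xy] sub(2)] DERIV_subset[OF Tyy[OF xy] sub(2)]
      have "((\<lambda>s. - \<alpha> * (cos x * sin s * T (x, s)) - b * Ty (x, s)) has_real_derivative
          - \<alpha> * (cos x * cos y * T (x, y) + cos x * sin y * Ty (x, y)) - b * Tyy (x, y)) (at y within {0..r})"
        by (auto intro!: derivative_eq_intros d)
      from DERIV_mult[OF DERIV_tube_bump(2) this] show ?thesis by (simp add: Q_def Qy_def)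
    qed
    show "continuous_on ({s1..s2} \<times> {0..r}) Px" "continuous_on ({s1..s2} \<times> {0..r}) Qy"
      unfolding Px_def Qy_def by (intro continuous_intros c cont)+
  qed (use s r in auto)
  moreover have "integral ({s1..s2} \<times> {0..r}) (\<lambda>p. Px p + Qy p) = integral ({s1..s2} \<times> {0..r})
    (\<lambda>p. tube_bump p * (h p - w p) - b * (tube_bump_x p * Tx p + tube_bump_y p * Ty p))"
  proof (rule integral_cong)
    fix p assume "p \<in> {s1..s2} \<times> {0..r}"
    then obtain x y where p: "p = (x, y)" "x \<in> {s1..s2}" "y \<in> {0..r}" by auto
    have xy: "x \<in> {- (pi/2)..pi/2}" "y \<in> {0..pi/2}" using p(2,3) sub by blast+
    note p = p(1)
    have orth: "tube_bump_x p * (sin x * cos y) = tube_bump_y p * (cos x * sin y)"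
      by (simp add: tube_bump_x_def tube_bump_y_def p)
    have hw: "h p - w p = \<alpha> * (sin x * cos y * Tx p - cos x * sin y * Ty p) - b * (Txx p + Tyy p)"
      using eq[OF xy] by (simp add: p)
    have "Px p + Qy p = \<alpha> * T p * (tube_bump_x p * (sin x * cos y) - tube_bump_y p * (cos x * sin y))
      + tube_bump p * (\<alpha> * (sin x * cos y * Tx p - cos x * sin y * Ty p) - b * (Txx p + Tyy p))
      - b * (tube_bump_x p * Tx p + tube_bump_y p * Ty p)"
      by (simp add: Px_def Qy_def p algebra_simps)
    then show "Px p + Qy p = tube_bump p * (h p - w p) - b * (tube_bump_x p * Tx p + tube_bump_y p * Ty p)"
      by (simp add: orth hw)
  qed
  moreover have "integral {0..r} (\<lambda>y. P (s2, y) - P (s1, y)) = flux s2 r - flux s1 r"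
  proof -
    have "continuous_on {0..r} (\<lambda>y. P (s, y))" if "s \<in> {s1..s2}" for s
      by (rule continuous_on_slice(1)[OF _ that]) (unfold P_def, intro continuous_intros c cont)
    then show ?thesis
      using s by (subst integral_diff) (auto intro!: integrable_continuous_real simp: flux_def P_def)
  qed
  moreover have "integral {s1..s2} (\<lambda>x. Q (x, r) - Q (x, 0)) = top_flux s1 s2 r"
    by (simp add: top_flux_def Q_def tube_bump_def tube_def bump_simps)
  ultimately show ?thesis by simp
qed

text \<open>Reaction and time derivative cost b times the energy since |bump| \<le> 1; each of the
  two gradient terms costs 4 sqrt (energy / \<eta>) by Cauchy-Schwarz with 16/\<eta>, hence the
  8.\<close>

lemma interior_flux_bound:
  assumes s: "- (pi/2) \<le> s1" "s1 \<le> s2" "s2 \<le> pi/2" and r: "0 \<le> r" "r \<le> pi/2"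
  shows "\<bar>flux s2 r - flux s1 r + top_flux s1 s2 r\<bar> \<le> b * (energy + 8 * sqrt (energy / \<eta>))"
proof -
  let ?R = "{s1..s2} \<times> {0..r}"
  have sub: "{s1..s2} \<subseteq> {- (pi/2)..pi/2}" "{0..r} \<subseteq> {0..pi/2}" using s r by auto
  have D: "?R \<subseteq> corner_rect" using sub by (intro Sigma_mono) auto
  note c = continuous_on_subset[OF _ D]
  have gx: "integral ?R (\<lambda>p. (tube_bump_x p)\<^sup>2) \<le> 16 / \<eta>"
  proof -
    have "integral ?R (\<lambda>p. (tube_bump_x p)\<^sup>2) \<le> integral corner_rect (\<lambda>p. (tube_bump_x p)\<^sup>2)"
      by (rule rect_subset_le[OF _ D]) (auto intro!: continuous_intros)
    also have "\<dots> \<le> 16 / \<eta>" unfolding tube_bump_x_def by (rule bump_tube_gradient_x[OF pos(2)])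
    finally show ?thesis .
  qed
  have gy: "integral ?R (\<lambda>p. (tube_bump_y p)\<^sup>2) \<le> 16 / \<eta>"
  proof -
    have "integral ?R (\<lambda>p. (tube_bump_y p)\<^sup>2) \<le> integral corner_rect (\<lambda>p. (tube_bump_y p)\<^sup>2)"
      by (rule rect_subset_le[OF _ D]) (auto intro!: continuous_intros)
    also have "\<dots> \<le> 16 / \<eta>" unfolding tube_bump_y_def by (rule bump_tube_gradient_y[OF pos(2)])
    finally show ?thesis .
  qed
  have s16: "sqrt (16 / \<eta> * energy) = 4 * sqrt (energy / \<eta>)"
    by (simp add: real_sqrt_mult real_sqrt_divide)
  let ?g1 = "\<lambda>p. \<bar>tube_bump_x p\<bar> * \<bar>Tx p\<bar>" and ?g2 = "\<lambda>p. \<bar>tube_bump_y p\<bar> * \<bar>Ty p\<bar>"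
  have "\<bar>integral ?R (\<lambda>p. tube_bump p * (h p - w p) - b * (tube_bump_x p * Tx p + tube_bump_y p * Ty p))\<bar>
    \<le> integral ?R (\<lambda>p. b * energy_density p + (b * ?g1 p + b * ?g2 p))"
  proof (rule abs_integral_le)
    fix p assume "p \<in> ?R"
    then obtain x y where p: "p = (x, y)" "x \<in> {s1..s2}" "y \<in> {0..r}" by auto
    have xy: "x \<in> {- (pi/2)..pi/2}" "y \<in> {0..pi/2}" using p(2,3) sub by blast+
    note p = p(1)
    have "\<bar>tube_bump p * (h p - w p)\<bar> \<le> 1 * (h p + w p)"
      unfolding abs_mult
      using bump_bounds(1)[of "tube \<eta> p"] h_nonneg[OF xy] w_nonneg[OF xy]
      by (intro mult_mono) (auto simp: tube_bump_def p)
    also have "\<dots> \<le> b * energy_density p" using energy_density_bounds(3)[OF xy] by (simp add: p)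
    finally have 1: "\<bar>tube_bump p * (h p - w p)\<bar> \<le> b * energy_density p" .
    have "\<bar>tube_bump_x p * Tx p + tube_bump_y p * Ty p\<bar> \<le> ?g1 p + ?g2 p"
      using abs_triangle_ineq[of "tube_bump_x p * Tx p" "tube_bump_y p * Ty p"] by (simp add: abs_mult)
    then have 2: "\<bar>b * (tube_bump_x p * Tx p + tube_bump_y p * Ty p)\<bar> \<le> b * ?g1 p + b * ?g2 p"
      using pos by (simp add: abs_mult flip: distrib_left)
    show "\<bar>tube_bump p * (h p - w p) - b * (tube_bump_x p * Tx p + tube_bump_y p * Ty p)\<bar>
      \<le> b * energy_density p + (b * ?g1 p + b * ?g2 p)"
      using 1 2 by linarith
  qed (intro rect_integrable continuous_intros c cont energy_density_continuous)+
  also have "\<dots> = b * integral ?R energy_density + (b * integral ?R ?g1 + b * integral ?R ?g2)"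
  proof -
    have "energy_density integrable_on ?R" "?g1 integrable_on ?R" "?g2 integrable_on ?R"
      by (intro rect_integrable continuous_intros c cont energy_density_continuous)+
    from this[THEN integrable_integral] show ?thesis
      by (intro integral_unique has_integral_add has_integral_mult_right)
  qed
  also have "\<dots> \<le> b * energy + (b * (4 * sqrt (energy / \<eta>)) + b * (4 * sqrt (energy / \<eta>)))"
    using subrect_energy[OF sub] gradient_Cauchy_Schwarz(1)[OF sub tube_bump_continuous(2) gx]
      gradient_Cauchy_Schwarz(2)[OF sub tube_bump_continuous(3) gy] pos
    unfolding s16 by (intro add_mono mult_left_mono) auto
  finally show ?thesis unfolding flux_identity[OF s r] by (simp add: algebra_simps)
qed

text \<open>On y = r the bump times cos x sin r is the x-derivative of \<eta> times
  \<open>Bump\<close>, so integration by parts trades T for \<open>Tx\<close>; the square integral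
  of \<open>Bump\<close> is of order \<eta> and contributes sqrt \<eta>. There are no end point
  terms, as x = pi/2 and x = -pi/2 lie outside the tube at height r.\<close>

lemma top_flux_bound:
  "\<exists>r\<in>{pi/3..pi/2}. \<bar>top_flux (- (pi/2)) (pi/2) r\<bar>
    \<le> 9 * (\<bar>\<alpha>\<bar> * \<eta> * sqrt (\<eta> * energy) + b * sqrt energy)"
proof -
  let ?I = "{- (pi/2)..pi/2}" and ?J = "{pi/3..pi/2}"
  let ?B = "\<lambda>p. Bump (tube \<eta> p)"
  let ?g = "\<lambda>p. \<bar>\<alpha>\<bar> * \<eta> * (\<bar>?B p\<bar> * \<bar>Tx p\<bar>) + b * (\<bar>tube_bump p\<bar> * \<bar>Ty p\<bar>)"
  have sub: "?I \<subseteq> {- (pi/2)..pi/2}" "?J \<subseteq> {0..pi/2}" by auto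
  have D: "?I \<times> ?J \<subseteq> corner_rect" using sub by (intro Sigma_mono) auto
  note c = continuous_on_subset[OF _ D]
  have cB: "continuous_on A ?B" for A by (intro continuous_intros)
  have cg: "continuous_on (?I \<times> ?J) ?g" by (intro continuous_intros c cont)
  have bump2: "integral (?I \<times> ?J) (\<lambda>p. (tube_bump p)\<^sup>2) \<le> 8"
  proof -
    have "integral (?I \<times> ?J) (\<lambda>p. (tube_bump p)\<^sup>2) \<le> integral corner_rect (\<lambda>p. (tube_bump p)\<^sup>2)"
      by (rule rect_subset_le[OF _ D]) (auto intro!: continuous_intros)
    also have "\<dots> \<le> integral corner_rect (\<lambda>p. 1)"
      by (rule rect_mono) (auto intro!: continuous_intros bump_bounds(1) simp: tube_bump_def abs_square_le_1)
    also have "\<dots> = pi * pi / 2"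
      by (subst rect_Fubini) (auto intro!: continuous_intros)
    also have "\<dots> \<le> 4 * 4 / 2"
      using pi_less_4 pi_gt_zero by (intro divide_right_mono mult_mono) auto
    finally show ?thesis by simp
  qed
  have tot: "integral (?I \<times> ?J) ?g \<le> 3 * (\<bar>\<alpha>\<bar> * \<eta> * sqrt (\<eta> * energy) + b * sqrt energy)"
  proof -
    have "(\<lambda>p. \<bar>?B p\<bar> * \<bar>Tx p\<bar>) integrable_on ?I \<times> ?J" "(\<lambda>p. \<bar>tube_bump p\<bar> * \<bar>Ty p\<bar>) integrable_on ?I \<times> ?J"
      by (intro rect_integrable continuous_intros c cont)+
    from this[THEN integrable_integral]
    have "integral (?I \<times> ?J) ?g = \<bar>\<alpha>\<bar> * \<eta> * integral (?I \<times> ?J) (\<lambda>p. \<bar>?B p\<bar> * \<bar>Tx p\<bar>)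
        + b * integral (?I \<times> ?J) (\<lambda>p. \<bar>tube_bump p\<bar> * \<bar>Ty p\<bar>)"
      by (intro integral_unique has_integral_add has_integral_mult_right)
    also have "\<dots> \<le> \<bar>\<alpha>\<bar> * \<eta> * sqrt (6 * \<eta> * energy) + b * sqrt (8 * energy)"
      using gradient_Cauchy_Schwarz(1)[OF sub cB Bump_tube_square[OF pos(2,3)]]
        gradient_Cauchy_Schwarz(2)[OF sub tube_bump_continuous(1) bump2] pos
      by (intro add_mono mult_left_mono) auto
    also have "\<dots> \<le> \<bar>\<alpha>\<bar> * \<eta> * (3 * sqrt (\<eta> * energy)) + b * (3 * sqrt energy)"
    proof -
      have "sqrt (6 * \<eta> * energy) \<le> sqrt (9 * (\<eta> * energy))" "sqrt (8 * energy) \<le> sqrt (9 * energy)"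
        using energy_nonneg pos by (auto intro!: real_sqrt_le_mono mult_right_mono)
      then show ?thesis using pos by (intro add_mono mult_left_mono) (auto simp: real_sqrt_mult)
    qed
    finally show ?thesis by (simp add: algebra_simps)
  qed
  \<comment> \<open>A height at which the line integral equals its average over {pi/3..pi/2}; this
    interval is longer than 1/3, which costs a factor 3.\<close>
  obtain r where r: "r \<in> ?J"
    "integral ?J (\<lambda>r. integral ?I (\<lambda>x. ?g (x, r))) = integral ?I (\<lambda>x. ?g (x, r)) * (pi/2 - pi/3)"
    using integral_mean_value[of "pi/3" "pi/2" "\<lambda>r. integral ?I (\<lambda>x. ?g (x, r))"]
      continuous_on_slice_integral_swap[OF cg] pi_gt_zero by auto
  have r': "0 \<le> r" "r \<le> pi/2" using r(1) pi_gt_zero by auto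
  define H where "H = integral ?I (\<lambda>x. ?g (x, r))"
  have cgr: "(\<lambda>x. ?g (x, r)) integrable_on ?I"
    by (intro integrable_continuous_real continuous_on_slice(2)[OF cg r(1)])
  have H0: "H \<ge> 0" unfolding H_def using pos by (intro integral_nonneg cgr) auto
  have "H * (1/3) \<le> H * (pi/2 - pi/3)" using H0 pi_ge_two by (intro mult_left_mono) auto
  also have "\<dots> = integral (?I \<times> ?J) ?g" using r(2) rect_Fubini_swap[OF cg] by (simp add: H_def)
  finally have H: "H \<le> 9 * (\<bar>\<alpha>\<bar> * \<eta> * sqrt (\<eta> * energy) + b * sqrt energy)" using tot by linarith
  have "sin (pi/6) \<le> sin r" using r(1) by (intro sin_monotone_2pi_le) auto
  then have sr: "sin r \<ge> \<eta>" using pos by (simp add: sin_30)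
  have "((\<lambda>x. \<eta> * (?B (x, r) * Tx (x, r)) + tube_bump (x, r) * (cos x * sin r * T (x, r))) has_integral
      (\<eta> * ?B (pi/2, r) * T (pi/2, r) - \<eta> * ?B (- (pi/2), r) * T (- (pi/2), r))) ?I"
  proof (rule fundamental_theorem_of_calculus)
    fix x assume x: "x \<in> ?I"
    have "((\<lambda>s. Bump (sin s * sin r / \<eta>)) has_real_derivative
        bump (sin x * sin r / \<eta>) * (cos x * sin r / \<eta>)) (at x within ?I)"
      by (rule DERIV_chain2[OF DERIV_Bump]) (use pos in \<open>auto intro!: derivative_eq_intros\<close>)
    from DERIV_mult[OF DERIV_cmult[OF this, of \<eta>] Tx[OF x, of r]] r'
    have "((\<lambda>x. \<eta> * ?B (x, r) * T (x, r)) has_real_derivative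
      \<eta> * (bump (sin x * sin r / \<eta>) * (cos x * sin r / \<eta>)) * T (x, r) + Tx (x, r) * (\<eta> * ?B (x, r))) (at x within ?I)"
      by (simp add: tube_def)
    moreover have "\<eta> * (bump (sin x * sin r / \<eta>) * (cos x * sin r / \<eta>)) * T (x, r) + Tx (x, r) * (\<eta> * ?B (x, r))
      = \<eta> * (?B (x, r) * Tx (x, r)) + tube_bump (x, r) * (cos x * sin r * T (x, r))"
      using pos by (simp add: tube_bump_def tube_def field_simps)
    ultimately show "((\<lambda>x. \<eta> * ?B (x, r) * T (x, r)) has_vector_derivative
      \<eta> * (?B (x, r) * Tx (x, r)) + tube_bump (x, r) * (cos x * sin r * T (x, r))) (at x within ?I)"
      unfolding has_real_derivative_iff_has_vector_derivative by (simp only:)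
  qed simp
  moreover have "?B (pi/2, r) = 0" "?B (- (pi/2), r) = 0"
    using sr pos by (auto simp: tube_def intro!: bump_simps)
  ultimately have parts: "((\<lambda>x. \<eta> * (?B (x, r) * Tx (x, r)) + tube_bump (x, r) * (cos x * sin r * T (x, r))) has_integral 0) ?I"
    by simp
  have cr: "continuous_on ?I (\<lambda>x. u (x, r))" if "continuous_on corner_rect u" for u :: "real \<times> real \<Rightarrow> real"
    by (rule continuous_on_slice(2)[OF c[OF that] r(1)])
  have ctop: "(\<lambda>x. tube_bump (x, r) * (- \<alpha> * (cos x * sin r * T (x, r)) - b * Ty (x, r))) integrable_on ?I"
    by (intro integrable_continuous_real continuous_intros cr cont)
  \<comment> \<open>Adding \<alpha> times the vanishing integral \<open>parts\<close> cancels every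
    term with T and leaves only gradients.\<close>
  have "top_flux (- (pi/2)) (pi/2) r = integral ?I (\<lambda>x. tube_bump (x, r) * (- \<alpha> * (cos x * sin r * T (x, r)) - b * Ty (x, r))
      + \<alpha> * (\<eta> * (?B (x, r) * Tx (x, r)) + tube_bump (x, r) * (cos x * sin r * T (x, r))))"
    using has_integral_add[OF integrable_integral[OF ctop] has_integral_mult_right[OF parts, of \<alpha>]]
    by (simp add: top_flux_def integral_unique)
  also have "\<dots> = integral ?I (\<lambda>x. \<alpha> * \<eta> * (?B (x, r) * Tx (x, r)) - b * (tube_bump (x, r) * Ty (x, r)))"
    by (rule integral_cong) (simp add: algebra_simps)
  also have "\<bar>\<dots>\<bar> \<le> H" unfolding H_def
  proof (rule abs_integral_le[OF _ cgr])
    show "(\<lambda>x. \<alpha> * \<eta> * (?B (x, r) * Tx (x, r)) - b * (tube_bump (x, r) * Ty (x, r))) integrable_on ?I"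
      by (intro integrable_continuous_real continuous_intros cr cont)
    show "\<bar>\<alpha> * \<eta> * (?B (x, r) * Tx (x, r)) - b * (tube_bump (x, r) * Ty (x, r))\<bar> \<le> ?g (x, r)" for x
      using abs_triangle_ineq4[of "\<alpha> * \<eta> * (?B (x, r) * Tx (x, r))" "b * (tube_bump (x, r) * Ty (x, r))"] pos
      by (simp add: abs_mult)
  qed
  finally show ?thesis using H r(1) by (intro bexI[of _ r]) auto
qed

text \<open>By \<open>scale\<close> the normalising factor 6 / (\<eta> |\<alpha>|) equals 96 \<eta>
  / b.\<close>

lemma tube_mean_diff:
  assumes "\<bar>flux s2 (pi/2) - flux s1 (pi/2)\<bar> \<le> B"
  shows "\<bar>tube_mean s2 - tube_mean s1\<bar> \<le> 96 * \<eta> * (B / b)"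
proof -
  have \<alpha>: "\<bar>\<alpha>\<bar> = b / (16 * \<eta>\<^sup>2)" using scale pos by (simp add: field_simps)
  have "tube_mean s2 - tube_mean s1 = 6 / (\<eta> * \<alpha>) * (flux s2 (pi/2) - flux s1 (pi/2))"
    unfolding tube_mean_def by (simp only: right_diff_distrib)
  moreover have "\<bar>6 / (\<eta> * \<alpha>)\<bar> = 6 / (\<eta> * \<bar>\<alpha>\<bar>)" using pos by (simp add: abs_mult)
  ultimately have "\<bar>tube_mean s2 - tube_mean s1\<bar> = 6 / (\<eta> * \<bar>\<alpha>\<bar>) * \<bar>flux s2 (pi/2) - flux s1 (pi/2)\<bar>"
    by (simp only: abs_mult)
  also have "\<dots> \<le> 6 / (\<eta> * \<bar>\<alpha>\<bar>) * B"
    using assms pos by (intro mult_left_mono) auto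
  also have "\<dots> = 96 * \<eta> * (B / b)" using pos by (simp add: \<alpha> power2_eq_square field_simps)
  finally show ?thesis .
qed

lemma sqrt_energy_simps:
  "\<eta> * sqrt (energy / \<eta>) = sqrt (\<eta> * energy)" "\<eta> * sqrt energy \<le> sqrt (\<eta> * energy) / 2"
proof -
  have e: "\<eta> = sqrt \<eta> * sqrt \<eta>" "sqrt \<eta> \<noteq> 0" using pos by auto
  have cancel: "r * r * (u / r) = r * u" if "r \<noteq> 0" for r u :: real using that by simp
  have "\<eta> * sqrt (energy / \<eta>) = sqrt \<eta> * sqrt \<eta> * (sqrt energy / sqrt \<eta>)"
    using e by (simp add: real_sqrt_divide)
  also have "\<dots> = sqrt (\<eta> * energy)" unfolding cancel[OF e(2)] by (simp add: real_sqrt_mult)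
  finally show "\<eta> * sqrt (energy / \<eta>) = sqrt (\<eta> * energy)" .
  have "sqrt \<eta> \<le> sqrt (1/4)" using pos by (intro real_sqrt_le_mono) auto
  then have "sqrt \<eta> \<le> 1 / 2" by (simp add: real_sqrt_divide)
  then have "sqrt \<eta> * (sqrt \<eta> * sqrt energy) \<le> 1 / 2 * (sqrt \<eta> * sqrt energy)"
    using energy_nonneg pos by (intro mult_right_mono) auto
  then show "\<eta> * sqrt energy \<le> sqrt (\<eta> * energy) / 2"
    using e by (simp add: real_sqrt_mult mult.assoc[symmetric])
qed

text \<open>The bound on the cut holds at a special height r, whereas the means refer to height
  pi/2. On x = pi/2 and x = -pi/2 the tube ends below r, so both heights give the same flux.\<close>

lemma tube_mean_corner:
  "\<bar>tube_mean (pi/2) - tube_mean (- (pi/2))\<bar> \<le> 1300 * (\<eta> * energy + sqrt (\<eta> * energy))"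
proof -
  obtain r where r: "r \<in> {pi/3..pi/2}" and
    top: "\<bar>top_flux (- (pi/2)) (pi/2) r\<bar> \<le> 9 * (\<bar>\<alpha>\<bar> * \<eta> * sqrt (\<eta> * energy) + b * sqrt energy)"
    using top_flux_bound by blast
  have r': "0 \<le> r" "r \<le> pi/2" using r pi_gt_zero by auto
  have ends: "flux s (pi/2) = flux s r" if s: "\<bar>sin s\<bar> = 1" and sI: "s \<in> {- (pi/2)..pi/2}" for s
  proof -
    let ?k = "\<lambda>y. tube_bump (s, y) * (\<alpha> * (sin s * cos y * T (s, y)) - b * Tx (s, y))"
    have ck: "continuous_on {0..pi/2} ?k"
      by (intro continuous_intros continuous_on_slice(1)[OF cont(1) sI]
        continuous_on_slice(1)[OF cont(2) sI] continuous_on_slice(1)[OF tube_bump_continuous(1) sI])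
    have "integral {r..pi/2} ?k = integral {r..pi/2} (\<lambda>y. 0)"
    proof (rule integral_cong)
      fix y assume y: "y \<in> {r..pi/2}"
      have "sin (pi/6) \<le> sin y" using y r by (intro sin_monotone_2pi_le) auto
      then have "sin y \<ge> \<eta>" using pos by (simp add: sin_30)
      then have "tube_bump (s, y) = 0"
        using s pos by (auto simp: tube_bump_def tube_def abs_mult intro!: bump_simps)
      then show "?k y = 0" by simp
    qed
    then have "integral {r..pi/2} ?k = 0" by simp
    moreover have "integral {0..r} ?k + integral {r..pi/2} ?k = integral {0..pi/2} ?k"
      using r' by (intro Henstock_Kurzweil_Integration.integral_combine integrable_continuous_real ck) auto
    ultimately show ?thesis by (simp add: flux_def)
  qed
  let ?B = "b * (energy + 8 * sqrt (energy / \<eta>)) + 9 * (\<bar>\<alpha>\<bar> * \<eta> * sqrt (\<eta> * energy) + b * sqrt energy)"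
  have "\<bar>flux (pi/2) r - flux (- (pi/2)) r\<bar> \<le> ?B"
    using interior_flux_bound[of "- (pi/2)" "pi/2" r] top r' pi_gt_zero by auto
  then have "\<bar>flux (pi/2) (pi/2) - flux (- (pi/2)) (pi/2)\<bar> \<le> ?B" by (simp add: ends)
  from tube_mean_diff[OF this]
  have "\<bar>tube_mean (pi/2) - tube_mean (- (pi/2))\<bar> \<le> 96 * \<eta> * (?B / b)" .
  also have "96 * \<eta> * (?B / b) = 96 * (\<eta> * energy) + 768 * (\<eta> * sqrt (energy / \<eta>))
      + 864 * (\<eta>\<^sup>2 * \<bar>\<alpha>\<bar> / b) * sqrt (\<eta> * energy) + 864 * (\<eta> * sqrt energy)"
    using pos by (simp add: field_simps power2_eq_square)
  also have "\<eta>\<^sup>2 * \<bar>\<alpha>\<bar> / b = 1 / 16" using scale pos by (simp add: field_simps)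
  finally have "\<bar>tube_mean (pi/2) - tube_mean (- (pi/2))\<bar> \<le> 96 * (\<eta> * energy) + 768 * sqrt (\<eta> * energy)
      + 54 * sqrt (\<eta> * energy) + 864 * (\<eta> * sqrt energy)" by (simp add: sqrt_energy_simps(1))
  moreover have "\<eta> * energy \<ge> 0" "sqrt (\<eta> * energy) \<ge> 0" using energy_nonneg pos by auto
  \<comment> \<open>768 = 96 * 8, 54 = 864 / 16, and 864 m \<le> 432 s; the sum 1254 is rounded up
    to 1300.\<close>
  moreover have "M \<le> 1300 * (A + s)"
    if "M \<le> 96 * A + 768 * s + 54 * s + 864 * m" "A \<ge> 0" "s \<ge> 0" "m \<le> s / 2" for M A s m :: real
    using that by (simp add: algebra_simps)
  ultimately show ?thesis using sqrt_energy_simps(2) by blast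
qed

text \<open>Left of -pi/6 one has |sin s| \<ge> 1/2 \<ge> \<eta>, so the tube stays below y = pi/2
  and nothing leaves through the top.\<close>

lemma tube_mean_left:
  assumes "x \<in> {- (pi/2)..- (pi/6)}"
  shows "\<bar>tube_mean x - tube_mean (- (pi/2))\<bar> \<le> 96 * (\<eta> * energy) + 768 * sqrt (\<eta> * energy)"
proof -
  have "top_flux (- (pi/2)) x (pi/2) = integral {- (pi/2)..x} (\<lambda>x. 0)"
    unfolding top_flux_def
  proof (rule integral_cong)
    fix s assume s: "s \<in> {- (pi/2)..x}"
    have "sin s \<le> sin (- (pi/6))" using s assms by (intro sin_monotone_2pi_le) auto
    then have "sin s \<le> - \<eta>" using pos by (simp add: sin_30)
    then have "tube_bump (s, pi/2) = 0"
      using pos by (auto simp: tube_bump_def tube_def abs_if field_simps intro!: bump_simps)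
    then show "tube_bump (s, pi/2) * (- \<alpha> * (cos s * sin (pi/2) * T (s, pi/2)) - b * Ty (s, pi/2)) = 0"
      by simp
  qed
  then have "\<bar>flux x (pi/2) - flux (- (pi/2)) (pi/2)\<bar> \<le> b * (energy + 8 * sqrt (energy / \<eta>))"
    using interior_flux_bound[of "- (pi/2)" x "pi/2"] assms pi_gt_zero by auto
  note diff = tube_mean_diff[OF this]
  have "\<bar>tube_mean x - tube_mean (- (pi/2))\<bar> \<le> 96 * (\<eta> * energy) + 768 * (\<eta> * sqrt (energy / \<eta>))"
  proof -
    have "b * (energy + 8 * sqrt (energy / \<eta>)) / b = energy + 8 * sqrt (energy / \<eta>)" using pos by simp
    moreover have "96 * \<eta> * (energy + 8 * sqrt (energy / \<eta>)) = 96 * (\<eta> * energy) + 768 * (\<eta> * sqrt (energy / \<eta>))"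
      by (simp add: distrib_left)
    ultimately show ?thesis using diff by simp
  qed
  then show ?thesis by (simp only: sqrt_energy_simps(1))
qed

text \<open>The weight W is a probability density on the column and vanishes above height 4 \<eta>
  \<le> d. So the mean differs from T at any height up to d by at most the oscillation of T on
  {0..d} and the diffusive correction.\<close>

lemma tube_mean_column:
  assumes x: "x \<in> {- (pi/2)..- (pi/6)}" and d: "4 * \<eta> \<le> d" "d \<le> 1" and y0: "y0 \<in> {0..d}"
  defines "e \<equiv> integral {0..pi/2} (\<lambda>y. energy_density (x, y))"
  shows "\<bar>tube_mean x - T (x, y0)\<bar> \<le> 37 * sqrt (d * e)"
proof -
  have xI: "x \<in> {- (pi/2)..pi/2}" using x pi_gt_zero by auto
  have d0: "d > 0" "d \<le> pi/2" using d pos pi_ge_two by auto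
  have sl: "continuous_on {0..pi/2} (\<lambda>y. u (x, y))" if "continuous_on corner_rect u" for u :: "real \<times> real \<Rightarrow> real"
    by (rule continuous_on_slice(1)[OF that xI])
  have sld: "continuous_on {0..d} (\<lambda>y. u (x, y))" if "continuous_on corner_rect u" for u :: "real \<times> real \<Rightarrow> real"
    by (rule continuous_on_subset[OF sl[OF that]]) (use d0 in auto)
  have e0: "e \<ge> 0" unfolding e_def
    by (intro integral_nonneg integrable_continuous_real sl energy_density_continuous)
      (use energy_density_bounds(4) xI in auto)
  define \<rho> where "\<rho> = - sin x"
  have "sin x \<le> sin (- (pi/6))" using x by (intro sin_monotone_2pi_le) auto
  then have \<rho>: "\<rho> \<ge> 1 / 2" by (simp add: \<rho>_def sin_30)
  define W where "W = (\<lambda>y. 6 / \<eta> * (bump (\<rho> * sin y / \<eta>) * (\<rho> * cos y)))"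
  have cW: "continuous_on A W" for A using pos unfolding W_def by (intro continuous_intros) auto
  have W1: "(W has_integral 1) {0..pi/2}"
  proof -
    have "(W has_integral (6 * Bump (\<rho> * sin (pi/2) / \<eta>) - 6 * Bump (\<rho> * sin 0 / \<eta>))) {0..pi/2}"
    proof (rule fundamental_theorem_of_calculus)
      fix y
      have "((\<lambda>y. Bump (\<rho> * sin y / \<eta>)) has_real_derivative
          bump (\<rho> * sin y / \<eta>) * (\<rho> * cos y / \<eta>)) (at y within {0..pi/2})"
        by (rule DERIV_chain2[OF DERIV_Bump]) (use pos in \<open>auto intro!: derivative_eq_intros\<close>)
      from DERIV_cmult[OF this, of 6]
      show "((\<lambda>y. 6 * Bump (\<rho> * sin y / \<eta>)) has_vector_derivative W y) (at y within {0..pi/2})"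
        by (simp add: W_def has_real_derivative_iff_has_vector_derivative)
    qed simp
    moreover have "Bump (\<rho> * sin (pi/2) / \<eta>) = 0" using \<rho> pos by (intro bump_simps) (auto simp: field_simps)
    ultimately show ?thesis by (simp add: bump_simps)
  qed
  have W0: "W y \<ge> 0" if "y \<in> {0..pi/2}" for y
    unfolding W_def using that \<rho> pos
    by (intro mult_nonneg_nonneg bump_nonneg divide_nonneg_nonneg) (auto intro!: sin_ge_zero cos_ge_zero)
  define osc where "osc = integral {0..d} (\<lambda>y. \<bar>Ty (x, y)\<bar>)"
  have osc: "\<bar>T (x, y) - T (x, z)\<bar> \<le> osc" if "y \<in> {0..d}" "z \<in> {0..d}" for y z
  proof -
    have *: "\<bar>T (x, v) - T (x, u)\<bar> \<le> osc" if uv: "u \<in> {0..d}" "v \<in> {0..d}" "u \<le> v" for u v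
    proof -
      have "((\<lambda>y. Ty (x, y)) has_integral (T (x, v) - T (x, u))) {u..v}"
      proof (rule fundamental_theorem_of_calculus[OF uv(3)])
        fix s assume "s \<in> {u..v}"
        then have "s \<in> {0..pi/2}" "{u..v} \<subseteq> {0..pi/2}" using uv d0 by auto
        from DERIV_subset[OF Ty[OF xI this(1)] this(2)]
        show "((\<lambda>y. T (x, y)) has_vector_derivative Ty (x, s)) (at s within {u..v})"
          by (simp add: has_real_derivative_iff_has_vector_derivative)
      qed
      then have "\<bar>T (x, v) - T (x, u)\<bar> = \<bar>integral {u..v} (\<lambda>y. Ty (x, y))\<bar>" by (simp add: integral_unique)
      also have "\<dots> \<le> integral {u..v} (\<lambda>y. \<bar>Ty (x, y)\<bar>)"
        using uv by (intro abs_integral_le integrable_continuous_real continuous_intros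
            continuous_on_subset[OF sld[OF cont(3)]]) auto
      also have "\<dots> \<le> osc" unfolding osc_def
        using uv by (intro integral_subset_le integrable_continuous_real continuous_intros
            continuous_on_subset[OF sld[OF cont(3)]]) auto
      finally show ?thesis .
    qed
    show ?thesis using *[of y z] *[of z y] that by (cases "y \<le> z") (auto simp: abs_minus_commute)
  qed
  have osc_le: "osc \<le> sqrt (d * e)"
  proof (rule real_le_rsqrt)
    have "osc\<^sup>2 \<le> (d - 0) * integral {0..d} (\<lambda>y. (Ty (x, y))\<^sup>2)"
      unfolding osc_def using d0 by (intro interval_Cauchy_Schwarz sld cont) auto
    also have "\<dots> \<le> d * integral {0..d} (\<lambda>y. energy_density (x, y))"
      using d0 energy_density_bounds(2)[OF xI]
      by (auto intro!: mult_left_mono integral_le integrable_continuous_real continuous_intros sld cont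
          energy_density_continuous)
    also have "\<dots> \<le> d * e" unfolding e_def
      using d0 energy_density_bounds(4)[OF xI]
      by (auto intro!: mult_left_mono integral_subset_le integrable_continuous_real sld sl
          energy_density_continuous)
    finally show "osc\<^sup>2 \<le> d * e" .
  qed
  define D where "D = integral {0..pi/2} (\<lambda>y. \<bar>Tx (x, y)\<bar>)"
  have D_le: "D \<le> sqrt (2 * e)"
  proof (rule real_le_rsqrt)
    have "D\<^sup>2 \<le> (pi/2 - 0) * integral {0..pi/2} (\<lambda>y. (Tx (x, y))\<^sup>2)"
      unfolding D_def by (intro interval_Cauchy_Schwarz sl cont) auto
    also have "\<dots> \<le> (pi/2 - 0) * e"
      unfolding e_def using energy_density_bounds(1)[OF xI]
      by (auto intro!: mult_left_mono integral_le integrable_continuous_real continuous_intros sl cont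
          energy_density_continuous)
    also have "\<dots> \<le> 2 * e" using pi_less_4 e0 by (intro mult_right_mono) auto
    finally show "D\<^sup>2 \<le> 2 * e" .
  qed
  let ?k = "6 * b / (\<eta> * \<alpha>)"
  have \<alpha>: "\<bar>\<alpha>\<bar> = b / (16 * \<eta>\<^sup>2)" "\<alpha> \<noteq> 0" using scale pos by (auto simp: field_simps)
  have k: "\<bar>?k\<bar> = 96 * \<eta>" using pos by (simp add: abs_mult \<alpha>(1) field_simps power2_eq_square)
  have iW: "(\<lambda>y. W y * (T (x, y) - T (x, y0))) integrable_on {0..pi/2}"
    by (intro integrable_continuous_real continuous_intros cW sl cont)
  have iX: "(\<lambda>y. tube_bump (x, y) * Tx (x, y)) integrable_on {0..pi/2}"
    by (intro integrable_continuous_real continuous_intros sl cont)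
  have "((\<lambda>y. W y * (T (x, y) - T (x, y0)) + T (x, y0) * W y - ?k * (tube_bump (x, y) * Tx (x, y))) has_integral
      integral {0..pi/2} (\<lambda>y. W y * (T (x, y) - T (x, y0))) + T (x, y0) * 1
      - ?k * integral {0..pi/2} (\<lambda>y. tube_bump (x, y) * Tx (x, y))) {0..pi/2}"
    by (intro has_integral_diff has_integral_add has_integral_mult_right W1 integrable_integral iW iX)
  moreover have "W y * (T (x, y) - T (x, y0)) + T (x, y0) * W y - ?k * (tube_bump (x, y) * Tx (x, y))
      = 6 / (\<eta> * \<alpha>) * (tube_bump (x, y) * (\<alpha> * (sin x * cos y * T (x, y)) - b * Tx (x, y)))" for y
  proof -
    have "tube_bump (x, y) = - bump (\<rho> * sin y / \<eta>)"
      using bump_simps(6)[of "sin x * sin y / \<eta>"] by (simp add: tube_bump_def tube_def \<rho>_def)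
    then have "W y = 6 / \<eta> * (tube_bump (x, y) * (sin x * cos y))" by (simp add: W_def \<rho>_def)
    then show ?thesis using \<alpha>(2) pos by (simp add: field_simps)
  qed
  ultimately have mean0: "((\<lambda>y. 6 / (\<eta> * \<alpha>) * (tube_bump (x, y) * (\<alpha> * (sin x * cos y * T (x, y)) - b * Tx (x, y)))) has_integral
      integral {0..pi/2} (\<lambda>y. W y * (T (x, y) - T (x, y0))) + T (x, y0) * 1
      - ?k * integral {0..pi/2} (\<lambda>y. tube_bump (x, y) * Tx (x, y))) {0..pi/2}"
    by (simp only:)
  have mean: "tube_mean x - T (x, y0) = integral {0..pi/2} (\<lambda>y. W y * (T (x, y) - T (x, y0)))
      - ?k * integral {0..pi/2} (\<lambda>y. tube_bump (x, y) * Tx (x, y))"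
    using integral_unique[OF mean0] unfolding tube_mean_def flux_def integral_mult_right by simp
  have "\<bar>integral {0..pi/2} (\<lambda>y. W y * (T (x, y) - T (x, y0)))\<bar> \<le> integral {0..pi/2} (\<lambda>y. osc * W y)"
  proof (rule abs_integral_le[OF iW])
    show "(\<lambda>y. osc * W y) integrable_on {0..pi/2}" by (intro integrable_continuous_real continuous_intros cW)
    fix y assume y: "y \<in> {0..pi/2}"
    show "\<bar>W y * (T (x, y) - T (x, y0))\<bar> \<le> osc * W y"
    proof (cases "y \<le> d")
      case True
      have "\<bar>T (x, y) - T (x, y0)\<bar> \<le> osc" using True y y0 by (intro osc) auto
      from mult_left_mono[OF this W0[OF y]] show ?thesis
        using W0[OF y] by (simp add: abs_mult mult.commute)
    next
      case False
      \<comment> \<open>The origin of 4 \<eta>: with \<rho> \<ge> 1/2 and sin y \<ge> y/2 the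
        argument of \<open>bump\<close> reaches 1 at height 4 \<eta> at the latest.\<close>
      have "\<eta> \<le> 1 / 2 * (y / 2)" using False d by linarith
      also have "\<dots> \<le> \<rho> * sin y" using sin_ge_half[of y] y \<rho> by (intro mult_mono) auto
      finally have "W y = 0" using pos by (simp add: W_def bump_simps)
      then show ?thesis by simp
    qed
  qed
  also have "\<dots> = osc" using W1 by (simp add: integral_unique)
  finally have 1: "\<bar>integral {0..pi/2} (\<lambda>y. W y * (T (x, y) - T (x, y0)))\<bar> \<le> sqrt (d * e)"
    using osc_le by simp
  have "\<bar>integral {0..pi/2} (\<lambda>y. tube_bump (x, y) * Tx (x, y))\<bar> \<le> D"
    unfolding D_def
  proof (rule abs_integral_le[OF iX])
    show "(\<lambda>y. \<bar>Tx (x, y)\<bar>) integrable_on {0..pi/2}"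
      by (intro integrable_continuous_real continuous_intros sl cont)
    show "\<bar>tube_bump (x, y) * Tx (x, y)\<bar> \<le> \<bar>Tx (x, y)\<bar>" for y
      using bump_bounds(1) by (simp add: abs_mult tube_bump_def mult_left_le_one_le)
  qed
  then have "\<bar>?k * integral {0..pi/2} (\<lambda>y. tube_bump (x, y) * Tx (x, y))\<bar> \<le> 96 * \<eta> * sqrt (2 * e)"
    unfolding abs_mult k using D_le pos by (intro mult_mono) auto
  also have "\<dots> \<le> 36 * sqrt (d * e)"
  proof -
    \<comment> \<open>96 \<eta> \<le> 24 d and d \<le> 1 give 2 * 24^2 = 1152 \<le> 36^2; together
      with the oscillation this makes 37.\<close>
    have "(96 * \<eta>)\<^sup>2 * (2 * e) \<le> (24 * d)\<^sup>2 * (2 * e)"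
      using d pos e0 by (intro mult_right_mono power_mono) auto
    also have "\<dots> = 1152 * (d * (d * e))" by (simp add: power2_eq_square)
    also have "\<dots> \<le> 1152 * (1 * (d * e))" using d d0 e0 by (intro mult_left_mono mult_right_mono) auto
    also have "\<dots> \<le> 36\<^sup>2 * (d * e)" using mult_nonneg_nonneg[of d e] d0 e0 by simp
    finally have "sqrt ((96 * \<eta>)\<^sup>2 * (2 * e)) \<le> sqrt (36\<^sup>2 * (d * e))" by (rule real_sqrt_le_mono)
    moreover have sq: "sqrt (u\<^sup>2 * v) = u * sqrt v" if "u \<ge> 0" for u v :: real
      using that by (simp add: real_sqrt_mult)
    have "sqrt ((96 * \<eta>)\<^sup>2 * (2 * e)) = 96 * \<eta> * sqrt (2 * e)" by (rule sq) (use pos in auto)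
    moreover have "sqrt (36\<^sup>2 * (d * e)) = 36 * sqrt (d * e)" by (rule sq) auto
    ultimately show ?thesis by (simp only:)
  qed
  finally have 2: "\<bar>?k * integral {0..pi/2} (\<lambda>y. tube_bump (x, y) * Tx (x, y))\<bar> \<le> 36 * sqrt (d * e)" .
  show ?thesis unfolding mean
    by (rule order_trans[OF abs_triangle_ineq4 order_trans[OF add_mono[OF 1 2]]]) simp
qed

text \<open>The interval {-(pi/2)..-(pi/6)} is longer than 1, so a column of average energy has at
  most the whole energy. From 4 \<eta> \<le> d come 24 = 96 / 4 and 384 = 768 / 2; then 421 = 384 +
  37.\<close>

lemma good_column:
  assumes d: "4 * \<eta> \<le> d" "d \<le> 1"
  shows "\<exists>x\<in>{- (pi/2)..- (pi/6)}. integral {0..pi/2} (\<lambda>y. energy_density (x, y)) \<le> energy \<and>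
    (\<forall>y\<in>{0..d}. \<bar>tube_mean (- (pi/2)) - T (x, y)\<bar> \<le> 24 * (d * energy) + 421 * sqrt (d * energy))"
proof -
  let ?I = "{- (pi/2)..- (pi/6)}"
  define e where "e = (\<lambda>x. integral {0..pi/2} (\<lambda>y. energy_density (x, y)))"
  have "- (pi/6) \<le> pi/2" using pi_gt_zero by linarith
  then have sub: "?I \<subseteq> {- (pi/2)..pi/2}" "{0..pi/2} \<subseteq> {0..pi/2}" by auto
  have ce: "continuous_on (?I \<times> {0..pi/2}) energy_density"
    by (rule continuous_on_subset[OF energy_density_continuous]) (intro Sigma_mono sub)
  obtain x where x: "x \<in> ?I" "integral ?I e = e x * (- (pi/6) - - (pi/2))"
    using integral_mean_value[of "- (pi/2)" "- (pi/6)" e] continuous_on_slice_integral[OF ce] pi_gt_zero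
    by (auto simp: e_def)
  have ex0: "e x \<ge> 0" unfolding e_def
    by (intro integral_nonneg integrable_continuous_real continuous_on_slice(1)[OF ce x(1)])
      (use subsetD[OF sub(1) x(1)] energy_density_bounds(4) in auto)
  have "e x * 1 \<le> e x * (- (pi/6) - - (pi/2))" using ex0 pi_gt3 by (intro mult_left_mono) auto
  also have "\<dots> = integral (?I \<times> {0..pi/2}) energy_density"
    using x(2) rect_Fubini[OF ce] by (simp add: e_def)
  also have "\<dots> \<le> energy" by (rule subrect_energy[OF sub])
  finally have ex: "e x \<le> energy" by simp
  have "\<bar>tube_mean (- (pi/2)) - T (x, y)\<bar> \<le> 24 * (d * energy) + 421 * sqrt (d * energy)" if y: "y \<in> {0..d}" for y
  proof -
    have 1: "\<bar>tube_mean x - T (x, y)\<bar> \<le> 37 * sqrt (d * e x)"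
      using tube_mean_column[OF x(1) d y] by (simp add: e_def)
    have 2: "sqrt (d * e x) \<le> sqrt (d * energy)"
      using ex d pos by (intro real_sqrt_le_mono mult_left_mono) auto
    have "4 * (\<eta> * energy) \<le> d * energy" using mult_right_mono[OF d(1) energy_nonneg] by simp
    moreover from this have "sqrt (4 * (\<eta> * energy)) \<le> sqrt (d * energy)" by (rule real_sqrt_le_mono)
    ultimately have "96 * (\<eta> * energy) + 768 * sqrt (\<eta> * energy) \<le> 24 * (d * energy) + 384 * sqrt (d * energy)"
      by (simp add: real_sqrt_mult)
    then show ?thesis using tube_mean_left[OF x(1)] 1 2 by linarith
  qed
  then show ?thesis using x(1) ex by (auto simp: e_def)
qed

end

section \<open>Propagation from cell to cell\<close>

text \<open>q is the first point at or below \<alpha>, and p the last one before it at or above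
  \<beta>; between them h stays within both levels.\<close>

lemma crossing_interval:
  fixes h :: "real \<Rightarrow> real"
  assumes cont: "continuous_on {u..v} h" and "u \<le> v" "h u \<ge> \<beta>" "h v \<le> \<alpha>" "\<alpha> < \<beta>"
  shows "\<exists>p q. u \<le> p \<and> p < q \<and> q \<le> v \<and> h p = \<beta> \<and> h q = \<alpha> \<and> (\<forall>x\<in>{p..q}. \<alpha> \<le> h x \<and> h x \<le> \<beta>)"
proof -
  have "closed ({u..v} \<inter> h -` {..\<alpha>})"
    by (rule continuous_closed_preimage[OF cont]) auto
  moreover have "v \<in> {u..v} \<inter> h -` {..\<alpha>}" using assms by auto
  ultimately have "\<exists>q\<in>{u..v} \<inter> h -` {..\<alpha>}. \<forall>x\<in>{u..v} \<inter> h -` {..\<alpha>}. q \<le> x"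
    by (intro compact_attains_inf bounded_closed_imp_seq_compact)
      (auto simp: compact_eq_bounded_closed intro: bounded_subset[of "{u..v}"])
  then obtain q where q: "u \<le> q" "q \<le> v" "h q \<le> \<alpha>" and
    qmin: "\<And>x. u \<le> x \<Longrightarrow> x \<le> v \<Longrightarrow> h x \<le> \<alpha> \<Longrightarrow> q \<le> x" by auto
  have cq: "continuous_on {u..q} h" using cont by (rule continuous_on_subset) (use q in auto)
  have "closed ({u..q} \<inter> h -` {\<beta>..})"
    by (rule continuous_closed_preimage[OF cq]) auto
  moreover have "u \<in> {u..q} \<inter> h -` {\<beta>..}" using assms q by auto
  ultimately have "\<exists>p\<in>{u..q} \<inter> h -` {\<beta>..}. \<forall>x\<in>{u..q} \<inter> h -` {\<beta>..}. x \<le> p"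
    by (intro compact_attains_sup)
      (auto simp: compact_eq_bounded_closed intro: bounded_subset[of "{u..q}"])
  then obtain p where p: "u \<le> p" "p \<le> q" "h p \<ge> \<beta>" and
    pmax: "\<And>x. u \<le> x \<Longrightarrow> x \<le> q \<Longrightarrow> h x \<ge> \<beta> \<Longrightarrow> x \<le> p" by auto
  have pq: "p < q" using p(2,3) q(3) assms(5) by (cases "p = q") auto
  have cpq: "continuous_on {p..q} h" using cq by (rule continuous_on_subset) (use p in auto)
  obtain x where x: "p \<le> x" "x \<le> q" "h x = \<beta>"
    using IVT2'[of h q \<beta> p] p q assms(5) cpq by auto
  have hp: "h p = \<beta>" using pmax[of x] x p by auto
  obtain x' where x': "p \<le> x'" "x' \<le> q" "h x' = \<alpha>"
    using IVT2'[of h q \<alpha> p] p q assms(5) cpq by auto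
  have hq: "h q = \<alpha>" using qmin[of x'] x' p q by auto
  have "\<alpha> \<le> h x \<and> h x \<le> \<beta>" if "x \<in> {p..q}" for x
    using that pmax[of x] qmin[of x] p q hp hq by (smt (verit) atLeastAtMost_iff)
  then show ?thesis using p(1) pq q(2) hp hq by blast
qed

lemma sum_sqrt_le:
  fixes e :: "nat \<Rightarrow> real"
  assumes "\<And>j. j \<in> A \<Longrightarrow> e j \<ge> 0" "finite A"
  shows "(\<Sum>j\<in>A. sqrt (e j)) \<le> sqrt (card A * (\<Sum>j\<in>A. e j))"
proof (rule real_le_rsqrt)
  have "(\<Sum>j\<in>A. 1 * sqrt (e j))\<^sup>2 \<le> (\<Sum>j\<in>A. 1\<^sup>2) * (\<Sum>j\<in>A. (sqrt (e j))\<^sup>2)"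
    by (rule Cauchy_Schwarz_ineq_sum)
  also have "(\<Sum>j\<in>A. (sqrt (e j))\<^sup>2) = (\<Sum>j\<in>A. e j)"
    by (rule sum.cong) (use assms in auto)
  finally show "(\<Sum>j\<in>A. sqrt (e j))\<^sup>2 \<le> card A * (\<Sum>j\<in>A. e j)" by simp
qed

text \<open>In a sequence of cells leading from hot to cold, either few cells are at an intermediate
  level, so that one jump between neighbours is large, or many are, and all of these burn.\<close>

lemma discrete_front:
  fixes m e :: "nat \<Rightarrow> real"
  assumes ends: "m 0 > \<beta>" "m N < \<alpha>" "\<alpha> < \<beta>"
    and e: "\<And>j. e j \<ge> 0" "(\<Sum>j<N. e j) \<le> E"
    and jump: "\<And>j. j < N \<Longrightarrow> \<bar>m (Suc j) - m j\<bar> \<le> 1300 * (\<eta> * e j + sqrt (\<eta> * e j))"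
    and burn: "\<And>j. j < N \<Longrightarrow> \<alpha> \<le> m j \<Longrightarrow> m j \<le> \<beta> \<Longrightarrow> e j \<ge> \<kappa>"
    and pos: "\<eta> > 0" "\<kappa> > 0" and small: "\<eta> * E \<le> 1"
  shows "\<exists>n\<ge>1. real (n - 1) * \<kappa> \<le> E \<and> (\<beta> - \<alpha>)\<^sup>2 \<le> 2600\<^sup>2 * (real n * (\<eta> * E))"
proof -
  define q where "q = (LEAST j. m j < \<alpha>)"
  have q: "m q < \<alpha>" "q \<le> N" unfolding q_def using ends by (auto intro: LeastI Least_le)
  have below_q: "m j \<ge> \<alpha>" if "j < q" for j
    using not_less_Least[of j "\<lambda>j. m j < \<alpha>"] that by (auto simp: q_def)
  define S where "S = {j. j < q \<and> m j > \<beta>}"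
  have "q > 0" using q ends by (cases q) auto
  then have S: "finite S" "S \<noteq> {}" using ends by (auto simp: S_def)
  define p where "p = Max S"
  have p: "p < q" "m p > \<beta>" using Max_in[OF S] by (auto simp: p_def S_def)
  have mid: "m j \<le> \<beta>" if "p < j" "j < q" for j
  proof (rule ccontr)
    assume "\<not> m j \<le> \<beta>"
    then have "j \<in> S" using that by (simp add: S_def)
    then show False using Max_ge[OF S(1)] that(1) by (auto simp: p_def leD)
  qed
  \<comment> \<open>There are n jumps from p to q but only n - 1 cells strictly in between, and only
    these are known to burn; for n = 1 a single jump covers the whole gap.\<close>
  define n where "n = q - p"
  have n: "n \<ge> 1" "card {p..<q} = n" using p by (auto simp: n_def)
  have part: "(\<Sum>j\<in>A. e j) \<le> E" if "A \<subseteq> {..<N}" for A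
    using sum_mono2[of "{..<N}" A e] that e by auto
  have "real (n - 1) * \<kappa> = (\<Sum>j\<in>{p<..<q}. \<kappa>)" by (simp add: n_def)
  also have "\<dots> \<le> (\<Sum>j\<in>{p<..<q}. e j)"
    using below_q mid q by (intro sum_mono burn) auto
  also have "\<dots> \<le> E" using q by (intro part) auto
  finally have 1: "real (n - 1) * \<kappa> \<le> E" .
  \<comment> \<open>Here \<eta> E \<le> 1 enters: the linear part of a jump is absorbed by the
    square root, which turns 1300 into 2600.\<close>
  have le1: "\<eta> * e j \<le> sqrt (\<eta> * e j)" if "j < N" for j
  proof -
    have "e j \<le> E" using part[of "{j}"] that by auto
    then have "\<eta> * e j \<le> 1" using small pos by (smt (verit) mult_left_mono)
    moreover have "\<eta> * e j \<ge> 0" using pos e by simp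
    ultimately show ?thesis
      by (intro real_le_rsqrt) (simp add: power2_eq_square mult_left_le)
  qed
  have "m p - m q = (\<Sum>j\<in>{p..<q}. m j - m (Suc j))"
    using p by (subst sum_Suc_diff'[of p q "\<lambda>j. - m j", simplified]) auto
  also have "\<dots> \<le> (\<Sum>j\<in>{p..<q}. 2600 * sqrt (\<eta> * e j))"
  proof (rule sum_mono)
    fix j assume "j \<in> {p..<q}"
    then have "j < N" using q by auto
    then show "m j - m (Suc j) \<le> 2600 * sqrt (\<eta> * e j)" 
    proof -
      have "1300 * (\<eta> * e j + sqrt (\<eta> * e j)) \<le> 2600 * sqrt (\<eta> * e j)"
        using le1[OF \<open>j < N\<close>] by simp
      then show ?thesis using jump[OF \<open>j < N\<close>] by linarith
    qed
  qed
  also have "\<dots> = 2600 * (\<Sum>j\<in>{p..<q}. sqrt (\<eta> * e j))" by (simp add: sum_distrib_left)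
  also have "\<dots> \<le> 2600 * sqrt (real n * (\<Sum>j\<in>{p..<q}. \<eta> * e j))"
    using sum_sqrt_le[of "{p..<q}" "\<lambda>j. \<eta> * e j"] pos e n by (intro mult_left_mono) auto
  also have "\<dots> \<le> 2600 * sqrt (real n * (\<eta> * E))"
  proof -
    have "{p..<q} \<subseteq> {..<N}" using q by auto
    from mult_left_mono[OF part[OF this], of \<eta>] pos
    have "(\<Sum>j\<in>{p..<q}. \<eta> * e j) \<le> \<eta> * E" by (simp add: sum_distrib_left)
    then show ?thesis by (intro mult_left_mono real_sqrt_le_mono) auto
  qed
  finally have "\<beta> - \<alpha> \<le> 2600 * sqrt (real n * (\<eta> * E))" using p q by linarith
  moreover have "E \<ge> 0" using part[of "{}"] by simp
  ultimately have "(\<beta> - \<alpha>)\<^sup>2 \<le> (2600 * sqrt (real n * (\<eta> * E)))\<^sup>2"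
    using ends by (intro power_mono) auto
  also have "\<dots> = 2600\<^sup>2 * (real n * (\<eta> * E))"
    using \<open>E \<ge> 0\<close> pos by (simp add: power_mult_distrib)
  finally show ?thesis using n(1) 1 by blast
qed

section \<open>Fronts whose reaction exceeds \<phi> at intermediate levels\<close>

locale burning_front = cellular_profile +
  fixes \<phi> \<theta>1 \<theta>4 \<zeta> V :: real
  assumes front: "\<phi> > 0" "\<zeta> > 0" "\<theta>1 < \<theta>4" "{\<theta>1 - \<zeta> <..< \<theta>4 + \<zeta>} \<subseteq> {0..1}"
    and f_gt: "\<And>\<theta>. \<theta> \<in> {\<theta>1 - \<zeta> <..< \<theta>4 + \<zeta>} \<Longrightarrow> f \<theta> > \<phi>"
    and V: "\<And>x1 x2. integral ({x1..x2} \<times> {0..pi}) w \<le> V"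
begin

text \<open>Obtained by passing to the closure of the interval. It means that T is beyond \<theta>1
  and \<theta>4 once it is within \<zeta> of its limits at infinity.\<close>

lemma levels: "\<theta>1 \<ge> \<zeta>" "\<theta>4 \<le> 1 - \<zeta>"
proof -
  have "\<theta>1 - \<zeta> \<le> \<theta>4 + \<zeta>" "\<theta>1 - \<zeta> < \<theta>4 + \<zeta>" using front by auto
  then have "closure {\<theta>1 - \<zeta> <..< \<theta>4 + \<zeta>} = {\<theta>1 - \<zeta> .. \<theta>4 + \<zeta>}" by simp
  moreover have "closure {\<theta>1 - \<zeta> <..< \<theta>4 + \<zeta>} \<subseteq> {0..1}"
    using front(4) by (intro closure_minimal) auto
  ultimately show "\<theta>1 \<ge> \<zeta>" "\<theta>4 \<le> 1 - \<zeta>" using front by auto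
qed

text \<open>Completing the square along a crossing gives 2 sqrt(b c \<phi>)(\<theta>4 - \<theta>1)
  on each horizontal line. The factor 2 is spent on bounding dissipation and reaction by V
  separately.\<close>

lemma basic_bound: "V \<ge> pi * sqrt (b * c * \<phi>) * (\<theta>4 - \<theta>1)"
proof -
  define g where "g = (\<lambda>p. b * (Tx p)\<^sup>2 + c * f (T p))"
  have cg: "continuous_on (UNIV \<times> {0..pi}) g" unfolding g_def by (intro continuous_intros cont continuous_fT)
  have g0: "g (x, y) \<ge> 0" if "y \<in> {0..pi}" for x y
    using fT_nonneg[OF that, of x] pos by (simp add: g_def)
  obtain N1 N2 where N1: "\<And>x y. x \<ge> N1 \<Longrightarrow> y \<in> {0..pi} \<Longrightarrow> T (x, y) \<le> \<zeta>"
    and N2: "\<And>x y. x \<le> N2 \<Longrightarrow> y \<in> {0..pi} \<Longrightarrow> 1 - T (x, y) \<le> \<zeta>"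
    using T_limit_right[OF front(2)] T_limit_left[OF front(2)] by metis
  define R where "R = max N1 (max (- N2) 0)"
  have cR: "continuous_on ({-R..R} \<times> {0..pi}) g" by (intro continuous_on_rect cg) auto
  let ?s = "sqrt (b * c * \<phi>)"
  have line: "2 * ?s * (\<theta>4 - \<theta>1) \<le> integral {-R..R} (\<lambda>x. g (x, y))" if y: "y \<in> {0..pi}" for y
  proof -
    have cT: "continuous_on {-R..R} (\<lambda>x. T (x, y))"
      by (rule continuous_on_slice(2)[OF continuous_on_rect[OF cont(1)] y]) auto
    obtain p q where pq: "-R \<le> p" "p < q" "q \<le> R" "T (p, y) = \<theta>4" "T (q, y) = \<theta>1"
      "\<And>x. x \<in> {p..q} \<Longrightarrow> \<theta>1 \<le> T (x, y) \<and> T (x, y) \<le> \<theta>4"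
      using crossing_interval[OF cT, of \<theta>4 \<theta>1] N1[of R y] N2[of "-R" y] y levels front(3)
      by (force simp: R_def)
    have sl: "continuous_on {p..q} (\<lambda>x. g (x, y))"
      by (rule continuous_on_slice(2)[OF continuous_on_rect[OF cg] y]) auto
    have slR: "continuous_on {-R..R} (\<lambda>x. g (x, y))"
      by (rule continuous_on_slice(2)[OF continuous_on_rect[OF cg] y]) auto
    have hi: "((\<lambda>x. - 2 * ?s * Tx (x, y)) has_integral (- 2 * ?s * T (q, y) - (- 2 * ?s * T (p, y)))) {p..q}"
    proof (rule fundamental_theorem_of_calculus)
      fix x
      have "((\<lambda>x. - 2 * ?s * T (x, y)) has_real_derivative - 2 * ?s * Tx (x, y)) (at x within {p..q})"
        by (intro DERIV_cmult has_field_derivative_at_within[OF Tx[OF y]])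
      then show "((\<lambda>x. - 2 * ?s * T (x, y)) has_vector_derivative - 2 * ?s * Tx (x, y)) (at x within {p..q})"
        by (simp only: has_real_derivative_iff_has_vector_derivative)
    qed (use pq in auto)
    have "2 * ?s * (\<theta>4 - \<theta>1) = - 2 * ?s * T (q, y) - (- 2 * ?s * T (p, y))"
      using pq by (simp add: algebra_simps)
    also have "\<dots> = integral {p..q} (\<lambda>x. - 2 * ?s * Tx (x, y))"
      by (rule integral_unique[OF hi, symmetric])
    also have "integral {p..q} (\<lambda>x. - 2 * ?s * Tx (x, y)) \<le> integral {p..q} (\<lambda>x. g (x, y))"
    proof (rule integral_le[OF has_integral_integrable[OF hi] integrable_continuous_real[OF sl]])
      fix x assume "x \<in> {p..q}"
      then have "f (T (x, y)) \<ge> \<phi>" using pq(6) front(2) f_gt[of "T (x, y)"] by force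
      then have "c * \<phi> \<le> c * f (T (x, y))" using pos by simp
      moreover have "0 \<le> (sqrt b * Tx (x, y) + sqrt (c * \<phi>))\<^sup>2" by simp
      then have "0 \<le> b * (Tx (x, y))\<^sup>2 + 2 * (sqrt b * sqrt (c * \<phi>)) * Tx (x, y) + c * \<phi>"
        using pos front by (simp add: power2_sum power_mult_distrib algebra_simps)
      ultimately show "- 2 * ?s * Tx (x, y) \<le> g (x, y)"
        by (simp add: g_def real_sqrt_mult mult.assoc)
    qed
    also have "\<dots> \<le> integral {-R..R} (\<lambda>x. g (x, y))"
      using pq g0[OF y] by (intro integral_subset_le integrable_continuous_real sl slR) auto
    finally show ?thesis .
  qed
  have "pi * (2 * ?s * (\<theta>4 - \<theta>1)) = integral {0..pi} (\<lambda>y. 2 * ?s * (\<theta>4 - \<theta>1))" by simp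
  also have "\<dots> \<le> integral {0..pi} (\<lambda>y. integral {-R..R} (\<lambda>x. g (x, y)))"
    by (intro integral_le integrable_continuous_real continuous_on_slice_integral_swap cR line) auto
  also have "\<dots> = integral ({-R..R} \<times> {0..pi}) g" by (rule rect_Fubini_swap[OF cR, symmetric])
  also have "\<dots> \<le> integral ({-R..R} \<times> {0..pi}) (\<lambda>p. b * ((Tx p)\<^sup>2 + (Ty p)\<^sup>2) + c * f (T p))"
    using pos by (intro rect_mono cR continuous_on_rect continuous_intros cont continuous_fT) (auto simp: g_def)
  also have "\<dots> = integral ({-R..R} \<times> {0..pi}) (\<lambda>p. b * ((Tx p)\<^sup>2 + (Ty p)\<^sup>2))
      + integral ({-R..R} \<times> {0..pi}) (\<lambda>p. c * f (T p))"
    by (intro integral_add rect_integrable continuous_on_rect continuous_intros cont continuous_fT) auto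
  also have "\<dots> \<le> V + V"
    by (intro add_mono dissipation_le_burning_rate reaction_le_burning_rate V)
  finally show ?thesis by simp
qed

section \<open>Energies and tube means attached to the corners\<close>

definition "front_density p = (Tx p)\<^sup>2 + (Ty p)\<^sup>2 + (c * f (T p) + w p) / b"
text \<open>With z running through the multiples of pi, these windows are centred at the
  separatrices and tile the strip, so that their energies add up.\<close>

definition "cell_energy z = integral ({z - pi/2..z + pi/2} \<times> {0..pi}) front_density"
definition "\<eta> = sqrt (b / a) / 4"
text \<open>\<open>tube_mean\<close> for the profile shifted to z, with the signed speed a cos z; it
  is used for sin z = 0, where the shifted profile satisfies the assumptions of
  \<open>corner_flow\<close>.\<close>

definition "corner_mean z s =
  corner_flow.tube_mean (a * cos z) b \<eta> (\<lambda>p. T (z + fst p, snd p)) (\<lambda>p. Tx (z + fst p, snd p)) s"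
definition "corner_energy z =
  integral corner_rect (\<lambda>p. front_density (z + fst p, snd p))"

lemma front_density_continuous: "continuous_on (UNIV \<times> {0..pi}) front_density"
  using pos unfolding front_density_def[abs_def] by (intro continuous_intros cont continuous_fT) auto

lemma front_density_nonneg: "y \<in> {0..pi} \<Longrightarrow> front_density (x, y) \<ge> 0"
  using fT_nonneg[of y x] w_nonneg[of y x] pos by (simp add: front_density_def)

lemma total_energy: "integral ({x1..x2} \<times> {0..pi}) front_density \<le> 3 * V / b"
proof -
  let ?R = "{x1..x2} \<times> {0..pi}"
  have i: "(\<lambda>p. b * ((Tx p)\<^sup>2 + (Ty p)\<^sup>2)) integrable_on ?R" "(\<lambda>p. c * f (T p)) integrable_on ?R" "w integrable_on ?R"
    by (intro rect_integrable continuous_on_rect continuous_intros cont continuous_fT; simp)+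
  have "((\<lambda>p. 1 / b * (b * ((Tx p)\<^sup>2 + (Ty p)\<^sup>2) + c * f (T p) + w p)) has_integral
      1 / b * (integral ?R (\<lambda>p. b * ((Tx p)\<^sup>2 + (Ty p)\<^sup>2)) + integral ?R (\<lambda>p. c * f (T p)) + integral ?R w)) ?R"
    by (intro has_integral_mult_right has_integral_add integrable_integral i)
  moreover have "1 / b * (b * ((Tx p)\<^sup>2 + (Ty p)\<^sup>2) + c * f (T p) + w p) = front_density p" for p
    using pos by (simp add: front_density_def field_simps)
  ultimately have "integral ?R front_density =
      1 / b * (integral ?R (\<lambda>p. b * ((Tx p)\<^sup>2 + (Ty p)\<^sup>2)) + integral ?R (\<lambda>p. c * f (T p)) + integral ?R w)"
    by (simp add: integral_unique)
  also have "\<dots> \<le> 1 / b * (V + V + V)"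
    using pos dissipation_le_burning_rate[OF V] reaction_le_burning_rate[OF V] V
    by (intro mult_left_mono add_mono) auto
  finally show ?thesis by simp
qed

lemma sum_cell_energy:
  "(\<Sum>j<n. cell_energy (z + real j * pi)) \<le> 3 * V / b"
proof -
  have "(\<Sum>j<n. cell_energy (z + real j * pi)) = integral ({z - pi/2..z + real n * pi - pi/2} \<times> {0..pi}) front_density"
    if "n \<ge> 1" using that
  proof (induction n rule: nat_induct_at_least)
    case base
    show ?case by (simp add: cell_energy_def add.commute)
  next
    case (Suc n)
    have "integral ({z - pi/2..z + real (Suc n) * pi - pi/2} \<times> {0..pi}) front_density =
        integral ({z - pi/2..z + real n * pi - pi/2} \<times> {0..pi}) front_density
        + integral ({z + real n * pi - pi/2..z + real (Suc n) * pi - pi/2} \<times> {0..pi}) front_density"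
      using pi_gt_zero
      by (intro rect_combine continuous_on_rect front_density_continuous) (auto simp: algebra_simps)
    moreover have "{z + real n * pi - pi/2..z + real (Suc n) * pi - pi/2} =
        {(z + real n * pi) - pi/2..(z + real n * pi) + pi/2}"
      by (simp add: field_simps)
    ultimately show ?case using Suc.IH by (simp add: cell_energy_def add_ac)
  qed
  \<comment> \<open>For n = 0 the sum is empty, and the empty window from 1 to 0 provides 0 \<le> 3
    V / b.\<close>
  then show ?thesis using total_energy[of "z - pi/2"] total_energy[of 1 0]
    by (cases "n \<ge> 1") (auto simp: not_le)
qed

lemma cell_energy_nonneg: "cell_energy z \<ge> 0"
  unfolding cell_energy_def
  by (rule integral_nonneg) (auto intro!: rect_integrable continuous_on_rect front_density_continuous front_density_nonneg)

lemma shift_continuous: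
  fixes u :: "real \<times> real \<Rightarrow> real"
  assumes "continuous_on (UNIV \<times> {0..pi}) u"
  shows "continuous_on corner_rect (\<lambda>p. u (z + fst p, snd p))"
  by (rule continuous_on_compose2[OF assms]) (auto intro!: continuous_intros)

lemma corner_energy_le: "corner_energy z \<le> cell_energy z"
proof -
  have sub: "{0..pi/2} \<subseteq> {0..pi}" using pi_gt_zero by auto
  have c: "continuous_on ({z - pi/2..z + pi/2} \<times> {0..pi/2}) front_density"
    by (intro continuous_on_rect front_density_continuous sub)
  have "corner_energy z = integral {0..pi/2} (\<lambda>y. integral {- (pi/2)..pi/2} (\<lambda>x. front_density (z + x, y)))"
    unfolding corner_energy_def by (subst rect_Fubini_swap[OF shift_continuous[OF front_density_continuous]]) simp
  also have "\<dots> = integral {0..pi/2} (\<lambda>y. integral {z - pi/2..z + pi/2} (\<lambda>x. front_density (x, y)))"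
  proof (rule integral_cong)
    fix y assume y: "y \<in> {0..pi/2}"
    have "continuous_on {z - pi/2..z + pi/2} (\<lambda>x. front_density (x, y))" by (rule continuous_on_slice(2)[OF c y])
    then show "integral {- (pi/2)..pi/2} (\<lambda>x. front_density (z + x, y)) = integral {z - pi/2..z + pi/2} (\<lambda>x. front_density (x, y))"
      using integral_shift[of "- (pi/2)" z "pi/2" "\<lambda>x. front_density (x, y)"] by (simp add: o_def add.commute)
  qed
  also have "\<dots> = integral ({z - pi/2..z + pi/2} \<times> {0..pi/2}) front_density" by (rule rect_Fubini_swap[OF c, symmetric])
  also have "\<dots> \<le> cell_energy z" unfolding cell_energy_def
    by (rule rect_subset_le[OF continuous_on_rect[OF front_density_continuous]])
      (use sub front_density_nonneg in \<open>auto intro!: Sigma_mono\<close>)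
  finally show ?thesis .
qed

section \<open>The regime b \<le> c \<le> a of a fast flow\<close>

context
  assumes order: "b \<le> c" "c \<le> a"
begin

text \<open>4 \<eta> = sqrt (b / a), so c \<le> a makes the tube no higher than the reaction length
  sqrt (b / c), and b \<le> a gives \<eta> \<le> 1/4.\<close>

lemma \<eta>: "\<eta> > 0" "\<eta> \<le> 1/4" "16 * \<eta>\<^sup>2 * a = b" "4 * \<eta> \<le> sqrt (b / c)"
proof -
  have "sqrt (b / a) \<le> 1" using pos order by (simp add: real_sqrt_le_1_iff)
  then show "\<eta> > 0" "\<eta> \<le> 1/4" "16 * \<eta>\<^sup>2 * a = b" using pos by (auto simp: \<eta>_def power_divide)
  show "4 * \<eta> \<le> sqrt (b / c)" unfolding \<eta>_def
    using pos order by (simp add: divide_left_mono)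
qed

text \<open>Where sin z = 0, a shift by z multiplies both sin and cos by cos z, which is 1 or -1;
  this sign goes into \<alpha> = a cos z.\<close>

lemma corner:
  assumes z: "sin z = 0"
  shows "corner_flow (a * cos z) b \<eta> (\<lambda>p. c * f (T (z + fst p, snd p)))
    (\<lambda>p. T (z + fst p, snd p)) (\<lambda>p. Tx (z + fst p, snd p)) (\<lambda>p. Ty (z + fst p, snd p))
    (\<lambda>p. Txx (z + fst p, snd p)) (\<lambda>p. Tyy (z + fst p, snd p)) (\<lambda>p. w (z + fst p, snd p))"
proof
  have sub: "{0..pi/2} \<subseteq> {0..pi}" using pi_gt_zero by auto
  have cz: "\<bar>cos z\<bar> = 1" using sin_cos_squared_add[of z] z by (simp add: power2_eq_1_iff abs_if) auto
  show "b > 0" by (rule pos)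
  show "\<eta> > 0" "\<eta> \<le> 1/4" by (rule \<eta>)+
  show "16 * \<eta>\<^sup>2 * \<bar>a * cos z\<bar> = b" using \<eta>(3) cz pos by (simp add: abs_mult)
  show "continuous_on corner_rect (\<lambda>p. T (z + fst p, snd p))"
    "continuous_on corner_rect (\<lambda>p. Tx (z + fst p, snd p))"
    "continuous_on corner_rect (\<lambda>p. Ty (z + fst p, snd p))"
    "continuous_on corner_rect (\<lambda>p. Txx (z + fst p, snd p))"
    "continuous_on corner_rect (\<lambda>p. Tyy (z + fst p, snd p))"
    "continuous_on corner_rect (\<lambda>p. w (z + fst p, snd p))"
    by (intro shift_continuous cont)+
  show "continuous_on corner_rect (\<lambda>p. c * f (T (z + fst p, snd p)))"
    by (intro continuous_intros shift_continuous[OF continuous_fT])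
  fix x y :: real assume y: "y \<in> {0..pi/2}"
  have y': "y \<in> {0..pi}" using y sub by blast
  have "((\<lambda>s. T (z + s, y)) has_real_derivative Tx (z + x, y) * 1) (at x within {- (pi/2)..pi/2})"
    by (rule DERIV_chain2[where f = "\<lambda>s. T (s, y)"]) (auto intro!: derivative_eq_intros Tx y')
  then show "((\<lambda>s. T (z + fst (s, y), snd (s, y))) has_real_derivative Tx (z + fst (x, y), snd (x, y)))
      (at x within {- (pi/2)..pi/2})" by simp
  have "((\<lambda>s. Tx (z + s, y)) has_real_derivative Txx (z + x, y) * 1) (at x within {- (pi/2)..pi/2})"
    by (rule DERIV_chain2[where f = "\<lambda>s. Tx (s, y)"]) (auto intro!: derivative_eq_intros Txx y')
  then show "((\<lambda>s. Tx (z + fst (s, y), snd (s, y))) has_real_derivative Txx (z + fst (x, y), snd (x, y)))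
      (at x within {- (pi/2)..pi/2})" by simp
  show "((\<lambda>s. T (z + fst (x, s), snd (x, s))) has_real_derivative Ty (z + fst (x, y), snd (x, y)))
      (at y within {0..pi/2})"
    "((\<lambda>s. Ty (z + fst (x, s), snd (x, s))) has_real_derivative Tyy (z + fst (x, y), snd (x, y)))
      (at y within {0..pi/2})"
    using DERIV_subset[OF Ty[OF y'] sub] DERIV_subset[OF Tyy[OF y'] sub] by auto
  show "c * f (T (z + fst (x, y), snd (x, y))) \<ge> 0" using fT_nonneg[OF y'] pos by simp
  show "w (z + fst (x, y), snd (x, y)) \<ge> 0" using w_nonneg[OF y'] by simp
  show "w (z + fst (x, y), snd (x, y)) + a * cos z * (sin x * cos y * Tx (z + fst (x, y), snd (x, y))
      - cos x * sin y * Ty (z + fst (x, y), snd (x, y))) =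
    b * (Txx (z + fst (x, y), snd (x, y)) + Tyy (z + fst (x, y), snd (x, y)))
      + c * f (T (z + fst (x, y), snd (x, y)))"
    using eq[OF y', of "z + x"] by (simp add: sin_add cos_add z algebra_simps)
qed

lemma corner_energy_eq:
  assumes z: "sin z = 0"
  shows "corner_flow.energy b (\<lambda>p. c * f (T (z + fst p, snd p))) (\<lambda>p. Tx (z + fst p, snd p))
    (\<lambda>p. Ty (z + fst p, snd p)) (\<lambda>p. w (z + fst p, snd p)) = corner_energy z"
  unfolding corner_flow.energy_def[OF corner[OF z]] corner_energy_def
    corner_flow.energy_density_def[OF corner[OF z], abs_def] front_density_def ..

text \<open>The flow reverses from one corner to the next; dividing the flux by the signed velocity makes the
  two means agree on the vertical line halfway between the corners.\<close>

lemma corner_mean_glue: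
  assumes z: "sin z = 0"
  shows "corner_mean z (pi/2) = corner_mean (z + pi) (- (pi/2))"
proof -
  have z': "sin (z + pi) = 0" using z by simp
  have shift: "z + pi + - (pi / 2) = z + pi / 2" by simp
  have bump: "bump (- (1 * sin y / \<eta>)) = - bump (sin y / \<eta>)" for y using bump_simps(6) by simp
  have "integral {0..pi/2} (\<lambda>y. bump (sin (- (pi/2)) * sin y / \<eta>) *
      (a * cos (z + pi) * (sin (- (pi/2)) * cos y * T (z + pi + - (pi/2), y)) - b * Tx (z + pi + - (pi/2), y)))
    = integral {0..pi/2} (\<lambda>y. - (bump (sin (pi/2) * sin y / \<eta>) *
      (a * cos z * (sin (pi/2) * cos y * T (z + pi/2, y)) - b * Tx (z + pi/2, y))))"
    unfolding shift by (rule integral_cong) (simp add: bump_simps)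
  then show ?thesis
    unfolding corner_mean_def corner_flow.tube_mean_def[OF corner[OF z]] corner_flow.tube_mean_def[OF corner[OF z']]
      corner_flow.flux_def[OF corner[OF z]] corner_flow.flux_def[OF corner[OF z']]
      corner_flow.tube_bump_def[OF corner[OF z]] corner_flow.tube_bump_def[OF corner[OF z']] tube_def
    by simp
qed

lemma corner_jump:
  assumes z: "sin z = 0"
  shows "\<bar>corner_mean (z + pi) (- (pi/2)) - corner_mean z (- (pi/2))\<bar>
    \<le> 1300 * (\<eta> * cell_energy z + sqrt (\<eta> * cell_energy z))"
proof -
  have "\<bar>corner_mean z (pi/2) - corner_mean z (- (pi/2))\<bar> \<le> 1300 * (\<eta> * corner_energy z + sqrt (\<eta> * corner_energy z))"
    using corner_flow.tube_mean_corner[OF corner[OF z]] by (simp add: corner_mean_def corner_energy_eq[OF z])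
  also have "\<dots> \<le> 1300 * (\<eta> * cell_energy z + sqrt (\<eta> * cell_energy z))"
    using corner_energy_le \<eta>(1) by (intro mult_left_mono add_mono real_sqrt_le_mono) auto
  finally show ?thesis by (simp add: corner_mean_glue[OF z])
qed

text \<open>The entry 1 gives \<open>threshold\<close> \<le> sqrt \<open>threshold\<close>; the
  entry with 1000 gives (24 + 421) sqrt \<open>threshold\<close> < \<zeta>/2; and \<phi> is what a
  burning column is compared with.\<close>

definition "threshold = min 1 (min ((\<zeta> / 1000)\<^sup>2) \<phi>)"

lemma threshold: "threshold > 0" "threshold \<le> 1" "sqrt threshold \<le> \<zeta> / 1000" "threshold \<le> \<phi>"
proof -
  show "threshold > 0" "threshold \<le> 1" "threshold \<le> \<phi>" using front by (auto simp: threshold_def)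
  have "sqrt threshold \<le> sqrt ((\<zeta> / 1000)\<^sup>2)" by (intro real_sqrt_le_mono) (simp add: threshold_def)
  then show "sqrt threshold \<le> \<zeta> / 1000" using front by simp
qed

text \<open>This is \<open>good_column\<close> with d = sqrt (b / c): being quiet says that d times
  the energy is below \<open>threshold\<close>, and the closeness estimate involves the energy only
  through this product.\<close>

lemma quiet_corner:
  assumes z: "sin z = 0" and quiet: "cell_energy z < threshold / sqrt (b / c)"
  shows "\<exists>x\<in>{z - pi/2..z}. integral {0..pi/2} (\<lambda>y. front_density (x, y)) \<le> cell_energy z \<and>
    (\<forall>y\<in>{0..sqrt (b / c)}. \<bar>corner_mean z (- (pi/2)) - T (x, y)\<bar> < \<zeta> / 2)"
proof -
  let ?d = "sqrt (b / c)"
  have d: "4 * \<eta> \<le> ?d" "?d \<le> 1" "?d > 0" using \<eta>(4) pos order by (auto simp: real_sqrt_le_1_iff)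
  have E: "corner_energy z \<le> cell_energy z" by (rule corner_energy_le)
  obtain s where s: "s \<in> {- (pi/2)..- (pi/6)}"
    "integral {0..pi/2} (\<lambda>y. front_density (z + s, y)) \<le> corner_energy z"
    "\<And>y. y \<in> {0..?d} \<Longrightarrow> \<bar>corner_mean z (- (pi/2)) - T (z + s, y)\<bar>
      \<le> 24 * (?d * corner_energy z) + 421 * sqrt (?d * corner_energy z)"
    using corner_flow.good_column[OF corner[OF z] d(1,2)]
    by (auto simp: corner_mean_def corner_energy_eq[OF z] corner_flow.energy_density_def[OF corner[OF z]] front_density_def)
  define u where "u = ?d * corner_energy z"
  have "corner_energy z < threshold / ?d" using E quiet by linarith
  then have u: "u < threshold" using d(3) by (simp add: u_def pos_less_divide_eq mult.commute)
  have "24 * u + 421 * sqrt u < \<zeta> / 2"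
  proof -
    have "u \<le> \<bar>u\<bar>" by simp
    have "24 * u \<le> 24 * sqrt threshold"
    proof -
      have "threshold * threshold \<le> threshold * 1" using threshold by (intro mult_left_mono) auto
      then have "threshold \<le> sqrt threshold"
        by (intro real_le_rsqrt) (simp add: power2_eq_square)
      then show ?thesis using u by linarith
    qed
    moreover have "sqrt u \<le> sqrt threshold" using u by simp
    ultimately have "24 * u + 421 * sqrt u \<le> 445 * sqrt threshold" by linarith
    then show ?thesis using threshold(3) front(2) by linarith
  qed
  then have "\<forall>y\<in>{0..?d}. \<bar>corner_mean z (- (pi/2)) - T (z + s, y)\<bar> < \<zeta> / 2"
    using s(3) unfolding u_def by (meson le_less_trans)
  moreover have "z + s \<in> {z - pi/2..z}"
  proof -
    have "s \<le> - (pi/6)" "- (pi/2) \<le> s" using s(1) by auto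
    then show ?thesis using pi_gt_zero by auto
  qed
  ultimately show ?thesis using s(2) E by (intro bexI[of _ "z + s"] conjI) auto
qed

text \<open>In a quiet cell T would lie within \<zeta>/2 of the mean on a column of height d = sqrt
  (b / c), so f(T) > \<phi> there, and the column alone would carry d c \<phi> / b = \<phi> / d. For
  this d quietness and burning have the same scale 1/d.\<close>

lemma intermediate_corner_burns:
  assumes z: "sin z = 0" and mid: "\<theta>1 \<le> corner_mean z (- (pi/2))" "corner_mean z (- (pi/2)) \<le> \<theta>4"
  shows "cell_energy z \<ge> threshold / sqrt (b / c)"
proof (rule ccontr)
  assume "\<not> cell_energy z \<ge> threshold / sqrt (b / c)"
  then have quiet: "cell_energy z < threshold / sqrt (b / c)" by simp
  let ?d = "sqrt (b / c)"
  have d: "?d \<le> 1" "?d > 0" using pos order by (auto simp: real_sqrt_le_1_iff)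
  have "?d \<le> pi/2" "?d \<le> pi" using d(1) pi_gt3 by linarith+
  then have d2: "{0..?d} \<subseteq> {0..pi/2}" "{0..pi/2} \<subseteq> {0..pi}" "?d \<le> pi" by auto
  obtain x where x: "integral {0..pi/2} (\<lambda>y. front_density (x, y)) \<le> cell_energy z"
    "\<And>y. y \<in> {0..?d} \<Longrightarrow> \<bar>corner_mean z (- (pi/2)) - T (x, y)\<bar> < \<zeta> / 2"
    using quiet_corner[OF z quiet] by blast
  have cx: "continuous_on {0..pi} (\<lambda>y. front_density (x, y))"
    by (rule continuous_on_slice(1)[OF front_density_continuous]) simp
  have dd: "?d * ?d = b / c" using pos by simp
  have "\<phi> / ?d = ?d * (c * \<phi> / b)"
    using d(2) pos dd by (simp add: field_simps)
  also have "\<dots> = integral {0..?d} (\<lambda>y. c * \<phi> / b)" using d by simp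
  also have "\<dots> \<le> integral {0..?d} (\<lambda>y. front_density (x, y))"
  proof (rule integral_le)
    show "(\<lambda>y. front_density (x, y)) integrable_on {0..?d}"
      using d2 by (intro integrable_continuous_real continuous_on_subset[OF cx]) auto
    fix y assume y: "y \<in> {0..?d}"
    have y': "y \<in> {0..pi}" using y d2 by blast
    have "\<theta>1 - \<zeta> < T (x, y)" "T (x, y) < \<theta>4 + \<zeta>" using x(2)[OF y] mid front(2) by linarith+
    then have "c * \<phi> + 0 \<le> c * f (T (x, y)) + w (x, y)"
      using f_gt[of "T (x, y)"] pos w_nonneg[OF y', of x] by (intro add_mono mult_left_mono) auto
    then have "c * \<phi> / b \<le> (c * f (T (x, y)) + w (x, y)) / b" using pos by (intro divide_right_mono) auto
    then show "c * \<phi> / b \<le> front_density (x, y)" by (simp add: front_density_def add_increasing)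
  qed auto
  also have "\<dots> \<le> integral {0..pi/2} (\<lambda>y. front_density (x, y))"
    using d2 front_density_nonneg
    by (intro integral_subset_le integrable_continuous_real continuous_on_subset[OF cx]) auto
  also have "\<dots> < threshold / ?d" using x(1) quiet by linarith
  also have "\<dots> \<le> \<phi> / ?d" using threshold d by (intro divide_right_mono) auto
  finally show False by simp
qed

text \<open>Pigeonhole against the total energy. In a noisy cell the limits of T at infinity give no
  control of the tube mean, so the sequence of cells has to start and end at quiet ones.\<close>

lemma exists_quiet_corner:
  assumes "real J * (threshold / sqrt (b / c)) > 3 * V / b"
  shows "\<exists>j<J. cell_energy (z + real j * pi) < threshold / sqrt (b / c)"
proof (rule ccontr)
  assume "\<not> ?thesis"
  then have "threshold / sqrt (b / c) \<le> cell_energy (z + real j * pi)" if "j < J" for j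
    using that by (meson not_less)
  then have "(\<Sum>j<J. threshold / sqrt (b / c)) \<le> (\<Sum>j<J. cell_energy (z + real j * pi))"
    by (intro sum_mono) auto
  with sum_cell_energy[where z = z and n = J] assms show False by simp
qed

lemma sin_shift: "sin z = 0 \<Longrightarrow> sin (z + real j * pi) = 0"
  by (simp add: sin_add)

lemma energy_alternative:
  defines "E \<equiv> 3 * V / b"
  shows "\<eta> * E > 1 \<or> (\<exists>n\<ge>1. real (n - 1) * (threshold / sqrt (b / c)) \<le> E \<and>
    (\<theta>4 - \<theta>1)\<^sup>2 \<le> 2600\<^sup>2 * (real n * (\<eta> * E)))"
proof (cases "\<eta> * E > 1")
  case False
  let ?\<kappa> = "threshold / sqrt (b / c)"
  have \<kappa>: "?\<kappa> > 0" using threshold pos by simp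
  obtain J where J: "real J * ?\<kappa> > E" using reals_Archimedean3[OF \<kappa>] by blast
  have z4: "\<zeta> / 4 > 0" using front by simp
  obtain N1 N2 where N1: "\<And>x y. x \<ge> N1 \<Longrightarrow> y \<in> {0..pi} \<Longrightarrow> T (x, y) \<le> \<zeta> / 4"
    and N2: "\<And>x y. x \<le> N2 \<Longrightarrow> y \<in> {0..pi} \<Longrightarrow> 1 - T (x, y) \<le> \<zeta> / 4"
    using T_limit_right[OF z4] T_limit_left[OF z4] by metis
  obtain M where M: "real M * pi > max (N1 + pi) (- N2)"
    using reals_Archimedean3[OF pi_gt_zero] by blast
  \<comment> \<open>The left block of J cells starts J cells further out, so that a quiet cell found
    in it still has its column to the left of -M pi.\<close>
  define z0 where "z0 = - (real (M + J) * pi)"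
  have sz0: "sin z0 = 0" using sin_npi[of "M + J"] by (simp add: z0_def)
  obtain jl where jl: "jl < J" "cell_energy (z0 + real jl * pi) < ?\<kappa>"
    using exists_quiet_corner[of J z0] J by (auto simp: E_def)
  obtain jr where jr: "jr < J" "cell_energy (real M * pi + real jr * pi) < ?\<kappa>"
    using exists_quiet_corner[of J "real M * pi"] J by (auto simp: E_def)
  define zl where "zl = z0 + real jl * pi"
  \<comment> \<open>The number of cells from zl to the quiet cell on the right; the subtraction is
    exact because jl < J.\<close>
  define N where "N = 2 * M + J - jl + jr"
  have szl: "sin zl = 0" unfolding zl_def by (rule sin_shift[OF sz0])
  have zr: "zl + real N * pi = real M * pi + real jr * pi"
    using jl(1) by (simp add: zl_def z0_def N_def of_nat_diff algebra_simps)
  have szr: "sin (zl + real N * pi) = 0" by (rule sin_shift[OF szl])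
  define m where "m = (\<lambda>j. corner_mean (zl + real j * pi) (- (pi/2)))"
  have 0: "(0::real) \<in> {0..sqrt (b / c)}" "(0::real) \<in> {0..pi}" using pos by auto
  have "\<exists>n\<ge>1. real (n - 1) * ?\<kappa> \<le> E \<and> (\<theta>4 - \<theta>1)\<^sup>2 \<le> 2600\<^sup>2 * (real n * (\<eta> * E))"
  proof (rule discrete_front)
    show "m 0 > \<theta>4"
    proof -
      obtain x where x: "x \<in> {zl - pi/2..zl}"
        "\<forall>y\<in>{0..sqrt (b / c)}. \<bar>corner_mean zl (- (pi/2)) - T (x, y)\<bar> < \<zeta> / 2"
        using quiet_corner[OF szl] jl(2) by (auto simp: zl_def)
      have "zl \<le> - (real M * pi)"
        using jl(1) pi_gt_zero by (simp add: zl_def z0_def algebra_simps)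
      then have "x \<le> N2" using x(1) M by auto
      then have "1 - T (x, 0) \<le> \<zeta> / 4" by (rule N2[OF _ 0(2)])
      moreover have "\<bar>corner_mean zl (- (pi/2)) - T (x, 0)\<bar> < \<zeta> / 2" using x(2) 0(1) by blast
      ultimately have "corner_mean zl (- (pi/2)) > \<theta>4" using levels(2) front(2) by linarith
      then show ?thesis by (simp add: m_def)
    qed
    show "m N < \<theta>1"
    proof -
      obtain x where x: "x \<in> {zl + real N * pi - pi/2..zl + real N * pi}"
        "\<forall>y\<in>{0..sqrt (b / c)}. \<bar>corner_mean (zl + real N * pi) (- (pi/2)) - T (x, y)\<bar> < \<zeta> / 2"
        using quiet_corner[OF szr] jr(2) by (auto simp: zr)
      have "x \<ge> real M * pi + real jr * pi - pi/2" using x(1) zr by auto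
      moreover have "real jr * pi \<ge> 0" using pi_gt_zero by simp
      moreover have "N1 + pi < real M * pi" using M by simp
      ultimately have "x \<ge> N1" using pi_gt_zero by linarith
      then have "T (x, 0) \<le> \<zeta> / 4" by (rule N1[OF _ 0(2)])
      moreover have "\<bar>corner_mean (zl + real N * pi) (- (pi/2)) - T (x, 0)\<bar> < \<zeta> / 2" using x(2) 0(1) by blast
      ultimately have "corner_mean (zl + real N * pi) (- (pi/2)) < \<theta>1" using levels(1) front(2) by linarith
      then show ?thesis by (simp add: m_def)
    qed
    show "(\<Sum>j<N. cell_energy (zl + real j * pi)) \<le> E" unfolding E_def by (rule sum_cell_energy)
    show "\<bar>m (Suc j) - m j\<bar> \<le> 1300 * (\<eta> * cell_energy (zl + real j * pi) + sqrt (\<eta> * cell_energy (zl + real j * pi)))" for j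
      using corner_jump[OF sin_shift[OF szl, of j]] by (simp add: m_def algebra_simps)
    show "cell_energy (zl + real j * pi) \<ge> ?\<kappa>" if "\<theta>1 \<le> m j" "m j \<le> \<theta>4" for j
      using intermediate_corner_burns[OF sin_shift[OF szl, of j]] that by (simp add: m_def)
  qed (use cell_energy_nonneg \<eta>(1) \<kappa> False front in auto)
  then show ?thesis by blast
qed auto

text \<open>Every alternative leads to E^2 \<ge> k / (\<eta> d) with d = sqrt (b / c); the entries
  of k belong to \<eta> E > 1, to a single jump and to several jumps. As \<eta> d = b / (4 sqrt (a
  c)) and V = b E / 3, a square root yields the power 1/4.\<close>

lemma enhanced_bound:
  defines "\<delta> \<equiv> \<theta>4 - \<theta>1"
  defines "k \<equiv> min 1 (min ((\<delta>\<^sup>2 / 2600\<^sup>2)\<^sup>2) (threshold * \<delta>\<^sup>2 / (2 * 2600\<^sup>2)))"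
  shows "V \<ge> b * (sqrt k / 3) * sqrt (c / b) * (a / c) powr (1 / 4)"
proof -
  define E where "E = 3 * V / b"
  let ?d = "sqrt (b / c)"
  have d: "?d > 0" "4 * \<eta> \<le> ?d" using pos \<eta>(4) by auto
  have E0: "E \<ge> 0" using sum_cell_energy[where n = 0] by (simp add: E_def)
  have \<delta>: "\<delta> > 0" using front by (simp add: \<delta>_def)
  have k: "k \<le> 1" "k \<le> (\<delta>\<^sup>2 / 2600\<^sup>2)\<^sup>2" "k \<le> threshold * \<delta>\<^sup>2 / (2 * 2600\<^sup>2)" "k > 0"
    using \<delta> threshold by (auto simp: k_def)
  have inv: "1 / (\<eta> * ?d) \<le> 1 / \<eta>\<^sup>2"
    using d \<eta>(1) by (intro divide_left_mono) (auto simp: power2_eq_square)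
  have E2: "E\<^sup>2 \<ge> k / (\<eta> * ?d)"
  proof (cases "\<eta> * E > 1")
    case True
    then have "1 / \<eta> < E" using \<eta>(1) by (simp add: field_simps)
    then have "(1 / \<eta>)\<^sup>2 \<le> E\<^sup>2" using \<eta>(1) by (intro power_mono) auto
    then have "1 / (\<eta> * ?d) \<le> E\<^sup>2" using inv by (simp add: power_divide)
    moreover have "k / (\<eta> * ?d) \<le> 1 / (\<eta> * ?d)" using k d \<eta>(1) by (intro divide_right_mono) auto
    ultimately show ?thesis by linarith
  next
    case False
    then obtain n where n: "n \<ge> 1" "real (n - 1) * (threshold / ?d) \<le> E" "\<delta>\<^sup>2 \<le> 2600\<^sup>2 * (real n * (\<eta> * E))"
      using energy_alternative by (auto simp: E_def \<delta>_def)
    show ?thesis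
    proof (cases "n = 1")
      case True
      then have "\<delta>\<^sup>2 / 2600\<^sup>2 / \<eta> \<le> E" using n(3) \<eta>(1) by (simp add: field_simps)
      then have "(\<delta>\<^sup>2 / 2600\<^sup>2 / \<eta>)\<^sup>2 \<le> E\<^sup>2" using \<eta>(1) by (intro power_mono) auto
      moreover have "k * (1 / (\<eta> * ?d)) \<le> (\<delta>\<^sup>2 / 2600\<^sup>2)\<^sup>2 * (1 / \<eta>\<^sup>2)"
        using k(2,4) inv d \<eta>(1) by (intro mult_mono) auto
      ultimately show ?thesis by (simp add: power_divide)
    next
      case False
      then have n2: "real n \<le> 2 * real (n - 1)" using n(1) by linarith
      \<comment> \<open>The jump bound carries n \<eta> E, the burning bound is (n - 1)
        \<open>threshold\<close> / d \<le> E; their product eliminates n, as n \<le> 2 (n - 1) for n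
        \<ge> 2.\<close>
      have "\<delta>\<^sup>2 * (threshold / ?d) \<le> 2600\<^sup>2 * (real n * (\<eta> * E)) * (threshold / ?d)"
        using n(3) threshold d by (intro mult_right_mono) auto
      also have "\<dots> \<le> 2600\<^sup>2 * (2 * real (n - 1) * (\<eta> * E)) * (threshold / ?d)"
        using n2 threshold d E0 \<eta>(1) by (intro mult_right_mono mult_left_mono) auto
      also have "\<dots> = 2600\<^sup>2 * 2 * \<eta> * E * (real (n - 1) * (threshold / ?d))" by simp
      also have "\<dots> \<le> 2600\<^sup>2 * 2 * \<eta> * E * E" using n(2) E0 \<eta>(1) by (intro mult_left_mono) auto
      finally have "threshold * \<delta>\<^sup>2 / (2 * 2600\<^sup>2) / (\<eta> * ?d) \<le> E\<^sup>2"
        using d(1) \<eta>(1) by (simp add: field_simps power2_eq_square)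
      moreover have "k / (\<eta> * ?d) \<le> threshold * \<delta>\<^sup>2 / (2 * 2600\<^sup>2) / (\<eta> * ?d)"
        using k(3) d \<eta>(1) by (intro divide_right_mono) auto
      ultimately show ?thesis by linarith
    qed
  qed
  have "(b * (sqrt k / 3) * sqrt (c / b) * (a / c) powr (1 / 4))\<^sup>2 = b\<^sup>2 * (k / 9) * ((c / b) * sqrt (a / c))"
  proof -
    have "((a / c) powr (1 / 4))\<^sup>2 = (a / c) powr (1 / 4 + 1 / 4)"
      unfolding power2_eq_square by (rule powr_add[symmetric])
    also have "\<dots> = sqrt (a / c)" using pos by (simp add: powr_half_sqrt)
    finally show ?thesis using k(4) pos by (simp add: power_mult_distrib power_divide)
  qed
  also have "(c / b) * sqrt (a / c) = 1 / (4 * (\<eta> * ?d))"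
  proof -
    have sq: "sqrt u * sqrt u = u" if "u > 0" for u using that by simp
    have "4 * (\<eta> * ?d) = sqrt b * sqrt b / (sqrt a * sqrt c)"
      by (simp add: \<eta>_def real_sqrt_divide)
    then have "1 / (4 * (\<eta> * ?d)) = (sqrt a * sqrt c) / b" using sq[OF pos(2)] by simp
    moreover have "r * r / b * (s / r) = s * r / b" if "r \<noteq> 0" for r s :: real using that by simp
    from this[of "sqrt c" "sqrt a"] have "sqrt c * sqrt c / b * (sqrt a / sqrt c) = sqrt a * sqrt c / b"
      using pos by simp
    then have "(c / b) * sqrt (a / c) = sqrt a * sqrt c / b"
      unfolding sq[OF pos(3)] real_sqrt_divide .
    ultimately show ?thesis by simp
  qed
  also have "b\<^sup>2 * (k / 9) * (1 / (4 * (\<eta> * ?d))) \<le> b\<^sup>2 / 9 * (k / (\<eta> * ?d))"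
    using k(4) \<eta>(1) d(1) by (simp add: field_simps)
  also have "\<dots> \<le> b\<^sup>2 / 9 * E\<^sup>2" by (intro mult_left_mono E2) auto
  also have "\<dots> = V\<^sup>2" using pos by (simp add: E_def power2_eq_square)
  finally have "(b * (sqrt k / 3) * sqrt (c / b) * (a / c) powr (1 / 4))\<^sup>2 \<le> V\<^sup>2" .
  moreover have "V \<ge> 0" using E0 pos by (simp add: E_def zero_le_divide_iff)
  ultimately show ?thesis by (rule power2_le_imp_le)
qed

end

end

section \<open>Monotonicity in time and decay\<close>

text \<open>Derivatives of T are given only for t > 0, so the initial value S carries its own; it
  acts as a stationary subsolution. The disjunction in \<open>bc\<close> stands outside the
  quantifiers, so that T and S obey the same kind of condition and their differences inherit
  it.\<close>

locale cellular_evolution =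
  fixes a b c L K \<mu> :: real and f :: "real \<Rightarrow> real"
    and T Tx Ty Txx Tyy Tt :: "real \<Rightarrow> real \<times> real \<Rightarrow> real"
    and S Sx Sy Sxx Syy :: "real \<times> real \<Rightarrow> real"
  assumes pos: "a > 0" "b > 0" "c > 0" "L \<ge> 0" "K \<ge> 0" "\<mu> > 0"
    and f_nonneg: "\<And>s. s \<in> {0..1} \<Longrightarrow> f s \<ge> 0" and f0: "f 0 = 0" and f1: "f 1 = 0"
    and f_lipschitz: "\<And>s r. s \<in> {0..1} \<Longrightarrow> r \<in> {0..1} \<Longrightarrow> \<bar>f s - f r\<bar> \<le> L * \<bar>s - r\<bar>"
    and cont_T: "continuous_on ({0..} \<times> (UNIV \<times> {0..pi})) (\<lambda>(t, p). T t p)"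
    and cont: "\<And>t. t > 0 \<Longrightarrow> continuous_on (UNIV \<times> {0..pi}) (Tx t)"
      "\<And>t. t > 0 \<Longrightarrow> continuous_on (UNIV \<times> {0..pi}) (Ty t)"
      "\<And>t. t > 0 \<Longrightarrow> continuous_on (UNIV \<times> {0..pi}) (Txx t)"
      "\<And>t. t > 0 \<Longrightarrow> continuous_on (UNIV \<times> {0..pi}) (Tyy t)"
      "\<And>t. t > 0 \<Longrightarrow> continuous_on (UNIV \<times> {0..pi}) (Tt t)"
    and T_range: "\<And>t x y. t \<ge> 0 \<Longrightarrow> y \<in> {0..pi} \<Longrightarrow> T t (x, y) \<in> {0..1}"
    and Tt: "\<And>t x y. t > 0 \<Longrightarrow> y \<in> {0..pi} \<Longrightarrow>
      ((\<lambda>s. T s (x, y)) has_real_derivative Tt t (x, y)) (at t)"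
    and Tx: "\<And>t x y. t > 0 \<Longrightarrow> y \<in> {0..pi} \<Longrightarrow>
      ((\<lambda>s. T t (s, y)) has_real_derivative Tx t (x, y)) (at x)"
    and Txx: "\<And>t x y. t > 0 \<Longrightarrow> y \<in> {0..pi} \<Longrightarrow>
      ((\<lambda>s. Tx t (s, y)) has_real_derivative Txx t (x, y)) (at x)"
    and Ty: "\<And>t x y. t > 0 \<Longrightarrow> y \<in> {0..pi} \<Longrightarrow>
      ((\<lambda>s. T t (x, s)) has_real_derivative Ty t (x, y)) (at y within {0..pi})"
    and Tyy: "\<And>t x y. t > 0 \<Longrightarrow> y \<in> {0..pi} \<Longrightarrow>
      ((\<lambda>s. Ty t (x, s)) has_real_derivative Tyy t (x, y)) (at y within {0..pi})"
    and eq: "\<And>t x y. t > 0 \<Longrightarrow> y \<in> {0..pi} \<Longrightarrow>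
      Tt t (x, y) + a * (sin x * cos y * Tx t (x, y) - cos x * sin y * Ty t (x, y)) =
        b * (Txx t (x, y) + Tyy t (x, y)) + c * f (T t (x, y))"
    and bc: "(\<forall>t>0. \<forall>x. Ty t (x, 0) = 0 \<and> Ty t (x, pi) = 0) \<and> (\<forall>x. Sy (x, 0) = 0 \<and> Sy (x, pi) = 0) \<or>
      (\<forall>t>0. \<forall>x. T t (x, 0) = T t (x, pi) \<and> Ty t (x, 0) = Ty t (x, pi)) \<and>
      (\<forall>x. S (x, 0) = S (x, pi) \<and> Sy (x, 0) = Sy (x, pi))"
    and init: "\<And>x y. y \<in> {0..pi} \<Longrightarrow> T 0 (x, y) = S (x, y)"
    and cont_S: "continuous_on (UNIV \<times> {0..pi}) S"
    and Sx: "\<And>x y. y \<in> {0..pi} \<Longrightarrow> ((\<lambda>s. S (s, y)) has_real_derivative Sx (x, y)) (at x)"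
    and Sxx: "\<And>x y. y \<in> {0..pi} \<Longrightarrow> ((\<lambda>s. Sx (s, y)) has_real_derivative Sxx (x, y)) (at x)"
    and Sy: "\<And>x y. y \<in> {0..pi} \<Longrightarrow>
      ((\<lambda>s. S (x, s)) has_real_derivative Sy (x, y)) (at y within {0..pi})"
    and Syy: "\<And>x y. y \<in> {0..pi} \<Longrightarrow>
      ((\<lambda>s. Sy (x, s)) has_real_derivative Syy (x, y)) (at y within {0..pi})"
    and subsolution: "\<And>x y. y \<in> {0..pi} \<Longrightarrow>
      b * (Sxx (x, y) + Syy (x, y)) - a * (sin x * cos y * Sx (x, y) - cos x * sin y * Sy (x, y))
        + c * f (S (x, y)) \<ge> 0"
    and decay_right: "\<And>x y. y \<in> {0..pi} \<Longrightarrow> S (x, y) \<le> K * exp (- \<mu> * x)"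
    and decay_left: "\<And>x y. y \<in> {0..pi} \<Longrightarrow> 1 - S (x, y) \<le> K * exp (\<mu> * x)"
begin

lemma comparison:
  fixes W Wx Wy Wxx Wyy Wt :: "real \<Rightarrow> real \<times> real \<Rightarrow> real"
  assumes cW: "continuous_on ({0..} \<times> (UNIV \<times> {0..pi})) (\<lambda>(t, p). W t p)"
    and bdd: "\<And>t x y. t \<ge> 0 \<Longrightarrow> y \<in> {0..pi} \<Longrightarrow> W t (x, y) \<ge> - 1"
    and W0: "\<And>x y. y \<in> {0..pi} \<Longrightarrow> W 0 (x, y) \<ge> 0"
    and d: "\<And>t x y. t > 0 \<Longrightarrow> y \<in> {0..pi} \<Longrightarrow> ((\<lambda>s. W s (x, y)) has_real_derivative Wt t (x, y)) (at t)"
      "\<And>t x y. t > 0 \<Longrightarrow> y \<in> {0..pi} \<Longrightarrow> ((\<lambda>s. W t (s, y)) has_real_derivative Wx t (x, y)) (at x)"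
      "\<And>t x y. t > 0 \<Longrightarrow> y \<in> {0..pi} \<Longrightarrow> ((\<lambda>s. Wx t (s, y)) has_real_derivative Wxx t (x, y)) (at x)"
      "\<And>t x y. t > 0 \<Longrightarrow> y \<in> {0..pi} \<Longrightarrow>
        ((\<lambda>s. W t (x, s)) has_real_derivative Wy t (x, y)) (at y within {0..pi})"
      "\<And>t x y. t > 0 \<Longrightarrow> y \<in> {0..pi} \<Longrightarrow>
        ((\<lambda>s. Wy t (x, s)) has_real_derivative Wyy t (x, y)) (at y within {0..pi})"
    and Wbc: "\<And>t x. t > 0 \<Longrightarrow>
      (Wy t (x, 0) = 0 \<and> Wy t (x, pi) = 0) \<or> (W t (x, 0) = W t (x, pi) \<and> Wy t (x, 0) = Wy t (x, pi))"
    and super: "\<And>t x y. t > 0 \<Longrightarrow> y \<in> {0..pi} \<Longrightarrow> W t (x, y) < 0 \<Longrightarrow>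
      Wt t (x, y) + a * (sin x * cos y * Wx t (x, y) - cos x * sin y * Wy t (x, y))
        - b * (Wxx t (x, y) + Wyy t (x, y)) \<ge> c * L * W t (x, y)"
    and t: "t > 0" and y: "y \<in> {0..pi}"
  shows "W t (x, y) \<ge> 0"
proof (rule comparison_strip[where \<tau> = t and l = pi and b = b and a = a and L = "c * L" and B = 1
      and vx = "\<lambda>p. a * (sin (fst p) * cos (snd p))" and vy = "\<lambda>p. - a * (cos (fst p) * sin (snd p))"
      and W = W and Wx = Wx and Wy = Wy and Wxx = Wxx and Wyy = Wyy and Wt = Wt])
  show "continuous_on ({0..t} \<times> UNIV \<times> {0..pi}) (\<lambda>(t, p). W t p)"
    by (rule continuous_on_subset[OF cW]) auto
  show "\<bar>a * (sin (fst p) * cos (snd p))\<bar> \<le> a" for p :: "real \<times> real"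
    using pos by (simp add: abs_mult mult_le_one mult_left_le)
  show "c * L * W s (x, y) \<le> Wt s (x, y) + (a * (sin (fst (x, y)) * cos (snd (x, y))) * Wx s (x, y)
      + - a * (cos (fst (x, y)) * sin (snd (x, y))) * Wy s (x, y)) - b * (Wxx s (x, y) + Wyy s (x, y))"
    if "s \<in> {0<..t}" "y \<in> {0..pi}" "W s (x, y) < 0" for s x y
    using super[of s y x] that by (simp add: algebra_simps)
qed (use pos t y d bdd W0 Wbc in auto)

lemma continuous_T: "t > 0 \<Longrightarrow> continuous_on (UNIV \<times> {0..pi}) (T t)"
proof -
  assume "t > 0"
  then have "continuous_on (UNIV \<times> {0..pi}) (\<lambda>p. (\<lambda>(t, p). T t p) (t, p))"
    by (intro continuous_on_compose2[OF cont_T]) (auto intro!: continuous_intros)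
  then show ?thesis by simp
qed

lemma S_range: "y \<in> {0..pi} \<Longrightarrow> S (x, y) \<in> {0..1}"
  using T_range[of 0 y x] init[of y x] by simp

lemma reaction_difference:
  assumes "s \<in> {0..1}" "r \<in> {0..1}" "s - r < 0"
  shows "c * f s - c * f r \<ge> c * L * (s - r)"
proof -
  have "L * \<bar>s - r\<bar> = - (L * (s - r))" using assms(3) by (simp add: algebra_simps)
  then have "f s - f r \<ge> L * (s - r)" using f_lipschitz[OF assms(1,2)] by linarith
  then have "c * (f s - f r) \<ge> c * (L * (s - r))" using pos by (intro mult_left_mono) auto
  then show ?thesis by (simp add: algebra_simps)
qed

lemma above_initial:
  assumes t: "t > 0" and y: "y \<in> {0..pi}"
  shows "T t (x, y) \<ge> S (x, y)"
proof -
  have "T t (x, y) - S (x, y) \<ge> 0"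
  proof (rule comparison[where W = "\<lambda>t p. T t p - S p" and Wx = "\<lambda>t p. Tx t p - Sx p"
        and Wy = "\<lambda>t p. Ty t p - Sy p" and Wxx = "\<lambda>t p. Txx t p - Sxx p"
        and Wyy = "\<lambda>t p. Tyy t p - Syy p" and Wt = Tt, OF _ _ _ _ _ _ _ _ _ _ t y])
    have "continuous_on ({0..} \<times> (UNIV \<times> {0..pi})) (\<lambda>q. T (fst q) (snd q) - S (snd q))"
      using cont_T by (auto simp: case_prod_beta' intro!: continuous_intros continuous_on_compose2[OF cont_S])
    then show "continuous_on ({0..} \<times> (UNIV \<times> {0..pi})) (\<lambda>(t, p). T t p - S p)"
      by (simp add: case_prod_beta')
    show "T t (x, y) - S (x, y) \<ge> - 1" if "t \<ge> 0" "y \<in> {0..pi}" for t x y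
      using T_range[OF that, of x] S_range[OF that(2), of x] by simp
    show "T 0 (x, y) - S (x, y) \<ge> 0" if "y \<in> {0..pi}" for x y using init[OF that] by simp
    show "((\<lambda>s. T s (x, y) - S (x, y)) has_real_derivative Tt t (x, y)) (at t)"
      if "t > 0" "y \<in> {0..pi}" for t x y
      using DERIV_diff[OF Tt[OF that] DERIV_const[of "S (x, y)"]] by simp
    show "((\<lambda>s. T t (s, y) - S (s, y)) has_real_derivative Tx t (x, y) - Sx (x, y)) (at x)"
      "((\<lambda>s. Tx t (s, y) - Sx (s, y)) has_real_derivative Txx t (x, y) - Sxx (x, y)) (at x)"
      "((\<lambda>s. T t (x, s) - S (x, s)) has_real_derivative Ty t (x, y) - Sy (x, y)) (at y within {0..pi})"
      "((\<lambda>s. Ty t (x, s) - Sy (x, s)) has_real_derivative Tyy t (x, y) - Syy (x, y)) (at y within {0..pi})"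
      if "t > 0" "y \<in> {0..pi}" for t x y
      using that by (auto intro!: DERIV_diff Tx Txx Ty Tyy Sx Sxx Sy Syy)
    show "Ty t (x, 0) - Sy (x, 0) = 0 \<and> Ty t (x, pi) - Sy (x, pi) = 0 \<or>
      T t (x, 0) - S (x, 0) = T t (x, pi) - S (x, pi) \<and> Ty t (x, 0) - Sy (x, 0) = Ty t (x, pi) - Sy (x, pi)"
      if "t > 0" for t x using bc that by auto
    show "c * L * (T t (x, y) - S (x, y)) \<le> Tt t (x, y)
        + a * (sin x * cos y * (Tx t (x, y) - Sx (x, y)) - cos x * sin y * (Ty t (x, y) - Sy (x, y)))
        - b * (Txx t (x, y) - Sxx (x, y) + (Tyy t (x, y) - Syy (x, y)))"
      if "t > 0" "y \<in> {0..pi}" "T t (x, y) - S (x, y) < 0" for t x y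
    proof -
      have "c * L * (T t (x, y) - S (x, y)) \<le> c * f (T t (x, y)) - c * f (S (x, y))"
        using that by (intro reaction_difference T_range S_range) auto
      then show ?thesis
        using eq[OF that(1,2), of x] subsolution[OF that(2), of x] by (simp add: algebra_simps)
    qed
  qed
  then show ?thesis by simp
qed

text \<open>Both T at time t + h and T at time t solve the equation, and they are ordered at t = 0
  because T at time h lies above the initial value.\<close>

lemma T_mono:
  assumes t: "t > 0" and h: "h > 0" and y: "y \<in> {0..pi}"
  shows "T t (x, y) \<le> T (t + h) (x, y)"
proof -
  have "T (t + h) (x, y) - T t (x, y) \<ge> 0"
  proof (rule comparison[where W = "\<lambda>t p. T (t + h) p - T t p" and Wx = "\<lambda>t p. Tx (t + h) p - Tx t p"
        and Wy = "\<lambda>t p. Ty (t + h) p - Ty t p" and Wxx = "\<lambda>t p. Txx (t + h) p - Txx t p"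
        and Wyy = "\<lambda>t p. Tyy (t + h) p - Tyy t p" and Wt = "\<lambda>t p. Tt (t + h) p - Tt t p",
        OF _ _ _ _ _ _ _ _ _ _ t y])
    have "continuous_on ({0..} \<times> (UNIV \<times> {0..pi})) (\<lambda>q. (\<lambda>(t, p). T t p) (fst q + h, snd q))"
      by (rule continuous_on_compose2[OF cont_T]) (use h in \<open>auto intro!: continuous_intros\<close>)
    then have "continuous_on ({0..} \<times> (UNIV \<times> {0..pi})) (\<lambda>q. T (fst q + h) (snd q) - T (fst q) (snd q))"
      using cont_T by (auto simp: case_prod_beta' intro!: continuous_intros)
    then show "continuous_on ({0..} \<times> (UNIV \<times> {0..pi})) (\<lambda>(t, p). T (t + h) p - T t p)"
      by (simp add: case_prod_beta')
    show "T (t + h) (x, y) - T t (x, y) \<ge> - 1" if "t \<ge> 0" "y \<in> {0..pi}" for t x y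
      using T_range[OF that, of x] T_range[of "t + h" y x] that h by simp
    show "T (0 + h) (x, y) - T 0 (x, y) \<ge> 0" if "y \<in> {0..pi}" for x y
      using above_initial[OF h that, of x] init[OF that, of x] by simp
    show "((\<lambda>s. T (s + h) (x, y) - T s (x, y)) has_real_derivative Tt (t + h) (x, y) - Tt t (x, y)) (at t)"
      if "t > 0" "y \<in> {0..pi}" for t x y
    proof -
      have "((\<lambda>s. T (s + h) (x, y)) has_real_derivative Tt (t + h) (x, y)) (at t)"
        using Tt[of "t + h" y x] that h by (simp add: DERIV_shift)
      from DERIV_diff[OF this Tt[OF that]] show ?thesis .
    qed
    show "((\<lambda>s. T (t + h) (s, y) - T t (s, y)) has_real_derivative Tx (t + h) (x, y) - Tx t (x, y)) (at x)"
      "((\<lambda>s. Tx (t + h) (s, y) - Tx t (s, y)) has_real_derivative Txx (t + h) (x, y) - Txx t (x, y)) (at x)"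
      "((\<lambda>s. T (t + h) (x, s) - T t (x, s)) has_real_derivative Ty (t + h) (x, y) - Ty t (x, y)) (at y within {0..pi})"
      "((\<lambda>s. Ty (t + h) (x, s) - Ty t (x, s)) has_real_derivative Tyy (t + h) (x, y) - Tyy t (x, y)) (at y within {0..pi})"
      if "t > 0" "y \<in> {0..pi}" for t x y
      using that h by (auto intro!: DERIV_diff Tx Txx Ty Tyy)
    show "Ty (t + h) (x, 0) - Ty t (x, 0) = 0 \<and> Ty (t + h) (x, pi) - Ty t (x, pi) = 0 \<or>
      T (t + h) (x, 0) - T t (x, 0) = T (t + h) (x, pi) - T t (x, pi) \<and>
      Ty (t + h) (x, 0) - Ty t (x, 0) = Ty (t + h) (x, pi) - Ty t (x, pi)"
      if "t > 0" for t x using bc that h by auto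
    show "c * L * (T (t + h) (x, y) - T t (x, y)) \<le> Tt (t + h) (x, y) - Tt t (x, y)
        + a * (sin x * cos y * (Tx (t + h) (x, y) - Tx t (x, y)) - cos x * sin y * (Ty (t + h) (x, y) - Ty t (x, y)))
        - b * (Txx (t + h) (x, y) - Txx t (x, y) + (Tyy (t + h) (x, y) - Tyy t (x, y)))"
      if "t > 0" "y \<in> {0..pi}" "T (t + h) (x, y) - T t (x, y) < 0" for t x y
    proof -
      have th: "t + h > 0" using that h by simp
      have "c * L * (T (t + h) (x, y) - T t (x, y)) \<le> c * f (T (t + h) (x, y)) - c * f (T t (x, y))"
        using that th by (intro reaction_difference T_range) auto
      then show ?thesis
        using eq[OF that(1,2), of x] eq[OF th that(2), of x] by (simp add: algebra_simps)
    qed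
  qed
  then show ?thesis by simp
qed

lemma Tt_nonneg:
  assumes t: "t > 0" and y: "y \<in> {0..pi}"
  shows "Tt t (x, y) \<ge> 0"
proof (rule derivative_nonneg_at_min_right[OF Tt[OF assms], of "t + 1"])
  show "T t (x, y) \<le> T s (x, y)" if "s \<in> {t..t + 1}" for s
    using T_mono[OF t, of "s - t" y x] y that by (cases "s = t") auto
qed auto

text \<open>The exponential is a supersolution: its rate pays a \<mu> for transport, b \<mu>^2 for
  diffusion and c L for f(s) \<le> L s.\<close>

lemma T_decay_right:
  assumes t: "t > 0" and y: "y \<in> {0..pi}"
  shows "T t (x, y) \<le> K * exp (- \<mu> * x + (a * \<mu> + b * \<mu>\<^sup>2 + c * L) * t)"
proof -
  define \<Lambda> where "\<Lambda> = a * \<mu> + b * \<mu>\<^sup>2 + c * L"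
  define G where "G = (\<lambda>t (p :: real \<times> real). K * exp (- \<mu> * fst p + \<Lambda> * t) :: real)"
  have G0: "G t p \<ge> 0" for t and p :: "real \<times> real" using pos by (simp add: G_def)
  have "G t (x, y) - T t (x, y) \<ge> 0"
  proof (rule comparison[where W = "\<lambda>t p. G t p - T t p" and Wx = "\<lambda>t p. - \<mu> * G t p - Tx t p"
        and Wy = "\<lambda>t p. - Ty t p" and Wxx = "\<lambda>t p. \<mu>\<^sup>2 * G t p - Txx t p"
        and Wyy = "\<lambda>t p. - Tyy t p" and Wt = "\<lambda>t p. \<Lambda> * G t p - Tt t p", OF _ _ _ _ _ _ _ _ _ _ t y])
    have "continuous_on ({0..} \<times> (UNIV \<times> {0..pi})) (\<lambda>q. G (fst q) (snd q) - T (fst q) (snd q))"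
      using cont_T unfolding G_def by (auto simp: case_prod_beta' intro!: continuous_intros)
    then show "continuous_on ({0..} \<times> (UNIV \<times> {0..pi})) (\<lambda>(t, p). G t p - T t p)"
      by (simp add: case_prod_beta')
    show "G t (x, y) - T t (x, y) \<ge> - 1" if "t \<ge> 0" "y \<in> {0..pi}" for t x y
      using T_range[OF that, of x] G0[of t "(x, y)"] by simp
    show "G 0 (x, y) - T 0 (x, y) \<ge> 0" if "y \<in> {0..pi}" for x y
      using init[OF that] decay_right[OF that, of x] by (simp add: G_def)
    show "((\<lambda>s. G s (x, y) - T s (x, y)) has_real_derivative \<Lambda> * G t (x, y) - Tt t (x, y)) (at t)"
      if "t > 0" "y \<in> {0..pi}" for t x y
      unfolding G_def by (auto intro!: derivative_eq_intros Tt that)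
    show "((\<lambda>s. G t (s, y) - T t (s, y)) has_real_derivative - \<mu> * G t (x, y) - Tx t (x, y)) (at x)"
      if "t > 0" "y \<in> {0..pi}" for t x y
      unfolding G_def by (auto intro!: derivative_eq_intros Tx that)
    show "((\<lambda>s. - \<mu> * G t (s, y) - Tx t (s, y)) has_real_derivative \<mu>\<^sup>2 * G t (x, y) - Txx t (x, y)) (at x)"
      if "t > 0" "y \<in> {0..pi}" for t x y
      unfolding G_def by (auto intro!: derivative_eq_intros Txx that simp: power2_eq_square)
    show "((\<lambda>s. G t (x, s) - T t (x, s)) has_real_derivative - Ty t (x, y)) (at y within {0..pi})"
      if "t > 0" "y \<in> {0..pi}" for t x y
      unfolding G_def by (auto intro!: derivative_eq_intros Ty that)
    show "((\<lambda>s. - Ty t (x, s)) has_real_derivative - Tyy t (x, y)) (at y within {0..pi})"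
      if "t > 0" "y \<in> {0..pi}" for t x y
      by (intro DERIV_minus Tyy that)
    show "- Ty t (x, 0) = 0 \<and> - Ty t (x, pi) = 0 \<or>
      G t (x, 0) - T t (x, 0) = G t (x, pi) - T t (x, pi) \<and> - Ty t (x, 0) = - Ty t (x, pi)"
      if "t > 0" for t x using bc that by (auto simp: G_def)
    show "c * L * (G t (x, y) - T t (x, y)) \<le> \<Lambda> * G t (x, y) - Tt t (x, y)
        + a * (sin x * cos y * (- \<mu> * G t (x, y) - Tx t (x, y)) - cos x * sin y * - Ty t (x, y))
        - b * (\<mu>\<^sup>2 * G t (x, y) - Txx t (x, y) + - Tyy t (x, y))"
      if "t > 0" "y \<in> {0..pi}" for t x y
    proof -
      have "f (T t (x, y)) \<le> L * T t (x, y)"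
        using f_lipschitz[of "T t (x, y)" 0] T_range[of t y x] that f0 by auto
      then have fT: "c * f (T t (x, y)) \<le> c * (L * T t (x, y))" using pos by simp
      have "\<bar>sin x * cos y\<bar> \<le> 1" by (simp add: abs_mult mult_le_one)
      then have "(a * \<mu> * G t (x, y)) * (sin x * cos y) \<le> (a * \<mu> * G t (x, y)) * 1"
        using pos G0[of t "(x, y)"] by (intro mult_left_mono) auto
      then show ?thesis using fT eq[OF that, of x] by (simp add: \<Lambda>_def algebra_simps)
    qed
  qed
  then show ?thesis by (simp add: G_def \<Lambda>_def)
qed

text \<open>For 1 - T the reaction has the favourable sign; the rate of the right tail is kept so
  that one constant serves both tails.\<close>

lemma T_decay_left:
  assumes t: "t > 0" and y: "y \<in> {0..pi}"
  shows "1 - T t (x, y) \<le> K * exp (\<mu> * x + (a * \<mu> + b * \<mu>\<^sup>2 + c * L) * t)"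
proof -
  define \<Lambda> where "\<Lambda> = a * \<mu> + b * \<mu>\<^sup>2 + c * L"
  define G where "G = (\<lambda>t (p :: real \<times> real). K * exp (\<mu> * fst p + \<Lambda> * t) :: real)"
  have G0: "G t p \<ge> 0" for t and p :: "real \<times> real" using pos by (simp add: G_def)
  have "G t (x, y) + T t (x, y) - 1 \<ge> 0"
  proof (rule comparison[where W = "\<lambda>t p. G t p + T t p - 1" and Wx = "\<lambda>t p. \<mu> * G t p + Tx t p"
        and Wy = Ty and Wxx = "\<lambda>t p. \<mu>\<^sup>2 * G t p + Txx t p"
        and Wyy = Tyy and Wt = "\<lambda>t p. \<Lambda> * G t p + Tt t p", OF _ _ _ _ _ _ _ _ _ _ t y])
    have "continuous_on ({0..} \<times> (UNIV \<times> {0..pi})) (\<lambda>q. G (fst q) (snd q) + T (fst q) (snd q) - 1)"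
      using cont_T unfolding G_def by (auto simp: case_prod_beta' intro!: continuous_intros)
    then show "continuous_on ({0..} \<times> (UNIV \<times> {0..pi})) (\<lambda>(t, p). G t p + T t p - 1)"
      by (simp add: case_prod_beta')
    show "G t (x, y) + T t (x, y) - 1 \<ge> - 1" if "t \<ge> 0" "y \<in> {0..pi}" for t x y
      using T_range[OF that, of x] G0[of t "(x, y)"] by simp
    show "G 0 (x, y) + T 0 (x, y) - 1 \<ge> 0" if "y \<in> {0..pi}" for x y
      using init[OF that] decay_left[OF that, of x] by (simp add: G_def)
    show "((\<lambda>s. G s (x, y) + T s (x, y) - 1) has_real_derivative \<Lambda> * G t (x, y) + Tt t (x, y)) (at t)"
      if "t > 0" "y \<in> {0..pi}" for t x y
      unfolding G_def by (auto intro!: derivative_eq_intros Tt that)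
    show "((\<lambda>s. G t (s, y) + T t (s, y) - 1) has_real_derivative \<mu> * G t (x, y) + Tx t (x, y)) (at x)"
      if "t > 0" "y \<in> {0..pi}" for t x y
      unfolding G_def by (auto intro!: derivative_eq_intros Tx that)
    show "((\<lambda>s. \<mu> * G t (s, y) + Tx t (s, y)) has_real_derivative \<mu>\<^sup>2 * G t (x, y) + Txx t (x, y)) (at x)"
      if "t > 0" "y \<in> {0..pi}" for t x y
      unfolding G_def by (auto intro!: derivative_eq_intros Txx that simp: power2_eq_square)
    show "((\<lambda>s. G t (x, s) + T t (x, s) - 1) has_real_derivative Ty t (x, y)) (at y within {0..pi})"
      if "t > 0" "y \<in> {0..pi}" for t x y
      unfolding G_def by (auto intro!: derivative_eq_intros Ty that)
    show "((\<lambda>s. Ty t (x, s)) has_real_derivative Tyy t (x, y)) (at y within {0..pi})"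
      if "t > 0" "y \<in> {0..pi}" for t x y
      by (intro Tyy that)
    show "Ty t (x, 0) = 0 \<and> Ty t (x, pi) = 0 \<or>
      G t (x, 0) + T t (x, 0) - 1 = G t (x, pi) + T t (x, pi) - 1 \<and> Ty t (x, 0) = Ty t (x, pi)"
      if "t > 0" for t x using bc that by (auto simp: G_def)
    show "c * L * (G t (x, y) + T t (x, y) - 1) \<le> \<Lambda> * G t (x, y) + Tt t (x, y)
        + a * (sin x * cos y * (\<mu> * G t (x, y) + Tx t (x, y)) - cos x * sin y * Ty t (x, y))
        - b * (\<mu>\<^sup>2 * G t (x, y) + Txx t (x, y) + Tyy t (x, y))"
      if "t > 0" "y \<in> {0..pi}" "G t (x, y) + T t (x, y) - 1 < 0" for t x y
    proof -
      have fT: "c * f (T t (x, y)) \<ge> 0" using f_nonneg T_range[of t y x] that pos by simp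
      have "c * L * (G t (x, y) + T t (x, y) - 1) \<le> 0"
        using that(3) pos by (intro mult_nonneg_nonpos) auto
      moreover have "\<bar>sin x * cos y\<bar> \<le> 1" by (simp add: abs_mult mult_le_one)
      then have "(a * \<mu> * G t (x, y)) * - (sin x * cos y) \<le> (a * \<mu> * G t (x, y)) * 1"
        using pos G0[of t "(x, y)"] by (intro mult_left_mono) auto
      moreover have "c * L * G t (x, y) \<ge> 0" using pos G0[of t "(x, y)"] by simp
      moreover have "Tt t (x, y) + a * (sin x * cos y * Tx t (x, y) - cos x * sin y * Ty t (x, y))
          - b * (Txx t (x, y) + Tyy t (x, y)) \<ge> 0"
        using fT eq[OF that(1,2), of x] by simp
      moreover have "\<Lambda> * G t (x, y) + Tt t (x, y)
          + a * (sin x * cos y * (\<mu> * G t (x, y) + Tx t (x, y)) - cos x * sin y * Ty t (x, y))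
          - b * (\<mu>\<^sup>2 * G t (x, y) + Txx t (x, y) + Tyy t (x, y)) =
        (Tt t (x, y) + a * (sin x * cos y * Tx t (x, y) - cos x * sin y * Ty t (x, y))
          - b * (Txx t (x, y) + Tyy t (x, y))) + c * L * G t (x, y)
          + ((a * \<mu> * G t (x, y)) * 1 - (a * \<mu> * G t (x, y)) * - (sin x * cos y))"
        by (simp add: \<Lambda>_def algebra_simps)
      ultimately show ?thesis by linarith
    qed
  qed
  then show ?thesis by (simp add: G_def \<Lambda>_def)
qed

lemma profile:
  assumes t: "t > 0"
  shows "cellular_profile a b c L (K * exp ((a * \<mu> + b * \<mu>\<^sup>2 + c * L) * t)) \<mu> f (T t) (Tx t) (Ty t) (Txx t) (Tyy t) (Tt t)"
proof
  fix x y :: real assume y: "y \<in> {0..pi}"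
  show "T t (x, y) \<le> K * exp ((a * \<mu> + b * \<mu>\<^sup>2 + c * L) * t) * exp (- \<mu> * x)"
    using T_decay_right[OF t y, of x] unfolding exp_add by (simp only: mult_ac)
  show "1 - T t (x, y) \<le> K * exp ((a * \<mu> + b * \<mu>\<^sup>2 + c * L) * t) * exp (\<mu> * x)"
    using T_decay_left[OF t y, of x] unfolding exp_add by (simp only: mult_ac)
next
  fix x
  show "Ty t (x, 0) = 0 \<and> Ty t (x, pi) = 0 \<or> T t (x, 0) = T t (x, pi) \<and> Ty t (x, 0) = Ty t (x, pi)"
    using bc t by auto
qed (use pos cont[OF t] continuous_T[OF t] Tx[OF t] Txx[OF t] Ty[OF t] Tyy[OF t] f_nonneg f0 f1 f_lipschitz
      T_range[of t] t Tt_nonneg[OF t] eq[OF t] in \<open>simp_all\<close>)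

end

section \<open>Rescaling\<close>

text \<open>Monotone convergence along growing windows; B keeps the limit finite, so the integral is
  not the default value 0.\<close>

lemma strip_set_integral:
  fixes w :: "real \<times> real \<Rightarrow> real"
  assumes cont: "continuous_on (UNIV \<times> {0..pi}) w"
    and nonneg: "\<And>x y. y \<in> {0..pi} \<Longrightarrow> w (x, y) \<ge> 0"
    and B: "\<And>x1 x2. integral ({x1..x2} \<times> {0..pi}) w \<le> B"
  shows "integral ({x1..x2} \<times> {0..pi}) w \<le> (LINT p:UNIV \<times> {0..pi}|lborel. w p)"
proof -
  define E where "E = (\<lambda>r::real. {-r..r} \<times> {0..pi})"
  have cE: "continuous_on (E r) w" for r
    unfolding E_def by (rule continuous_on_subset[OF cont]) auto
  have intE: "set_integrable lborel (E r) w" for r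
    unfolding set_integrable_def
    by (rule borel_integrable_compact[OF _ cE]) (auto simp: E_def intro!: compact_Times)
  have LE: "(LINT p:E r|lborel. w p) = integral (E r) w" for r
    by (rule set_borel_integral_eq_integral(2)[OF intE])
  have mono: "integral (E r) w \<le> integral (E s) w" if "r \<le> s" for r s
    unfolding E_def by (rule rect_subset_le[OF cE[unfolded E_def]]) (use that nonneg in auto)
  obtain V where V: "(\<lambda>n. integral (E (real n)) w) \<longlonglongrightarrow> V" "\<And>n. integral (E (real n)) w \<le> V"
    using incseq_convergent[of "\<lambda>n. integral (E (real n)) w" B] B mono
    by (auto simp: incseq_def E_def)
  have "integral\<^sup>L lborel (\<lambda>p. indicator (UNIV \<times> {0..pi}) p *\<^sub>R w p) = V"
  proof (rule integral_monotone_convergence_nonneg(2))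
    show "integrable lborel (\<lambda>p. indicator (E (real n)) p *\<^sub>R w p)" for n
      using intE by (simp add: set_integrable_def)
    show "AE p in lborel. mono (\<lambda>n. indicator (E (real n)) p *\<^sub>R w p)"
    proof (intro AE_I2 monoI)
      fix p :: "real \<times> real" and m n :: nat assume "m \<le> n"
      then show "indicator (E (real m)) p *\<^sub>R w p \<le> indicator (E (real n)) p *\<^sub>R w p"
        using nonneg by (cases p) (auto simp: indicator_def E_def)
    qed
    show "AE p in lborel. 0 \<le> indicator (E (real n)) p *\<^sub>R w p" for n
      using nonneg by (intro AE_I2) (auto simp: indicator_def E_def)
    show "AE p in lborel. (\<lambda>n. indicator (E (real n)) p *\<^sub>R w p)
        \<longlonglongrightarrow> indicator (UNIV \<times> {0..pi}) p *\<^sub>R w p"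
    proof (intro AE_I2)
      fix p :: "real \<times> real"
      obtain N :: nat where N: "\<bar>fst p\<bar> \<le> real N" using real_arch_simple by blast
      have "\<forall>\<^sub>F n in sequentially. indicator (E (real n)) p *\<^sub>R w p = indicator (UNIV \<times> {0..pi}) p *\<^sub>R w p"
      proof (rule eventually_sequentiallyI[of N])
        fix n assume "N \<le> n"
        then have "\<bar>fst p\<bar> \<le> real n" using N by linarith
        then show "indicator (E (real n)) p *\<^sub>R w p = indicator (UNIV \<times> {0..pi}) p *\<^sub>R w p"
          by (cases p) (auto simp: indicator_def E_def)
      qed
      then show "(\<lambda>n. indicator (E (real n)) p *\<^sub>R w p) \<longlonglongrightarrow> indicator (UNIV \<times> {0..pi}) p *\<^sub>R w p"
        by (rule tendsto_eventually)
    qed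
    show "(\<lambda>n. integral\<^sup>L lborel (\<lambda>p. indicator (E (real n)) p *\<^sub>R w p)) \<longlonglongrightarrow> V"
      using V(1) LE by (simp add: set_lebesgue_integral_def)
    have "UNIV \<times> {0..pi} \<in> sets (borel :: (real \<times> real) measure)"
      by (intro borel_closed closed_Times) auto
    from borel_measurable_continuous_on_indicator[OF this cont]
    show "(\<lambda>p. indicator (UNIV \<times> {0..pi}) p *\<^sub>R w p) \<in> borel_measurable lborel" by simp
  qed
  then have "(LINT p:UNIV \<times> {0..pi}|lborel. w p) = V" by (simp add: set_lebesgue_integral_def)
  moreover obtain N :: nat where N: "max \<bar>x1\<bar> \<bar>x2\<bar> \<le> real N" using real_arch_simple by blast
  have "integral ({x1..x2} \<times> {0..pi}) w \<le> integral (E (real N)) w"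
    unfolding E_def by (rule rect_subset_le[OF cE[unfolded E_def]]) (use N nonneg in auto)
  ultimately show ?thesis using V(2)[of N] by linarith
qed

lemma lborel_integral_dilation:
  fixes u :: "real \<times> real \<Rightarrow> real"
  assumes "H > 0" and [measurable]: "u \<in> borel_measurable borel"
  shows "integral\<^sup>L lborel u = H\<^sup>2 * integral\<^sup>L lborel (\<lambda>p. u (H *\<^sub>R p))"
proof -
  have "integral\<^sup>L lborel u =
      integral\<^sup>L (density (distr lborel borel (\<lambda>x::real \<times> real. 0 + H *\<^sub>R x)) (\<lambda>_. \<bar>H\<bar> ^ DIM(real \<times> real))) u"
    using lborel_affine[of H "0 :: real \<times> real"] assms(1) by simp
  also have "\<dots> = H\<^sup>2 * integral\<^sup>L lborel (\<lambda>p. u (H *\<^sub>R p))"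
    by (subst integral_density) (auto simp: integral_distr power2_eq_square)
  finally show ?thesis .
qed

lemma reaction_lipschitz:
  assumes "reaction f"
  obtains L where "L \<ge> 0" "\<And>s r. s \<in> {0..1} \<Longrightarrow> r \<in> {0..1} \<Longrightarrow> \<bar>f s - f r\<bar> \<le> L * \<bar>s - r\<bar>"
proof -
  obtain f' where f': "continuous_on {0..1} f'"
    "\<And>s. s \<in> {0..1} \<Longrightarrow> (f has_real_derivative f' s) (at s within {0..1})"
    using assms by (auto simp: reaction_def)
  have "compact (f' ` {0..1})" by (rule compact_continuous_image[OF f'(1)]) simp
  then obtain B where "\<And>z. z \<in> f' ` {0..1} \<Longrightarrow> norm z \<le> B"
    using compact_imp_bounded[of "f' ` {0..1}"] unfolding bounded_iff by blast
  then have B: "\<And>s. s \<in> {0..1} \<Longrightarrow> norm (f' s) \<le> B" by blast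
  have "B \<ge> 0" using B[of 0] norm_ge_zero[of "f' 0"] by (auto intro: order_trans)
  moreover have "\<bar>f s - f r\<bar> \<le> B * \<bar>s - r\<bar>" if "s \<in> {0..1}" "r \<in> {0..1}" for s r
    using field_differentiable_bound[OF _ f'(2) B that] by auto
  ultimately show ?thesis by (rule that)
qed

lemma DERIV_dilate_x:
  assumes "(\<lambda>s. g s y) differentiable (at (H * x))"
  shows "((\<lambda>s. g (H * s) y) has_real_derivative H * dx g (H * x) y) (at x)"
proof -
  have "((\<lambda>s. g s y) has_real_derivative dx g (H * x) y) (at (H * x))"
    using assms by (simp add: dx_def DERIV_deriv_iff_real_differentiable)
  then have "((\<lambda>s. g (H * s) y) has_real_derivative dx g (H * x) y * H) (at x)"
    by (rule DERIV_chain2[where f = "\<lambda>s. g s y"]) (auto intro!: derivative_eq_intros)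
  then show ?thesis by (simp add: mult.commute)
qed

lemma DERIV_dilate_y:
  assumes "(\<lambda>s. g x s) differentiable (at (H * y) within {0..pi * H})" "H > 0"
  shows "((\<lambda>s. g x (H * s)) has_real_derivative H * dy H g x (H * y)) (at y within {0..pi})"
proof -
  have "((\<lambda>s. g x s) has_real_derivative dy H g x (H * y)) (at (H * y) within {0..pi * H})"
    using assms(1) by (simp add: dy_def has_real_derivative_iff_has_vector_derivative vector_derivative_works)
  then have "((\<lambda>s. g x s) has_real_derivative dy H g x (H * y)) (at (H * y) within (\<lambda>s. H * s) ` {0..pi})"
    by (rule DERIV_subset) (use assms(2) in \<open>auto simp: mult.commute[of H]\<close>)
  then have "(((\<lambda>s. g x s) \<circ> (\<lambda>s. H * s)) has_real_derivative dy H g x (H * y) * H) (at y within {0..pi})"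
    by (rule DERIV_image_chain) (auto intro!: derivative_eq_intros)
  then show ?thesis by (simp add: o_def mult.commute)
qed

lemma strip_dilate: "H > 0 \<Longrightarrow> (H * x, H * y) \<in> strip H \<longleftrightarrow> y \<in> {0..pi}"
  by (auto simp: strip_def mult.commute[of H] zero_le_mult_iff)

lemma twice_differentiable_dilate:
  assumes "twice_differentiable_strip H g" "H > 0" "y \<in> {0..pi}"
  shows "((\<lambda>s. g (H * s) (H * y)) has_real_derivative H * dx g (H * x) (H * y)) (at x)"
    "((\<lambda>s. H * dx g (H * s) (H * y)) has_real_derivative H * (H * dx (dx g) (H * x) (H * y))) (at x)"
    "((\<lambda>s. g (H * x) (H * s)) has_real_derivative H * dy H g (H * x) (H * y)) (at y within {0..pi})"
    "((\<lambda>s. H * dy H g (H * x) (H * s)) has_real_derivative H * (H * dy H (dy H g) (H * x) (H * y)))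
      (at y within {0..pi})"
proof -
  have d: "(\<lambda>s. g s (H * y)) differentiable (at (H * x))"
      "(\<lambda>s. dx g s (H * y)) differentiable (at (H * x))"
      "(\<lambda>s. g (H * x) s) differentiable (at (H * y) within {0..pi * H})"
      "(\<lambda>s. dy H g (H * x) s) differentiable (at (H * y) within {0..pi * H})"
    using assms(1) strip_dilate[OF assms(2), of x y] assms(3)
    unfolding twice_differentiable_strip_def by auto
  show "((\<lambda>s. g (H * s) (H * y)) has_real_derivative H * dx g (H * x) (H * y)) (at x)"
    "((\<lambda>s. H * dx g (H * s) (H * y)) has_real_derivative H * (H * dx (dx g) (H * x) (H * y))) (at x)"
    "((\<lambda>s. g (H * x) (H * s)) has_real_derivative H * dy H g (H * x) (H * y)) (at y within {0..pi})"
    "((\<lambda>s. H * dy H g (H * x) (H * s)) has_real_derivative H * (H * dy H (dy H g) (H * x) (H * y)))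
      (at y within {0..pi})"
    using DERIV_dilate_x[where g = g, OF d(1)] DERIV_cmult[OF DERIV_dilate_x[where g = "dx g", OF d(2)]]
      DERIV_dilate_y[where g = g and x = "H * x", OF d(3) assms(2)]
      DERIV_cmult[OF DERIV_dilate_y[where g = "dy H g" and x = "H * x", OF d(4) assms(2)]] by auto
qed

lemma continuous_on_dilate:
  assumes "continuous_on (strip H) (\<lambda>(x, y). h x y)" "H > 0"
  shows "continuous_on (UNIV \<times> {0..pi}) (\<lambda>p. h (H * fst p) (H * snd p) :: real)"
proof -
  have "continuous_on (UNIV \<times> {0..pi}) (\<lambda>p. (\<lambda>(x, y). h x y) (H * fst p, H * snd p))"
    by (rule continuous_on_compose2[OF assms(1)])
      (use strip_dilate[OF assms(2)] in \<open>auto intro!: continuous_intros\<close>)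
  then show ?thesis by simp
qed

lemma continuous_on_dilate_time:
  assumes "continuous_on (strip H \<times> {0<..}) (\<lambda>((x, y), t). h x y t)" "H > 0" "t > 0"
  shows "continuous_on (UNIV \<times> {0..pi}) (\<lambda>p. h (H * fst p) (H * snd p) t :: real)"
proof -
  have "continuous_on (UNIV \<times> {0..pi}) (\<lambda>p. (\<lambda>((x, y), t). h x y t) ((H * fst p, H * snd p), t))"
    by (rule continuous_on_compose2[OF assms(1)])
      (use strip_dilate[OF assms(2)] assms(3) in \<open>auto intro!: continuous_intros\<close>)
  then show ?thesis by simp
qed

lemma dilated_equation:
  fixes H \<kappa> U c gx gy gxx gyy x y :: real
  assumes "H > 0"
  shows "cell_flow U H (H * x) (H * y) \<bullet> (gx, gy) =
      U / H * (sin x * cos y * (H * gx) - cos x * sin y * (H * gy))"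
    and "\<kappa> * (gxx + gyy) = \<kappa> / H\<^sup>2 * (H * (H * gxx) + H * (H * gyy))"
  using assms by (simp_all add: cell_flow_def inner_prod_def power2_eq_square field_simps)

lemma dilated_evolution:
  assumes f: "reaction f" and pos: "U > 0" "H > 0" "\<kappa> > 0" "v\<^sub>0 > 0"
    and bc: "bc = neumann_bc H \<or> bc = periodic_bc H"
    and adm: "admissible_initial_data f U H \<kappa> v\<^sub>0 bc T\<^sub>0"
    and sol: "solves_reaction_advection_diffusion f U H \<kappa> v\<^sub>0 bc T\<^sub>0 T"
  shows "\<exists>L K \<mu>. cellular_evolution (U / H) (\<kappa> / H\<^sup>2) (v\<^sub>0\<^sup>2 / \<kappa>) L K \<mu> f
    (\<lambda>t p. T (H * fst p) (H * snd p) t)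
    (\<lambda>t p. H * dx (\<lambda>x y. T x y t) (H * fst p) (H * snd p))
    (\<lambda>t p. H * dy H (\<lambda>x y. T x y t) (H * fst p) (H * snd p))
    (\<lambda>t p. H * (H * dx (dx (\<lambda>x y. T x y t)) (H * fst p) (H * snd p)))
    (\<lambda>t p. H * (H * dy H (dy H (\<lambda>x y. T x y t)) (H * fst p) (H * snd p)))
    (\<lambda>t p. dt T (H * fst p) (H * snd p) t)
    (\<lambda>p. T\<^sub>0 (H * fst p) (H * snd p))
    (\<lambda>p. H * dx T\<^sub>0 (H * fst p) (H * snd p)) (\<lambda>p. H * dy H T\<^sub>0 (H * fst p) (H * snd p))
    (\<lambda>p. H * (H * dx (dx T\<^sub>0) (H * fst p) (H * snd p)))
    (\<lambda>p. H * (H * dy H (dy H T\<^sub>0) (H * fst p) (H * snd p)))"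
proof -
  have C21: "C21_strip H T"
    and range: "\<And>x y t. (x, y) \<in> strip H \<Longrightarrow> t \<ge> 0 \<Longrightarrow> 0 \<le> T x y t \<and> T x y t \<le> 1"
    and eq: "\<And>x y t. (x, y) \<in> strip H \<Longrightarrow> t > 0 \<Longrightarrow>
      dt T x y t + cell_flow U H x y \<bullet> grad H (\<lambda>x y. T x y t) x y =
        \<kappa> * laplacian H (\<lambda>x y. T x y t) x y + v\<^sub>0\<^sup>2 / \<kappa> * f (T x y t)"
    and init: "\<And>x y. (x, y) \<in> strip H \<Longrightarrow> T x y 0 = T\<^sub>0 x y"
    and bcT: "\<And>t. t > 0 \<Longrightarrow> bc (\<lambda>x y. T x y t)"
    using sol unfolding solves_reaction_advection_diffusion_def by auto
  have cT: "continuous_on (strip H \<times> {0..}) (\<lambda>((x, y), t). T x y t)"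
    and dT: "\<And>t. t > 0 \<Longrightarrow> twice_differentiable_strip H (\<lambda>x y. T x y t)"
    and dtT: "\<And>x y t. (x, y) \<in> strip H \<Longrightarrow> t > 0 \<Longrightarrow> (\<lambda>s. T x y s) differentiable (at t)"
    and cTt: "continuous_on (strip H \<times> {0<..}) (\<lambda>((x, y), t). dt T x y t)"
    and cTx: "continuous_on (strip H \<times> {0<..}) (\<lambda>((x, y), t). dx (\<lambda>x y. T x y t) x y)"
    and cTy: "continuous_on (strip H \<times> {0<..}) (\<lambda>((x, y), t). dy H (\<lambda>x y. T x y t) x y)"
    and cTxx: "continuous_on (strip H \<times> {0<..}) (\<lambda>((x, y), t). dx (dx (\<lambda>x y. T x y t)) x y)"
    and cTyy: "continuous_on (strip H \<times> {0<..}) (\<lambda>((x, y), t). dy H (dy H (\<lambda>x y. T x y t)) x y)"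
    using C21 unfolding C21_strip_def by auto
  have C2: "C2_strip H T\<^sub>0" and bcS: "bc T\<^sub>0"
    and sub: "\<And>x y. (x, y) \<in> strip H \<Longrightarrow>
      \<kappa> * laplacian H T\<^sub>0 x y - cell_flow U H x y \<bullet> grad H T\<^sub>0 x y + v\<^sub>0\<^sup>2 / \<kappa> * f (T\<^sub>0 x y) \<ge> 0"
    using adm unfolding admissible_initial_data_def by auto
  obtain \<mu> C where \<mu>: "\<mu> > 0" and
    dec: "\<And>x y. (x, y) \<in> strip H \<Longrightarrow> x < 0 \<Longrightarrow> \<bar>1 - T\<^sub>0 x y\<bar> \<le> C * exp (\<mu> * x)"
      "\<And>x y. (x, y) \<in> strip H \<Longrightarrow> x > 0 \<Longrightarrow> \<bar>T\<^sub>0 x y\<bar> \<le> C * exp (- \<mu> * x)"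
    using adm unfolding admissible_initial_data_def by fastforce
  have dS: "twice_differentiable_strip H T\<^sub>0" and cS: "continuous_on (strip H) (\<lambda>(x, y). T\<^sub>0 x y)"
    using C2 unfolding C2_strip_def by auto
  obtain L where L: "L \<ge> 0" "\<And>s r. s \<in> {0..1} \<Longrightarrow> r \<in> {0..1} \<Longrightarrow> \<bar>f s - f r\<bar> \<le> L * \<bar>s - r\<bar>"
    using reaction_lipschitz[OF f] by blast
  have f0: "f 0 = 0" "f 1 = 0" using f by (auto simp: reaction_def)
  have f_nonneg: "f s \<ge> 0" if "s \<in> {0..1}" for s
  proof (cases "s = 0 \<or> s = 1")
    case False
    then have "s \<in> {0<..<1}" using that by auto
    then show ?thesis using f unfolding reaction_def by blast
  qed (use f0 in auto)
  note st = strip_dilate[OF pos(2), THEN iffD2]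
  \<comment> \<open>That the initial data lie in [0, 1] is read off from the solution at t =
    0.\<close>
  have S01: "0 \<le> T\<^sub>0 x y" "T\<^sub>0 x y \<le> 1" if "(x, y) \<in> strip H" for x y
    using range[OF that, of 0] init[OF that] by auto
  \<comment> \<open>K \<ge> 1 extends each exponential bound to the other half line, where its
    right-hand side is at least 1.\<close>
  define K where "K = max C 1"
  have K: "K \<ge> 1" "K \<ge> C" by (auto simp: K_def)
  have decR: "T\<^sub>0 x y \<le> K * exp (- \<mu> * x)" if "(x, y) \<in> strip H" for x y
  proof (cases "x > 0")
    case True
    then have "T\<^sub>0 x y \<le> C * exp (- \<mu> * x)" using dec(2)[OF that] by auto
    also have "\<dots> \<le> K * exp (- \<mu> * x)" using K by (intro mult_right_mono) auto
    finally show ?thesis .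
  next
    case False
    have "1 * 1 \<le> K * exp (- \<mu> * x)"
      using K False \<mu> by (intro mult_mono) (auto simp: mult_nonneg_nonpos)
    then show ?thesis using S01[OF that] by linarith
  qed
  have decL: "1 - T\<^sub>0 x y \<le> K * exp (\<mu> * x)" if "(x, y) \<in> strip H" for x y
  proof (cases "x < 0")
    case True
    then have "1 - T\<^sub>0 x y \<le> C * exp (\<mu> * x)" using dec(1)[OF that] by auto
    also have "\<dots> \<le> K * exp (\<mu> * x)" using K by (intro mult_right_mono) auto
    finally show ?thesis .
  next
    case False
    have "1 * 1 \<le> K * exp (\<mu> * x)"
      using K False \<mu> by (intro mult_mono) auto
    then show ?thesis using S01[OF that] by linarith
  qed
  have cT': "continuous_on ({0..} \<times> UNIV \<times> {0..pi}) (\<lambda>(t, p). T (H * fst p) (H * snd p) t)"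
  proof -
    have "continuous_on ({0..} \<times> (UNIV \<times> {0..pi}))
        (\<lambda>q. (\<lambda>((x, y), t). T x y t) ((H * fst (snd q), H * snd (snd q)), fst q))"
      by (rule continuous_on_compose2[OF cT]) (use st in \<open>auto intro!: continuous_intros\<close>)
    then show ?thesis by (simp add: case_prod_beta')
  qed
  have bc': "(\<forall>t>0. \<forall>x. H * dy H (\<lambda>x y. T x y t) (H * x) (H * 0) = 0 \<and> H * dy H (\<lambda>x y. T x y t) (H * x) (H * pi) = 0) \<and>
      (\<forall>x. H * dy H T\<^sub>0 (H * x) (H * 0) = 0 \<and> H * dy H T\<^sub>0 (H * x) (H * pi) = 0) \<or>
    (\<forall>t>0. \<forall>x. T (H * x) (H * 0) t = T (H * x) (H * pi) t \<and>
        H * dy H (\<lambda>x y. T x y t) (H * x) (H * 0) = H * dy H (\<lambda>x y. T x y t) (H * x) (H * pi)) \<and>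
      (\<forall>x. T\<^sub>0 (H * x) (H * 0) = T\<^sub>0 (H * x) (H * pi) \<and>
        H * dy H T\<^sub>0 (H * x) (H * 0) = H * dy H T\<^sub>0 (H * x) (H * pi))"
    using bc bcT bcS by (auto simp: neumann_bc_def periodic_bc_def mult.commute[of H pi])
  have eq': "dt T (H * x) (H * y) t + U / H * (sin x * cos y * (H * dx (\<lambda>x y. T x y t) (H * x) (H * y))
      - cos x * sin y * (H * dy H (\<lambda>x y. T x y t) (H * x) (H * y))) =
    \<kappa> / H\<^sup>2 * (H * (H * dx (dx (\<lambda>x y. T x y t)) (H * x) (H * y)) + H * (H * dy H (dy H (\<lambda>x y. T x y t)) (H * x) (H * y)))
      + v\<^sub>0\<^sup>2 / \<kappa> * f (T (H * x) (H * y) t)" if "t > 0" "y \<in> {0..pi}" for t x y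
    using eq[OF st[OF that(2), of x] that(1)]
    unfolding grad_def laplacian_def dilated_equation(1)[OF pos(2)]
      dilated_equation(2)[OF pos(2), of \<kappa> "dx (dx (\<lambda>x y. T x y t)) (H * x) (H * y)"
        "dy H (dy H (\<lambda>x y. T x y t)) (H * x) (H * y)"] .
  have sub': "0 \<le> \<kappa> / H\<^sup>2 * (H * (H * dx (dx T\<^sub>0) (H * x) (H * y)) + H * (H * dy H (dy H T\<^sub>0) (H * x) (H * y)))
      - U / H * (sin x * cos y * (H * dx T\<^sub>0 (H * x) (H * y)) - cos x * sin y * (H * dy H T\<^sub>0 (H * x) (H * y)))
      + v\<^sub>0\<^sup>2 / \<kappa> * f (T\<^sub>0 (H * x) (H * y))" if "y \<in> {0..pi}" for x y
    using sub[OF st[OF that, of x]]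
    unfolding grad_def laplacian_def dilated_equation(1)[OF pos(2)]
      dilated_equation(2)[OF pos(2), of \<kappa> "dx (dx T\<^sub>0) (H * x) (H * y)" "dy H (dy H T\<^sub>0) (H * x) (H * y)"] .
  have Tt': "((\<lambda>s. T (H * x) (H * y) s) has_real_derivative dt T (H * x) (H * y) t) (at t)"
    if "t > 0" "y \<in> {0..pi}" for t x y
    using dtT[OF st[OF that(2)] that(1)] by (simp add: dt_def DERIV_deriv_iff_real_differentiable)
  have dec': "T\<^sub>0 (H * x) (H * y) \<le> K * exp (- (\<mu> * H) * x)" "1 - T\<^sub>0 (H * x) (H * y) \<le> K * exp (\<mu> * H * x)"
    if "y \<in> {0..pi}" for x y
    using decR[OF st[OF that, of x]] decL[OF st[OF that, of x]] by (simp_all add: mult.assoc)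
  note cd = continuous_on_dilate_time[OF _ pos(2)]
  show ?thesis
    by (rule exI[of _ L], rule exI[of _ K], rule exI[of _ "\<mu> * H"], unfold_locales; (unfold fst_conv snd_conv)?;
      (intro continuous_on_mult_left)?; (rule L f0 f_nonneg cT' bc' eq' sub' Tt' dec' continuous_on_dilate[OF cS pos(2)]
        cd[OF cTx] cd[OF cTy] cd[OF cTxx] cd[OF cTyy] cd[OF cTt]
        twice_differentiable_dilate[OF dT pos(2)] twice_differentiable_dilate[OF dS pos(2)]; assumption?)?)
     (use pos K \<mu> range st init in auto)
qed

text \<open>The area element contributes H^2 and the definition of the rate 1 / H.\<close>

lemma bulk_burning_rate_dilated:
  assumes "H > 0" and cont: "continuous_on (strip H) (\<lambda>(x, y). dt T x y t)"
  shows "bulk_burning_rate H T t =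
    H * (LINT p:UNIV \<times> {0..pi}|lborel. dt T (H * fst p) (H * snd p) t)"
proof -
  define u where "u = (\<lambda>p. indicator (strip H) p *\<^sub>R (dt T (fst p) (snd p) t / H))"
  have "strip H \<in> sets borel" unfolding strip_def by (intro borel_closed closed_Times) auto
  moreover have "continuous_on (strip H) (\<lambda>p. dt T (fst p) (snd p) t / H)"
    using cont assms(1) by (auto simp: case_prod_beta' intro!: continuous_intros)
  ultimately have m: "u \<in> borel_measurable borel"
    unfolding u_def by (rule borel_measurable_continuous_on_indicator)
  have u: "u (H *\<^sub>R p) = 1 / H * (indicator (UNIV \<times> {0..pi}) p *\<^sub>R dt T (H * fst p) (H * snd p) t)" for p
    using strip_dilate[OF assms(1), of "fst p" "snd p"]
    by (cases p) (auto simp: u_def indicator_def)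
  have "bulk_burning_rate H T t = integral\<^sup>L lborel u"
    by (simp add: bulk_burning_rate_def set_lebesgue_integral_def u_def)
  also have "\<dots> = H\<^sup>2 * integral\<^sup>L lborel (\<lambda>p. u (H *\<^sub>R p))" by (rule lborel_integral_dilation[OF assms(1) m])
  also have "\<dots> = H\<^sup>2 * (1 / H * (LINT p:UNIV \<times> {0..pi}|lborel. dt T (H * fst p) (H * snd p) t))"
    unfolding u set_lebesgue_integral_def by simp
  finally show ?thesis using assms(1) by (simp add: power2_eq_square)
qed

theorem theorem7:
  fixes f\<^sub>0 \<zeta> \<delta> :: real
  assumes "f\<^sub>0 > 0" and "\<zeta> > 0" and "\<delta> > 0"
  shows "\<exists>C\<^sub>1>0. \<exists>C\<^sub>2>0.
    \<forall>(f :: real \<Rightarrow> real) \<theta>\<^sub>1 \<theta>\<^sub>4 U H \<kappa> v\<^sub>0 bc T\<^sub>0 T.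
      ignition_type f \<or> general_KPP_type f \<longrightarrow>
      \<theta>\<^sub>4 - \<theta>\<^sub>1 = \<delta> \<longrightarrow>
      {\<theta>\<^sub>1 - \<zeta> <..< \<theta>\<^sub>4 + \<zeta>} \<subseteq> {0..1} \<longrightarrow>
      (\<forall>\<theta>\<in>{\<theta>\<^sub>1 - \<zeta> <..< \<theta>\<^sub>4 + \<zeta>}. f \<theta> > f\<^sub>0) \<longrightarrow>
      U > 0 \<longrightarrow> H > 0 \<longrightarrow> \<kappa> > 0 \<longrightarrow> v\<^sub>0 > 0 \<longrightarrow>
      U * H / \<kappa> \<ge> 1 \<longrightarrow>
      (let l = \<kappa> / v\<^sub>0 in l / H \<le> 1) \<longrightarrow>
      bc = neumann_bc H \<or> bc = periodic_bc H \<longrightarrow>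
      admissible_initial_data f U H \<kappa> v\<^sub>0 bc T\<^sub>0 \<longrightarrow>
      solves_reaction_advection_diffusion f U H \<kappa> v\<^sub>0 bc T\<^sub>0 T \<longrightarrow>
      (let \<tau>\<^sub>c = \<kappa> / v\<^sub>0\<^sup>2; \<tau>\<^sub>u = H / U in
        \<forall>t>0.
          (\<tau>\<^sub>c \<le> \<tau>\<^sub>u \<longrightarrow>
             bulk_burning_rate H T t \<ge> (C\<^sub>1 * sqrt (\<tau>\<^sub>c / \<tau>\<^sub>u) + C\<^sub>2) * v\<^sub>0) \<and>
          (\<tau>\<^sub>c \<ge> \<tau>\<^sub>u \<longrightarrow>
             bulk_burning_rate H T t \<ge> (C\<^sub>1 * (\<tau>\<^sub>c / \<tau>\<^sub>u) powr (1 / 5) + C\<^sub>2) * v\<^sub>0))"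
proof -
  \<comment> \<open>The k of \<open>enhanced_bound\<close> with \<open>threshold\<close> written out
    for \<phi> = \<open>f\<^sub>0\<close>; it can be fixed before f.\<close>
  define k where "k = min 1 (min ((\<delta>\<^sup>2 / 2600\<^sup>2)\<^sup>2)
    (min 1 (min ((\<zeta> / 1000)\<^sup>2) f\<^sub>0) * \<delta>\<^sup>2 / (2 * 2600\<^sup>2)))"
  have k: "k > 0" using assms by (simp add: k_def)
  \<comment> \<open>One number serves as both constants; it is half of what the estimates give
    because each of them has to cover two summands.\<close>
  define C where "C = min (pi * sqrt f\<^sub>0 * \<delta>) (sqrt k / 3) / 2"
  have C: "C > 0" "2 * C \<le> pi * sqrt f\<^sub>0 * \<delta>" "2 * C \<le> sqrt k / 3"
    using assms k pi_gt_zero by (auto simp: C_def)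
  have main: "(\<kappa> / v\<^sub>0\<^sup>2 \<le> H / U \<longrightarrow>
        bulk_burning_rate H T t \<ge> (C * sqrt (\<kappa> / v\<^sub>0\<^sup>2 / (H / U)) + C) * v\<^sub>0) \<and>
      (\<kappa> / v\<^sub>0\<^sup>2 \<ge> H / U \<longrightarrow>
        bulk_burning_rate H T t \<ge> (C * (\<kappa> / v\<^sub>0\<^sup>2 / (H / U)) powr (1 / 5) + C) * v\<^sub>0)"
    if type: "ignition_type f \<or> general_KPP_type f" and \<delta>: "\<theta>\<^sub>4 - \<theta>\<^sub>1 = \<delta>"
      and sub: "{\<theta>\<^sub>1 - \<zeta> <..< \<theta>\<^sub>4 + \<zeta>} \<subseteq> {0..1}"
      and f_gt: "\<forall>\<theta>\<in>{\<theta>\<^sub>1 - \<zeta> <..< \<theta>\<^sub>4 + \<zeta>}. f \<theta> > f\<^sub>0"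
      and pos: "U > 0" "H > 0" "\<kappa> > 0" "v\<^sub>0 > 0"
      and l: "\<kappa> / v\<^sub>0 / H \<le> 1"
      and bc: "bc = neumann_bc H \<or> bc = periodic_bc H"
      and adm: "admissible_initial_data f U H \<kappa> v\<^sub>0 bc T\<^sub>0"
      and sol: "solves_reaction_advection_diffusion f U H \<kappa> v\<^sub>0 bc T\<^sub>0 T"
      and t: "t > 0"
    for f \<theta>\<^sub>1 \<theta>\<^sub>4 U H \<kappa> v\<^sub>0 bc T\<^sub>0 T t
  proof -
    let ?a = "U / H" and ?b = "\<kappa> / H\<^sup>2" and ?c = "v\<^sub>0\<^sup>2 / \<kappa>"
    define r where "r = \<kappa> / v\<^sub>0\<^sup>2 / (H / U)"
    have r: "r > 0" "r = ?a / ?c" using pos by (auto simp: r_def field_simps)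
    have rle: "\<kappa> / v\<^sub>0\<^sup>2 \<le> H / U \<longleftrightarrow> r \<le> 1" "\<kappa> / v\<^sub>0\<^sup>2 \<ge> H / U \<longleftrightarrow> r \<ge> 1"
    proof -
      have "H / U > 0" using pos by simp
      then show "\<kappa> / v\<^sub>0\<^sup>2 \<le> H / U \<longleftrightarrow> r \<le> 1" "\<kappa> / v\<^sub>0\<^sup>2 \<ge> H / U \<longleftrightarrow> r \<ge> 1"
        by (simp_all only: r_def divide_le_eq_1_pos le_divide_eq_1_pos)
    qed
    have "reaction f" using type by (auto simp: ignition_type_def general_KPP_type_def)
    from dilated_evolution[OF this pos bc adm sol] obtain L K \<mu> where
      ev: "cellular_evolution ?a ?b ?c L K \<mu> f
        (\<lambda>t p. T (H * fst p) (H * snd p) t)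
        (\<lambda>t p. H * dx (\<lambda>x y. T x y t) (H * fst p) (H * snd p))
        (\<lambda>t p. H * dy H (\<lambda>x y. T x y t) (H * fst p) (H * snd p))
        (\<lambda>t p. H * (H * dx (dx (\<lambda>x y. T x y t)) (H * fst p) (H * snd p)))
        (\<lambda>t p. H * (H * dy H (dy H (\<lambda>x y. T x y t)) (H * fst p) (H * snd p)))
        (\<lambda>t p. dt T (H * fst p) (H * snd p) t)
        (\<lambda>p. T\<^sub>0 (H * fst p) (H * snd p))
        (\<lambda>p. H * dx T\<^sub>0 (H * fst p) (H * snd p)) (\<lambda>p. H * dy H T\<^sub>0 (H * fst p) (H * snd p))
        (\<lambda>p. H * (H * dx (dx T\<^sub>0) (H * fst p) (H * snd p)))
        (\<lambda>p. H * (H * dy H (dy H T\<^sub>0) (H * fst p) (H * snd p)))" by blast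
    define w where "w = (\<lambda>p. dt T (H * fst p) (H * snd p) t)"
    note prof = cellular_evolution.profile[OF ev t, folded w_def]
    have cw: "continuous_on (UNIV \<times> {0..pi}) w" by (rule cellular_profile.cont(6)[OF prof])
    have w0: "w (x, y) \<ge> 0" if "y \<in> {0..pi}" for x y by (rule cellular_profile.w_nonneg[OF prof that])
    obtain B where B: "\<And>x1 x2. integral ({x1..x2} \<times> {0..pi}) w \<le> B"
      using cellular_profile.burning_rate_bounded[OF prof] by blast
    define V where "V = (LINT p:UNIV \<times> {0..pi}|lborel. w p)"
    have V: "integral ({x1..x2} \<times> {0..pi}) w \<le> V" for x1 x2
      unfolding V_def by (rule strip_set_integral[OF cw w0 B])
    have "continuous_on (strip H \<times> {0<..}) (\<lambda>((x, y), t). dt T x y t)"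
      using sol unfolding solves_reaction_advection_diffusion_def C21_strip_def by auto
    then have "continuous_on (strip H) (\<lambda>p. (\<lambda>((x, y), t). dt T x y t) (p, t))"
      by (rule continuous_on_compose2) (use t in \<open>auto intro!: continuous_intros\<close>)
    then have "continuous_on (strip H) (\<lambda>(x, y). dt T x y t)" by (simp add: case_prod_beta')
    from bulk_burning_rate_dilated[OF pos(2) this]
    have rate: "bulk_burning_rate H T t = H * V" by (simp add: V_def w_def)
    have front: "burning_front ?a ?b ?c L (K * exp ((?a * \<mu> + ?b * \<mu>\<^sup>2 + ?c * L) * t)) \<mu> f
      (\<lambda>p. T (H * fst p) (H * snd p) t)
      (\<lambda>p. H * dx (\<lambda>x y. T x y t) (H * fst p) (H * snd p))
      (\<lambda>p. H * dy H (\<lambda>x y. T x y t) (H * fst p) (H * snd p))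
      (\<lambda>p. H * (H * dx (dx (\<lambda>x y. T x y t)) (H * fst p) (H * snd p)))
      (\<lambda>p. H * (H * dy H (dy H (\<lambda>x y. T x y t)) (H * fst p) (H * snd p)))
      w f\<^sub>0 \<theta>\<^sub>1 \<theta>\<^sub>4 \<zeta> V"
      using prof assms \<delta> sub f_gt V
      by (auto intro!: burning_front.intro burning_front_axioms.intro)
    \<comment> \<open>The unit of both bounds: sqrt (b c) is the speed \<open>v\<^sub>0\<close>
      divided by H.\<close>
    have Hbc: "H * sqrt (?b * ?c) = v\<^sub>0"
    proof -
      have "?b * ?c = (v\<^sub>0 / H)\<^sup>2" using pos by (simp add: power2_eq_square field_simps)
      then show ?thesis using pos by simp
    qed
    have basic: "bulk_burning_rate H T t \<ge> 2 * C * v\<^sub>0"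
    proof -
      have "2 * C * v\<^sub>0 \<le> pi * sqrt f\<^sub>0 * \<delta> * v\<^sub>0" using C pos by (intro mult_right_mono) auto
      also have "\<dots> = H * (pi * sqrt (?b * ?c * f\<^sub>0) * \<delta>)"
        unfolding real_sqrt_mult[of "?b * ?c"] by (subst Hbc[symmetric]) simp
      also have "\<dots> \<le> H * V"
        using burning_front.basic_bound[OF front] \<delta> pos by (intro mult_left_mono) auto
      finally show ?thesis by (simp add: rate)
    qed
    have "bulk_burning_rate H T t \<ge> (C * sqrt r + C) * v\<^sub>0" if "r \<le> 1"
    proof -
      have "sqrt r \<le> 1" using that by simp
      then have "C * sqrt r \<le> C * 1" using C(1) by (intro mult_left_mono) auto
      then have "(C * sqrt r + C) * v\<^sub>0 \<le> 2 * C * v\<^sub>0" using pos by (intro mult_right_mono) auto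
      then show ?thesis using basic by linarith
    qed
    moreover have "bulk_burning_rate H T t \<ge> (C * r powr (1 / 5) + C) * v\<^sub>0" if "r \<ge> 1"
    proof -
      have "?c > 0" using pos by simp
      then have ca: "?c \<le> ?a" using that unfolding r(2) by (simp only: le_divide_eq_1_pos)
      \<comment> \<open>The condition l \<le> H, squared.\<close>
      have bc': "?b \<le> ?c"
      proof -
        have "(\<kappa> / v\<^sub>0 / H)\<^sup>2 \<le> 1\<^sup>2" using l pos by (intro power_mono) auto
        then have "\<kappa>\<^sup>2 \<le> v\<^sub>0\<^sup>2 * H\<^sup>2" using pos by (simp add: power_divide field_simps)
        then show ?thesis using pos by (simp add: field_simps power2_eq_square)
      qed
      \<comment> \<open>For r \<ge> 1 the constant summand is absorbed since 1 \<le> r^(1/5), and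
        the proved power 1/4 dominates the power 1/5.\<close>
      have p: "1 \<le> r powr (1 / 5)" "r powr (1 / 5) \<le> r powr (1 / 4)"
        using that by (auto intro: ge_one_powr_ge_zero powr_mono)
      have "C * 1 \<le> C * r powr (1 / 5)" using p(1) C(1) by (intro mult_left_mono) auto
      then have "(C * r powr (1 / 5) + C) * v\<^sub>0 \<le> (2 * C * r powr (1 / 5)) * v\<^sub>0"
        using pos by (intro mult_right_mono) auto
      also have "\<dots> \<le> (sqrt k / 3 * r powr (1 / 4)) * v\<^sub>0"
        using C p pos k by (intro mult_right_mono mult_mono) auto
      also have "\<dots> = H * (?b * (sqrt k / 3) * sqrt (?c / ?b) * (?a / ?c) powr (1 / 4))"
      proof -
        have "\<beta> * sqrt (\<gamma> / \<beta>) = sqrt (\<beta> * \<gamma>)" if "\<beta> > 0" for \<beta> \<gamma> :: real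
        proof -
          have "\<beta> * \<gamma> = \<beta>\<^sup>2 * (\<gamma> / \<beta>)" using that by (simp add: power2_eq_square)
          then show ?thesis using that by (simp only: real_sqrt_mult real_sqrt_abs abs_of_pos)
        qed
        from this[of ?b ?c] have "v\<^sub>0 = H * (?b * sqrt (?c / ?b))" using Hbc pos by simp
        moreover have "sqrt k / 3 * P * v = H * (\<beta> * (sqrt k / 3) * s * P)" if "v = H * (\<beta> * s)" for P v \<beta> s
          by (simp add: that)
        ultimately show ?thesis unfolding r(2) by blast
      qed
      also have "\<dots> \<le> H * V"
      proof (rule mult_left_mono)
        show "?b * (sqrt k / 3) * sqrt (?c / ?b) * (?a / ?c) powr (1 / 4) \<le> V"
          using burning_front.enhanced_bound[OF front bc' ca]
          unfolding burning_front.threshold_def[OF front bc' ca] \<delta> k_def .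
      qed (use pos in auto)
      finally show ?thesis by (simp add: rate)
    qed
    ultimately show ?thesis unfolding rle unfolding r_def by blast
  qed
  show ?thesis
    unfolding Let_def
    by (intro exI[of _ C] conjI allI impI C(1)) (use main in blast)+
qed

end
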